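(* Let $t(n)=3^{\frac{n-1}{3}}+\frac{n-1}{3}$, and let $f_1,f_2$ be the functions defined in the context. (1) For every tree $T$ of order $n\geq 4$, \[\Phi(T)\leq 3^{\frac{n-1}{3}}+\frac{n-1}{3},\] with equality if and only if $n\equiv 1\pmod 3$ and $T\cong T^*_n$. (2) For every forest $F$ of order $n$ with $4\leq n\leq 6$: if $\Phi(F)<f_1(n)$, then $\Phi(F)\leq f_2(n)$. For every forest $F$ of order $n\geq 7$: if $\Phi(F)<f_1(n)$, then $\Phi(F)\leq f_2(n)$, with equality if and only if \begin{itemize} \item $F\cong \frac{n-7}{3}P_3\cup T^*_7$, when $n\equiv 1\pmod 3$; \item $F\cong \frac{n-8}{3}P_3\cup T^*_8$ or $F\cong \frac{n-5}{3}P_3\cup K_{1,4}$, when $n\equiv 2\pmod 3$; \item $F\cong K_{1,3}\cup K_{1,4}$, when $n=9$; \item $F\cong \frac{n-12}{3}P_3\cup 3K_{1,3}$, when $n\equiv 0\pmod 3$ and $n\geq 12$. \end{itemize}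
   Context: All graphs are finite, simple, undirected. A dissociation set of a graph $G$ is a set $S\subseteq V(G)$ such that every vertex of the induced subgraph $G[S]$ has degree at most $1$. A dissociation set is maximal if it is not a proper subset of another dissociation set. $\Phi(G)$ denotes the number of maximal dissociation sets of $G$. The order of a graph is its number of vertices. $P_n$ is the path on $n$ vertices, $K_{1,m}$ the star with $m$ leaves; $G\cup H$ is the disjoint union and $kG$ the disjoint union of $k$ copies of $G$ (with $0G$ the empty graph). For $n\geq 4$, $n\equiv 1\pmod 3$, $T^*_n$ is the tree obtained from $\frac{n-1}{3}P_3$ and one extra isolated vertex $w$ by joining $w$ to the central (non-leaf) vertex of each of the $\frac{n-1}{3}$ copies of $P_3$. In particular $T^*_7$ is this tree for $n=7$. $T^*_8$ is the tree of order $8$ obtained from $2K_{1,3}$ by adding one edge joining a leaf of one copy of $K_{1,3}$ to a leaf of the other copy. $f_1(n)=3^{n/3}$ if $n\equiv 0\pmod 3$, $n\ge 3$; $f_1(n)=4\cdot 3^{\frac{n-4}{3}}$ if $n\equiv 1\pmod 3$, $n\geq 4$; $f_1(5)=5$; $f_1(n)=4^2\cdot 3^{\frac{n-8}{3}}$ if $n\equiv 2\pmod 3$, $n\geq 8$. $f_2(4)=3$, $f_2(5)=4$, $f_2(6)=6$; $f_2(n)=11\cdot 3^{\frac{n-7}{3}}$ if $n\equiv 1\pmod 3$, $n\geq 7$; $f_2(n)=15\cdot 3^{\frac{n-8}{3}}$ if $n\equiv 2\pmod 3$, $n\geq 8$; $f_2(9)=20$; $f_2(n)=4^3\cdot 3^{\frac{n-12}{3}}$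 if $n\equiv 0\pmod 3$, $n\geq 12$. *)

theory Defs
  imports Complex_Main
begin

section \<open>Finite simple graphs\<close>

record 'a ugraph =
  verts :: "'a set"
  edges :: "'a set set"

definition simple_graph :: "'a ugraph \<Rightarrow> bool" where
  "simple_graph G \<longleftrightarrow> finite (verts G) \<and>
     (\<forall>e\<in>edges G. \<exists>u\<in>verts G. \<exists>v\<in>verts G. u \<noteq> v \<and> e = {u, v})"

definition adj :: "'a ugraph \<Rightarrow> 'a \<Rightarrow> 'a \<Rightarrow> bool" where
  "adj G u v \<longleftrightarrow> {u, v} \<in> edges G"

definition graph_order :: "'a ugraph \<Rightarrow> nat" where
  "graph_order G = card (verts G)"

definition vertex_degree :: "'a ugraph \<Rightarrow> 'a \<Rightarrow> nat" where
  "vertex_degree G v = card {u \<in> verts G. adj G v u}"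

definition induced :: "'a ugraph \<Rightarrow> 'a set \<Rightarrow> 'a ugraph" where
  "induced G S = \<lparr>verts = S, edges = {e \<in> edges G. e \<subseteq> S}\<rparr>"

definition connected_graph :: "'a ugraph \<Rightarrow> bool" where
  "connected_graph G \<longleftrightarrow> verts G \<noteq> {} \<and> (\<forall>u\<in>verts G. \<forall>v\<in>verts G. (adj G)\<^sup>*\<^sup>* u v)"

definition is_cycle :: "'a ugraph \<Rightarrow> 'a list \<Rightarrow> bool" where
  "is_cycle G p \<longleftrightarrow> length p \<ge> 3 \<and> distinct p \<and> successively (adj G) p \<and> adj G (last p) (hd p)"

definition is_forest :: "'a ugraph \<Rightarrow> bool" where
  "is_forest G \<longleftrightarrow> simple_graph G \<and> (\<nexists>p. is_cycle G p)"

definition is_tree :: "'a ugraph \<Rightarrow> bool" where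
  "is_tree G \<longleftrightarrow> is_forest G \<and> connected_graph G"

definition graph_iso :: "'a ugraph \<Rightarrow> 'b ugraph \<Rightarrow> bool" (infix "\<simeq>" 50) where
  "G \<simeq> H \<longleftrightarrow> (\<exists>f. bij_betw f (verts G) (verts H) \<and>
     (\<forall>u\<in>verts G. \<forall>v\<in>verts G. adj G u v \<longleftrightarrow> adj H (f u) (f v)))"


section \<open>Maximal dissociation sets\<close>

definition dissociation_set :: "'a ugraph \<Rightarrow> 'a set \<Rightarrow> bool" where
  "dissociation_set G S \<longleftrightarrow> S \<subseteq> verts G \<and> (\<forall>v\<in>S. vertex_degree (induced G S) v \<le> 1)"

definition maximal_dissociation_set :: "'a ugraph \<Rightarrow> 'a set \<Rightarrow> bool" where
  "maximal_dissociation_set G S \<longleftrightarrow>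
     dissociation_set G S \<and> (\<nexists>S'. dissociation_set G S' \<and> S \<subset> S')"

definition num_mds :: "'a ugraph \<Rightarrow> nat" ("\<Phi>") where
  "\<Phi> G = card {S. maximal_dissociation_set G S}"


section \<open>Particular graphs\<close>

definition path_graph :: "nat \<Rightarrow> nat ugraph" where
  "path_graph n = \<lparr>verts = {..<n}, edges = {{i, Suc i} | i. Suc i < n}\<rparr>"

text \<open>The star with \<open>m\<close> leaves has centre \<open>0\<close> and leaves \<open>1, \<dots>, m\<close>.\<close>

definition star_graph :: "nat \<Rightarrow> nat ugraph" where
  "star_graph m = \<lparr>verts = {..m}, edges = {{0, i} | i. 1 \<le> i \<and> i \<le> m}\<rparr>"

definition disj_union :: "'a ugraph \<Rightarrow> 'b ugraph \<Rightarrow> ('a + 'b) ugraph" (infixr "\<uplus>" 65) where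
  "G \<uplus> H = \<lparr>verts = verts G <+> verts H,
             edges = (\<lambda>e. Inl ` e) ` edges G \<union> (\<lambda>e. Inr ` e) ` edges H\<rparr>"

definition copies :: "nat \<Rightarrow> 'a ugraph \<Rightarrow> (nat \<times> 'a) ugraph" where
  "copies k G = \<lparr>verts = {..<k} \<times> verts G,
                 edges = {Pair i ` e | i e. i < k \<and> e \<in> edges G}\<rparr>"

definition add_edges :: "'a ugraph \<Rightarrow> 'a set set \<Rightarrow> 'a ugraph" where
  "add_edges G E = \<lparr>verts = verts G, edges = edges G \<union> E\<rparr>"

text \<open>
  \<open>T_star n\<close> is meant for \<open>n \<ge> 4\<close> with \<open>n mod 3 = 1\<close>. The extra vertex \<open>w\<close> is \<open>Inr 0\<close>, and
  \<open>Inl (i, 1)\<close> is the central vertex of the \<open>i\<close>-th path \<open>P\<^sub>3\<close>.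
\<close>

definition T_star :: "nat \<Rightarrow> (nat \<times> nat + nat) ugraph" where
  "T_star n =
     (let k = (n - 1) div 3
      in add_edges (copies k (path_graph 3) \<uplus> path_graph 1) {{Inr 0, Inl (i, 1)} | i. i < k})"

definition T_star_8 :: "(nat \<times> nat) ugraph" where
  "T_star_8 = add_edges (copies 2 (star_graph 3)) {{(0, 1), (1, 1)}}"


section \<open>The extremal functions\<close>

text \<open>
  Both functions are meant for \<open>n \<ge> 4\<close> (\<open>f1\<close> also for \<open>n = 3\<close>). There all
  subtractions and divisions below are exact, so the values are those of the real expressions
  such as \<open>3 powr (n / 3)\<close>; the values at smaller \<open>n\<close> are irrelevant.
\<close>

definition f1 :: "nat \<Rightarrow> nat" where
  "f1 n =
     (if n mod 3 = 0 then 3 ^ (n div 3)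
      else if n mod 3 = 1 then 4 * 3 ^ ((n - 4) div 3)
      else if n = 5 then 5
      else 4 ^ 2 * 3 ^ ((n - 8) div 3))"

definition f2 :: "nat \<Rightarrow> nat" where
  "f2 n =
     (if n = 4 then 3
      else if n = 5 then 4
      else if n = 6 then 6
      else if n = 9 then 20
      else if n mod 3 = 1 then 11 * 3 ^ ((n - 7) div 3)
      else if n mod 3 = 2 then 15 * 3 ^ ((n - 8) div 3)
      else 4 ^ 3 * 3 ^ ((n - 12) div 3))"

end

theory Submission
  imports Defs
begin

text \<open>
  Hanging the components of a forest up at roots, the number of maximal dissociation sets of a tree is
  computed by a bilinear recursion on six numbers counting the possible states of the root.
  The tree bound \<open>tb\<close> is proved by induction on the order. Every tree can be rerooted at a vertex all
  of whose branches but at most one are among \<open>P\<^sub>1\<close>, \<open>P\<^sub>2\<close>, \<open>P\<^sub>3\<close> and \<open>K\<^sub>1\<^sub>,\<^sub>3\<close> hung at a leaf. Three leaves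
  or two such branches at the same vertex, unless both are leaves or both are \<open>P\<^sub>3\<close>, allow \<open>\<Phi>\<close> to be estimated by a nonnegative
  combination of the values of \<open>\<Phi>\<close> at smaller trees (the coefficients come from linear programming), and
  this combination stays below \<open>tb\<close> because \<open>tb n\<close> grows like \<open>3 powr (n / 3)\<close>; what remains are the trees
  \<open>T_star n\<close>. Only for finitely many small orders the estimates are too weak, and there all state vectors
  are enumerated. For forests, \<open>\<Phi>\<^sup>3 / 3\<^sup>n\<close> is multiplicative over components; it is \<open>1\<close> for \<open>P\<^sub>3\<close> and so small
  for all other trees that at most three components different from \<open>P\<^sub>3\<close> can occur near the maximum.
\<close>

section \<open>Rooted trees and their state vectors\<close>

text \<open>\<open>Join R W\<close> adds an edge between the two roots and keeps the root of
  \<open>R\<close>. With this constructor, moving the root along an edge is a swap of two arguments,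
  and independence of \<open>\<Phi>\<close> from the root becomes the symmetry of a bilinear form.
  Six states are needed because an excluded root may still have to be blocked by its parent, and
  because matching the root to its parent blocks the other neighbours of the root.

  The bound \<open>tb\<close> alone does not settle the forests: its integer part at order 9 is 21,
  but \<open>f2 9 = 20\<close>. The induction therefore also carries the sharper table
  \<open>sc\<close> up to order 9. This makes K_{1,4} and \<open>T_star_8\<close> exceptions besides
  the trees \<open>T_star n\<close>, although both lie strictly below \<open>tb\<close>. The value
  \<open>sc 9 = 19\<close> is also needed inside the induction, where several estimates have a
  margin below 0.2 and succeed only after rounding to integers.\<close>

datatype 'a rtree = Vtx 'a | Join "'a rtree" "'a rtree"

type_synonym sv = "nat \<times> nat \<times> nat \<times> nat \<times> nat \<times> nat"

text \<open>
  The six components count the states \<open>CA\<close>, ..., \<open>CF\<close> of the root defined below. With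
  \<open>o = a + b + c\<close> and \<open>g = a + d + e\<close> the recursion says, for instance, that \<open>o\<close> is multiplied by \<open>g'\<close>:
  \<open>g\<close> is the value of \<open>\<Phi>\<close> at the tree and \<open>o\<close> its value after the root has been deleted.
\<close>

fun joinv :: "sv \<Rightarrow> sv \<Rightarrow> sv" where
  "joinv (a, b, c, d, e, f) (a', b', c', d', e', f') =
     (a * (a' + d' + e') + b * (d' + e') + c * d', b * a' + c * e', c * a',
      d * (a' + b' + c') + f * f', e * (a' + b'), f * (a' + b' + c'))"

text \<open>For a single vertex the empty set is in state \<open>CC\<close>, and the root alone is
  in both \<open>CE\<close> and \<open>CF\<close>.\<close>

primrec vec :: "'a rtree \<Rightarrow> sv" where
  "vec (Vtx x) = (0, 0, 1, 0, 1, 1)"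
| "vec (Join R W) = joinv (vec R) (vec W)"

definition va :: "'a rtree \<Rightarrow> nat" where "va T = fst (vec T)"
definition vb :: "'a rtree \<Rightarrow> nat" where "vb T = fst (snd (vec T))"
definition vc :: "'a rtree \<Rightarrow> nat" where "vc T = fst (snd (snd (vec T)))"
definition vd :: "'a rtree \<Rightarrow> nat" where "vd T = fst (snd (snd (snd (vec T))))"
definition ve :: "'a rtree \<Rightarrow> nat" where "ve T = fst (snd (snd (snd (snd (vec T)))))"
definition vf :: "'a rtree \<Rightarrow> nat" where "vf T = snd (snd (snd (snd (snd (vec T)))))"

lemmas v_defs = va_def vb_def vc_def vd_def ve_def vf_def

lemma vec_eq: "vec T = (va T, vb T, vc T, vd T, ve T, vf T)"
  by (simp add: v_defs)

lemma v_Vtx [simp]: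
  "va (Vtx x) = 0" "vb (Vtx x) = 0" "vc (Vtx x) = 1" "vd (Vtx x) = 0" "ve (Vtx x) = 1" "vf (Vtx x) = 1"
  by (simp_all add: v_defs)

definition vo :: "'a rtree \<Rightarrow> nat" where "vo T = va T + vb T + vc T"
definition vg :: "'a rtree \<Rightarrow> nat" where "vg T = va T + vd T + ve T"

lemma v_Join [simp]:
  "va (Join R W) = va R * (va W + vd W + ve W) + vb R * (vd W + ve W) + vc R * vd W"
  "vb (Join R W) = vb R * va W + vc R * ve W"
  "vc (Join R W) = vc R * va W"
  "vd (Join R W) = vd R * (va W + vb W + vc W) + vf R * vf W"
  "ve (Join R W) = ve R * (va W + vb W)"
  "vf (Join R W) = vf R * (va W + vb W + vc W)"
  using vec_eq[of "Join R W"] vec_eq[of R] vec_eq[of W] by simp_all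

lemma vo_Vtx: "vo (Vtx x) = 1" and vo_Join: "vo (Join R W) = vo R * vg W"
  by (simp_all add: vo_def vg_def algebra_simps)

lemma vf_Join': "vf (Join R W) = vf R * vo W"
  by (simp add: vo_def)

section \<open>Order of a tree and inequalities between the root states\<close>

primrec nsz :: "'a rtree \<Rightarrow> nat" where
  "nsz (Vtx x) = 1"
| "nsz (Join R W) = nsz R + nsz W"

lemma nsz_pos [simp]: "nsz T > 0" by (induction T) auto

lemma nsz_neq0 [simp]: "nsz T \<noteq> 0" using nsz_pos[of T] by simp

text \<open>Over the branches of the root, \<open>vc\<close>, \<open>ve\<close> and
  \<open>vf\<close> are the products of \<open>va\<close>, \<open>va + vb\<close> and
  \<open>va + vb + vc\<close>, so they increase in this order.\<close>

lemma vc_le_ve: "vc T \<le> ve T"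
  by (induction T) (auto intro!: mult_mono)

lemma ve_le_vf: "ve T \<le> vf T"
  by (induction T) (auto intro!: mult_mono)

text \<open>Adding \<open>va\<close> on both sides turns this into \<open>vo T <= vg T\<close>:
  deleting the root does not increase \<open>\<Phi>\<close>. The term \<open>vc R * ve W\<close>,
  which no root state of \<open>R\<close> alone can pay for, is absorbed by
  \<open>vf R * vf W\<close>, where the two roots are matched.\<close>

lemma vbc_le_vde: "vb T + vc T \<le> vd T + ve T"
proof (induction T)
  case (Join R W)
  have "vb R * va W + vc R * va W \<le> vd R * va W + ve R * va W"
    using mult_le_mono1[OF Join.IH(1), of "va W"] by (simp add: algebra_simps)
  moreover have "vc R * ve W \<le> vf R * vf W"
    using le_trans[OF vc_le_ve ve_le_vf] ve_le_vf by (intro mult_mono) auto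
  ultimately show ?case by (simp add: algebra_simps)
qed simp

lemma vo_le_vg: "vo T \<le> vg T"
  using vbc_le_vde[of T] by (simp add: vo_def vg_def)

text \<open>Over the branches of the root, \<open>vf\<close> is the product of \<open>vo\<close> and
  \<open>vo\<close> is the product of \<open>vg\<close>.\<close>

lemma vf_le_vo: "vf T \<le> vo T"
proof (induction T)
  case (Join R W)
  then show ?case unfolding vf_Join' vo_Join using vo_le_vg[of W] by (intro mult_mono) auto
qed (simp add: vo_Vtx)

lemmas v_ineqs = vc_le_ve ve_le_vf vbc_le_vde vf_le_vo

subsection \<open>Reordering and rerooting\<close>

inductive req :: "'a rtree \<Rightarrow> 'a rtree \<Rightarrow> bool" where
  refl [simp, intro]: "req T T"
| perm: "req (Join (Join R A) B) (Join (Join R B) A)"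
| cong: "req R R' \<Longrightarrow> req W W' \<Longrightarrow> req (Join R W) (Join R' W')"
| trans: "req T T' \<Longrightarrow> req T' T'' \<Longrightarrow> req T T''"

text \<open>\<open>swap\<close> moves the root to the other end of the edge joining \<open>A\<close>
  and \<open>B\<close>; vertices and edges stay the same.\<close>

inductive ueq :: "'a rtree \<Rightarrow> 'a rtree \<Rightarrow> bool" where
  req: "req T T' \<Longrightarrow> ueq T T'"
| swap: "ueq (Join A B) (Join B A)"
| trans: "ueq T T' \<Longrightarrow> ueq T' T'' \<Longrightarrow> ueq T T''"

declare ueq.trans [trans]

lemma req_vec: "req T T' \<Longrightarrow> vec T = vec T'"
proof (induction rule: req.induct)
  case (perm R A B)
  show ?case by (simp add: vec_eq algebra_simps)
qed auto

lemma req_nsz: "req T T' \<Longrightarrow> nsz T = nsz T'"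
  by (induction rule: req.induct) auto

lemma req_vg: "req T T' \<Longrightarrow> vg T = vg T'"
  by (simp add: vg_def v_defs req_vec)

text \<open>The bilinear form for \<open>vg (Join A B)\<close> is symmetric in its two arguments, so
  independence of the root is pure algebra.\<close>

lemma ueq_vg: "ueq T T' \<Longrightarrow> vg T = vg T'"
proof (induction rule: ueq.induct)
  case (swap A B)
  show ?case by (simp add: vg_def algebra_simps)
qed (auto simp: req_vg)

lemma ueq_nsz: "ueq T T' \<Longrightarrow> nsz T = nsz T'"
  by (induction rule: ueq.induct) (auto simp: req_nsz)

primrec rt :: "'a rtree \<Rightarrow> 'a" where
  "rt (Vtx x) = x"
| "rt (Join R W) = rt R"

primrec kids :: "'a rtree \<Rightarrow> 'a rtree list" where
  "kids (Vtx x) = []"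
| "kids (Join R W) = kids R @ [W]"

abbreviation att :: "'a rtree \<Rightarrow> 'a rtree list \<Rightarrow> 'a rtree" where
  "att \<equiv> foldl Join"

lemma att_kids: "att (Vtx (rt T)) (kids T) = T"
  by (induction T) auto

lemma req_att_cong: "req R R' \<Longrightarrow> req (att R Ws) (att R' Ws)"
  by (induction Ws arbitrary: R R') (auto intro: req.cong)

lemma req_att_last: "req (att (Join R A) Ws) (Join (att R Ws) A)"
proof (induction Ws arbitrary: R)
  case (Cons B Ws)
  have "req (att (Join (Join R A) B) Ws) (att (Join (Join R B) A) Ws)"
    by (intro req_att_cong req.perm)
  with Cons[of "Join R B"] show ?case by (auto intro: req.trans)
qed simp

lemma req_att_split: "req (att R (xs @ A # ys)) (Join (att R (xs @ ys)) A)"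
  using req_att_last[of "att R xs" A ys] by simp

lemma req_extract:
  assumes "A \<in> set (kids T)"
  obtains S xs ys where "kids T = xs @ A # ys" "S = att (Vtx (rt T)) (xs @ ys)" "req T (Join S A)"
proof -
  obtain xs ys where "kids T = xs @ A # ys" using assms by (meson split_list)
  with that req_att_split[of "Vtx (rt T)" xs A ys] att_kids[of T] show ?thesis by metis
qed

subsection \<open>Small branches\<close>

definition isL :: "'a rtree \<Rightarrow> bool" where "isL T \<longleftrightarrow> (\<exists>x. T = Vtx x)"
definition isP2 :: "'a rtree \<Rightarrow> bool" where "isP2 T \<longleftrightarrow> (\<exists>x y. T = Join (Vtx x) (Vtx y))"
definition isP3c :: "'a rtree \<Rightarrow> bool" where
  "isP3c T \<longleftrightarrow> (\<exists>x y z. T = Join (Join (Vtx x) (Vtx y)) (Vtx z))"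
definition isP3e :: "'a rtree \<Rightarrow> bool" where
  "isP3e T \<longleftrightarrow> (\<exists>x y z. T = Join (Vtx x) (Join (Vtx y) (Vtx z)))"
definition isP3 :: "'a rtree \<Rightarrow> bool" where "isP3 T \<longleftrightarrow> isP3c T \<or> isP3e T"
text \<open>Since \<open>isP3\<close> admits both rootings of P_3, this contains P_4 rooted at an
  end besides K_{1,3} rooted at a leaf.\<close>

definition isK :: "'a rtree \<Rightarrow> bool" where "isK T \<longleftrightarrow> (\<exists>x A. isP3 A \<and> T = Join (Vtx x) A)"
definition item :: "'a rtree \<Rightarrow> bool" where "item T \<longleftrightarrow> isL T \<or> isP2 T \<or> isP3 T \<or> isK T"

lemmas is_defs = isL_def isP2_def isP3c_def isP3e_def isP3_def isK_def

lemma nsz_items: "isL T \<Longrightarrow> nsz T = 1" "isP2 T \<Longrightarrow> nsz T = 2" "isP3 T \<Longrightarrow> nsz T = 3" "isK T \<Longrightarrow> nsz T = 4"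
  by (auto simp: is_defs)

lemma nsz_le3_item: "nsz T \<le> 3 \<Longrightarrow> item T"
proof -
  assume a: "nsz T \<le> 3"
  have 1: "nsz U = 1 \<Longrightarrow> \<exists>x. U = Vtx x" for U :: "'a rtree"
    by (cases U) (auto simp: add_is_1)
  have 2: "nsz U = 2 \<Longrightarrow> \<exists>x y. U = Join (Vtx x) (Vtx y)" for U :: "'a rtree"
  proof (cases U)
    case (Join R W)
    moreover assume "nsz U = 2"
    ultimately have "nsz R + nsz W = 2" by simp
    then have "nsz R = 1" "nsz W = 1" using nsz_pos[of R] nsz_pos[of W] by linarith+
    then show ?thesis using Join 1 by blast
  qed auto
  show ?thesis
  proof (cases T)
    case (Join R W)
    with a have "nsz R = 1 \<and> nsz W = 1 \<or> nsz R = 2 \<and> nsz W = 1 \<or> nsz R = 1 \<and> nsz W = 2"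
      using nsz_pos[of R] nsz_pos[of W] by (auto simp del: nsz_pos)
    then show ?thesis using Join 1 2 unfolding item_def is_defs by metis
  qed (auto simp: item_def is_defs)
qed

text \<open>A walk into the offending branch: while \<open>U\<close> has a branch \<open>A\<close>
  that is no item, everything outside \<open>A\<close> is collected around the root of
  \<open>U\<close>, and \<open>A\<close> becomes the branch to look into. As \<open>A\<close> is
  smaller than \<open>U\<close>, the walk ends at a vertex whose branches away from the start are
  all items.\<close>

lemma descend:
  assumes "\<not> item U"
  shows "\<exists>R W. ueq (Join T U) (Join W R) \<and> \<not> item W \<and> (\<forall>A\<in>set (kids W). item A)"
  using assms
proof (induction "nsz U" arbitrary: T U rule: less_induct)
  case less
  show ?case
  proof (cases "\<forall>A\<in>set (kids U). item A")
    case True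
    then show ?thesis using less.prems ueq.swap by blast
  next
    case False
    then obtain A where A: "A \<in> set (kids U)" "\<not> item A" by blast
    then obtain S where S: "req U (Join S A)" using req_extract by metis
    have sz: "nsz A < nsz U" using req_nsz[OF S] by simp
    have "ueq (Join T U) (Join T (Join S A))" by (intro ueq.req req.cong S req.refl)
    also have "ueq \<dots> (Join (Join S A) T)" by (rule ueq.swap)
    also have "ueq \<dots> (Join (Join S T) A)" by (intro ueq.req req.perm)
    finally have "ueq (Join T U) (Join (Join S T) A)" .
    with less.hyps[OF sz A(2), of "Join S T"] show ?thesis by (blast intro: ueq.trans)
  qed
qed

text \<open>If the far side \<open>R\<close> found by the walk is itself an item, it is just one
  more item branch of \<open>W\<close>. Otherwise neither side of the edge is an item.\<close>

lemma decompose: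
  "(\<exists>W. ueq T W \<and> (\<forall>A\<in>set (kids W). item A)) \<or>
   (\<exists>R W. ueq T (Join W R) \<and> \<not> item W \<and> (\<forall>A\<in>set (kids W). item A) \<and> \<not> item R)"
proof (cases "\<forall>A\<in>set (kids T). item A")
  case True
  then show ?thesis using ueq.req req.refl by blast
next
  case False
  then obtain A where A: "A \<in> set (kids T)" "\<not> item A" by blast
  then obtain S where S: "req T (Join S A)" using req_extract by metis
  obtain R W where RW: "ueq (Join S A) (Join W R)" "\<not> item W" "\<forall>A\<in>set (kids W). item A"
    using descend[OF A(2), of S] by blast
  have T: "ueq T (Join W R)" using S RW(1) by (blast intro: ueq.intros)
  show ?thesis
  proof (cases "item R")
    case True
    then have "\<forall>A\<in>set (kids (Join W R)). item A" using RW by auto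
    with T show ?thesis by blast
  qed (use T RW in blast)
qed

section \<open>Reducible pairs of branches and the shapes avoiding them\<close>

definition pairform :: "('a rtree \<Rightarrow> bool) \<Rightarrow> ('a rtree \<Rightarrow> bool) \<Rightarrow> 'a rtree \<Rightarrow> bool" where
  "pairform P Q T \<longleftrightarrow> (\<exists>S A B. P A \<and> Q B \<and> ueq T (Join (Join S A) B))"

definition leaves3 :: "'a rtree \<Rightarrow> bool" where
  "leaves3 T \<longleftrightarrow> (\<exists>S x y z. ueq T (Join (Join (Join S (Vtx x)) (Vtx y)) (Vtx z)))"

definition reducible :: "'a rtree \<Rightarrow> bool" where
  "reducible T \<longleftrightarrow> leaves3 T \<or> pairform isP2 isP2 T \<or> pairform isL isP2 T \<or> pairform isP3 isP2 T \<or>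
     pairform isK isP2 T \<or> pairform isL isP3 T \<or> pairform isL isK T \<or> pairform isK isK T \<or> pairform isP3 isK T"

lemma pairform_list:
  assumes "req T (att (Vtx x) (xs @ A # ys @ B # zs))"
  shows "P A \<and> Q B \<Longrightarrow> pairform P Q T" "P B \<and> Q A \<Longrightarrow> pairform P Q T"
proof -
  let ?S = "att (Vtx x) (xs @ ys @ zs)"
  have "req (att (Vtx x) (xs @ A # ys @ B # zs)) (Join (att (Vtx x) (xs @ ys @ B # zs)) A)"
    by (rule req_att_split)
  moreover have "req (att (Vtx x) (xs @ ys @ B # zs)) (Join ?S B)"
    using req_att_split[of "Vtx x" "xs @ ys" B zs] by simp
  ultimately have 1: "req T (Join (Join ?S B) A)"
    using assms by (meson req.cong req.refl req.trans)
  then have 2: "req T (Join (Join ?S A) B)" by (meson req.perm req.trans)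
  show "P A \<and> Q B \<Longrightarrow> pairform P Q T" "P B \<and> Q A \<Longrightarrow> pairform P Q T"
    unfolding pairform_def using 1 2 ueq.req by metis+
qed

lemma two_members:
  assumes "A \<in> set Ws" "length Ws \<ge> 2"
  obtains B where "\<exists>xs ys zs. Ws = xs @ A # ys @ B # zs \<or> Ws = xs @ B # ys @ A # zs"
    and "B \<in> set Ws"
proof -
  obtain us vs where Ws: "Ws = us @ A # vs" using assms(1) by (meson split_list)
  show ?thesis
  proof (cases vs)
    case (Cons B vs')
    then have "Ws = us @ A # [] @ B # vs'" using Ws by simp
    then show ?thesis using that by (metis in_set_conv_decomp append_Cons append_assoc)
  next
    case Nil
    then obtain B us' where "us = B # us'" using Ws assms(2) by (cases us) auto
    then have "Ws = [] @ B # us' @ A # []" using Ws Nil by simp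
    then show ?thesis using that by (metis in_set_conv_decomp)
  qed
qed

lemma distinct_members:
  assumes "A \<in> set Ws" "B \<in> set Ws" "A \<noteq> B"
  shows "\<exists>xs ys zs. Ws = xs @ A # ys @ B # zs \<or> Ws = xs @ B # ys @ A # zs"
proof -
  obtain us vs where Ws: "Ws = us @ A # vs" using assms(1) by (meson split_list)
  then consider "B \<in> set us" | "B \<in> set vs" using assms by auto
  then show ?thesis
  proof cases
    case 1
    then obtain us1 us2 where "us = us1 @ B # us2" by (meson split_list)
    then have "Ws = us1 @ B # us2 @ A # vs" using Ws by simp
    then show ?thesis by blast
  next
    case 2
    then obtain vs1 vs2 where "vs = vs1 @ B # vs2" by (meson split_list)
    then show ?thesis using Ws by blast
  qed
qed

text \<open>\<open>Rs\<close> leaves room for branches that are no items. Every item next to a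
  \<open>K\<close> or a P_2 forms one of the forbidden pairs, so such a branch is the only item.
  Next to a leaf only leaves remain, and \<open>leaves3\<close> limits them to two.\<close>

lemma irreducible_kids:
  assumes "\<not> reducible T" "req T (att (Vtx x) (Ws @ Rs))" "\<forall>A\<in>set Ws. item A"
  shows "(\<exists>A. isK A \<and> Ws = [A]) \<or> (\<exists>A. isP2 A \<and> Ws = [A]) \<or> (\<exists>A. isL A \<and> Ws = [A]) \<or>
    (\<exists>A B. isL A \<and> isL B \<and> Ws = [A, B]) \<or> (\<forall>A\<in>set Ws. isP3 A)"
proof -
  have pair: "\<not> (P A \<and> Q B) \<and> \<not> (P B \<and> Q A)"
    if "Ws = xs @ A # ys @ B # zs" "\<not> pairform P Q T" for xs ys zs A B P Q
    using pairform_list[of T x xs A ys B "zs @ Rs" P Q] assms(2) that by auto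
  have two: "\<exists>B\<in>set Ws. (\<forall>P Q. \<not> pairform P Q T \<longrightarrow> \<not> (P A \<and> Q B) \<and> \<not> (P B \<and> Q A))"
    if "A \<in> set Ws" "length Ws \<ge> 2" for A
    using two_members[OF that] pair by metis
  have single: "Ws = [A]" if "A \<in> set Ws" "\<not> length Ws \<ge> 2" for A
    using that by (cases Ws; cases "tl Ws") auto
  have red: "\<not> pairform isP2 isP2 T" "\<not> pairform isL isP2 T" "\<not> pairform isP3 isP2 T"
    "\<not> pairform isK isP2 T" "\<not> pairform isL isP3 T" "\<not> pairform isL isK T" "\<not> pairform isK isK T"
    "\<not> pairform isP3 isK T"
    using assms(1) by (simp_all add: reducible_def)
  consider (K) A where "A \<in> set Ws" "isK A" | (P2) A where "A \<in> set Ws" "isP2 A"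
    | (L) A where "A \<in> set Ws" "isL A" "\<forall>B\<in>set Ws. isL B \<or> isP3 B" | (P3) "\<forall>A\<in>set Ws. isP3 A"
    using assms(3) unfolding item_def by blast
  then show ?thesis
  proof cases
    case K
    have "\<not> length Ws \<ge> 2"
    proof
      assume "length Ws \<ge> 2"
      then obtain B where "B \<in> set Ws" and B: "\<And>P Q. \<not> pairform P Q T \<Longrightarrow> \<not> (P A \<and> Q B) \<and> \<not> (P B \<and> Q A)"
        using two[OF K(1)] by metis
      then have "item B" using assms(3) by blast
      then show False
        using B[of isL isK] B[of isP3 isK] B[of isK isK] B[of isK isP2] red K(2) unfolding item_def by simp
    qed
    then show ?thesis using single K by blast
  next
    case P2
    have "\<not> length Ws \<ge> 2"
    proof
      assume "length Ws \<ge> 2"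
      then obtain B where "B \<in> set Ws" and B: "\<And>P Q. \<not> pairform P Q T \<Longrightarrow> \<not> (P A \<and> Q B) \<and> \<not> (P B \<and> Q A)"
        using two[OF P2(1)] by metis
      then have "item B" using assms(3) by blast
      then show False
        using B[of isL isP2] B[of isP3 isP2] B[of isK isP2] B[of isP2 isP2] red P2(2) unfolding item_def by simp
    qed
    then show ?thesis using single P2 by blast
  next
    case L
    have allL: "isL B" if BW: "B \<in> set Ws" for B
    proof (rule ccontr)
      assume "\<not> isL B"
      then have B: "isP3 B" using L(3) BW by blast
      have "A \<noteq> B" using L(2) \<open>\<not> isL B\<close> by blast
      then obtain xs ys zs where "Ws = xs @ A # ys @ B # zs \<or> Ws = xs @ B # ys @ A # zs"
        using distinct_members[OF L(1) BW] by metis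
      then show False using pair[of xs A ys B zs isL isP3] pair[of xs B ys A zs isL isP3] red(5) L(2) B by blast
    qed
    have "length Ws < 3"
    proof (rule ccontr)
      assume "\<not> length Ws < 3"
      then obtain a b c Ws' where Ws: "Ws = a # b # c # Ws'"
        by (cases Ws; cases "tl Ws"; cases "tl (tl Ws)") auto
      have "isL a" "isL b" "isL c" using allL Ws by auto
      then obtain p q s where abc: "a = Vtx p" "b = Vtx q" "c = Vtx s" by (auto simp: isL_def)
      let ?S = "att (Vtx x) (Ws' @ Rs)"
      have "req (att (Vtx x) (Ws @ Rs)) (Join (Join (Join ?S c) b) a)"
        using req_att_split[of "Vtx x" "[]" a "b # c # Ws' @ Rs"] req_att_split[of "Vtx x" "[]" b "c # Ws' @ Rs"]
          req_att_split[of "Vtx x" "[]" c "Ws' @ Rs"] unfolding Ws append_Nil append_Cons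
        by (blast intro: req.cong req.refl req.trans)
      then have "leaves3 T" unfolding leaves3_def abc using assms(2) by (meson req.trans ueq.req)
      then show False using assms(1) by (simp add: reducible_def)
    qed
    moreover have "length Ws \<noteq> 0" using L(1) by auto
    ultimately have "length Ws = 1 \<or> length Ws = 2" by linarith
    then show ?thesis
    proof
      assume "length Ws = 1"
      then show ?thesis using single[OF L(1)] L(2) by auto
    next
      assume "length Ws = 2"
      then obtain a b where "Ws = [a, b]" by (cases Ws; cases "tl Ws") auto
      then show ?thesis using allL by auto
    qed
  qed auto
qed

text \<open>When a large branch \<open>R\<close> remains, \<open>W\<close> is not an item. This
  excludes a single P_2, one leaf, two leaves or a single P_3 as its branches, because
  \<open>W\<close> would then be P_3, P_2, P_3 or \<open>K\<close>. Without \<open>R\<close> the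
  first three are too small.\<close>

lemma tree_shapes:
  assumes "nsz T \<ge> 4" "\<not> reducible T"
  obtains (X) x K where "isK K" "ueq T (Join (Vtx x) K)"
  | (star) x Ws where "\<forall>A\<in>set Ws. isP3 A" "ueq T (att (Vtx x) Ws)"
  | (XR) x K R where "isK K" "nsz R \<ge> 4" "ueq T (Join (Join (Vtx x) K) R)"
  | (starR) x Ws R where "\<forall>A\<in>set Ws. isP3 A" "length Ws \<ge> 2" "nsz R \<ge> 4" "ueq T (Join (att (Vtx x) Ws) R)"
proof -
  have red: "\<not> reducible U" if "ueq T U" for U
    using assms(2) that unfolding reducible_def leaves3_def pairform_def by (meson ueq.trans)
  consider (1) W where "ueq T W" "\<forall>A\<in>set (kids W). item A"
    | (2) R W where "ueq T (Join W R)" "\<not> item W" "\<forall>A\<in>set (kids W). item A" "\<not> item R"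
    using decompose by blast
  then show ?thesis
  proof cases
    case 1
    have W: "W = att (Vtx (rt W)) (kids W)" by (simp add: att_kids)
    have "req W (att (Vtx (rt W)) (kids W @ []))" using W by (metis append_Nil2 req.refl)
    from irreducible_kids[OF red[OF 1(1)] this 1(2)]
    consider A where "isK A" "kids W = [A]" | A where "isP2 A" "kids W = [A]" | A where "isL A" "kids W = [A]"
      | A B where "isL A" "isL B" "kids W = [A, B]" | "\<forall>A\<in>set (kids W). isP3 A" by blast
    then show ?thesis
    proof cases
      case (1 A)
      then show ?thesis using X[of A "rt W"] \<open>ueq T W\<close> W by simp
    next
      case 5
      then show ?thesis using star \<open>ueq T W\<close> W by metis
    next
      case (2 A)
      then have "nsz W = 3" using nsz_items(2)[of A] by (subst W) simp
      then show ?thesis using assms(1) ueq_nsz[OF \<open>ueq T W\<close>] by simp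
    next
      case (3 A)
      then have "nsz W = 2" using nsz_items(1)[of A] by (subst W) simp
      then show ?thesis using assms(1) ueq_nsz[OF \<open>ueq T W\<close>] by simp
    next
      case (4 A B)
      then have "nsz W = 3" using nsz_items(1)[of A] nsz_items(1)[of B] by (subst W) simp
      then show ?thesis using assms(1) ueq_nsz[OF \<open>ueq T W\<close>] by simp
    qed
  next
    case 2
    have W: "W = att (Vtx (rt W)) (kids W)" by (simp add: att_kids)
    have R: "nsz R \<ge> 4" using 2(4) nsz_le3_item[of R] by fastforce
    have "Join W R = att (Vtx (rt W)) (kids W @ [R])" using W by simp
    then have "req (Join W R) (att (Vtx (rt W)) (kids W @ [R]))" by (metis req.refl)
    from irreducible_kids[OF red[OF 2(1)] this 2(3)]
    consider A where "isK A" "kids W = [A]" | A where "isP2 A" "kids W = [A]" | A where "isL A" "kids W = [A]"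
      | A B where "isL A" "isL B" "kids W = [A, B]" | "\<forall>A\<in>set (kids W). isP3 A" by blast
    then show ?thesis
    proof cases
      case (1 A)
      then show ?thesis using XR[of A R "rt W"] 2(1) W R by simp
    next
      case (2 A)
      then show ?thesis using W \<open>\<not> item W\<close> unfolding item_def is_defs by (metis foldl.simps)
    next
      case (3 A)
      then show ?thesis using W \<open>\<not> item W\<close> unfolding item_def is_defs by (metis foldl.simps)
    next
      case (4 A B)
      then show ?thesis using W \<open>\<not> item W\<close> unfolding item_def is_defs by (metis foldl.simps)
    next
      case 5
      have "length (kids W) \<ge> 2"
      proof (rule ccontr)
        assume "\<not> ?thesis"
        then consider "kids W = []" | A where "kids W = [A]" by (cases "kids W"; cases "tl (kids W)") auto
        then show False
        proof cases
          case 1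
          then show False using W \<open>\<not> item W\<close> unfolding item_def isL_def by (metis foldl.simps(1))
        next
          case (2 A)
          then have "isK W" using W 5 unfolding isK_def by (metis foldl.simps list.set_intros(1))
          then show False using \<open>\<not> item W\<close> by (simp add: item_def)
        qed
      qed
      then show ?thesis using starR[OF 5] 2(1) W R by metis
    qed
  qed
qed

subsection \<open>State vectors of small trees\<close>

text \<open>The lists arise by closing the vector of a single vertex under \<open>joinv\<close>,
  order by order. Different rooted trees may share a vector: the nine of order 5 yield only
  eight.\<close>

definition vecs1 :: "sv list" where "vecs1 = [(0, 0, 1, 0, 1, 1)]"

definition vecs2 :: "sv list" where "vecs2 = [(0, 1, 0, 1, 0, 1)]"

definition vecs3 :: "sv list" where "vecs3 = [(1, 0, 0, 1, 1, 1), (1, 0, 0, 2, 0, 1)]"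

definition vecs4 :: "sv list" where "vecs4 = [(1, 0, 0, 2, 0, 1), (1, 0, 0, 3, 0, 1), (1, 1, 1, 1, 1, 1), (2, 0, 1, 1, 1, 1)]"

definition vecs5 :: "sv list" where "vecs5 = [(1, 0, 0, 2, 1, 1), (1, 0, 0, 3, 0, 1), (1, 0, 0, 4, 0, 1), (1, 1, 1, 1, 2, 3), (1, 1, 2, 1, 2, 3), (2, 0, 1,
    1, 1, 1), (2, 1, 0, 2, 0, 1), (3, 0, 1, 1, 1, 1)]"

definition vecs6 :: "sv list" where "vecs6 = [(1, 0, 0, 3, 0, 1), (1, 0, 0, 4, 0, 1), (1, 0, 0, 5, 0, 1), (1, 1, 2, 1, 2, 3), (1, 1, 3, 1, 3, 4), (1, 2, 1,
    3, 2, 3), (1, 2, 1, 3, 2, 4), (2, 0, 2, 1, 3, 3), (2, 1, 0, 2, 0, 1), (2, 1, 0, 4, 0, 3), (2, 1, 1, 1, 1, 1),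
    (2, 2, 0, 4, 0, 3), (3, 0, 0, 2, 1, 1), (3, 0, 0, 3, 0, 1), (3, 0, 1, 1, 1, 1), (3, 1, 0, 2, 0, 1), (4, 0, 1,
    1, 1, 1)]"

definition vecs7 :: "sv list" where "vecs7 = [(1, 0, 0, 3, 1, 1), (1, 0, 0, 4, 0, 1), (1, 0, 0, 5, 0, 1), (1, 0, 0, 6, 0, 1), (1, 1, 2, 1, 3, 4), (1, 1, 3,
    1, 3, 4), (1, 1, 4, 1, 4, 5), (1, 2, 1, 3, 2, 4), (1, 3, 1, 4, 2, 5), (1, 3, 2, 3, 2, 4), (2, 0, 2, 1, 3, 3),
    (2, 0, 3, 1, 4, 4), (2, 1, 3, 1, 3, 3), (2, 2, 0, 4, 0, 3), (2, 3, 0, 5, 0, 4), (3, 0, 0, 2, 1, 1), (3, 0, 0,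
    3, 0, 1), (3, 0, 0, 4, 0, 1), (3, 0, 0, 4, 2, 3), (3, 0, 0, 7, 0, 3), (3, 0, 1, 1, 1, 1), (3, 0, 3, 1, 3, 3),
    (3, 1, 0, 2, 0, 1), (3, 1, 0, 6, 0, 3), (3, 1, 0, 7, 0, 4), (3, 2, 1, 3, 3, 4), (3, 2, 1, 4, 3, 4), (4, 0, 0,
    2, 1, 1), (4, 0, 0, 3, 0, 1), (4, 0, 0, 4, 2, 3), (4, 0, 0, 7, 0, 3), (4, 0, 1, 1, 1, 1), (4, 0, 2, 3, 3, 3),
    (4, 0, 2, 3, 4, 4), (4, 1, 0, 2, 0, 1), (5, 0, 1, 1, 1, 1), (6, 2, 1, 2, 1, 1), (7, 1, 1, 2, 1, 1), (8, 0, 1,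
    2, 1, 1)]"

definition vecs8 :: "sv list" where "vecs8 = [(1, 0, 0, 4, 0, 1), (1, 0, 0, 5, 0, 1), (1, 0, 0, 6, 0, 1), (1, 0, 0, 7, 0, 1), (1, 1, 3, 1, 3, 4), (1, 1, 4,
    1, 4, 5), (1, 1, 5, 1, 5, 6), (1, 3, 1, 4, 2, 4), (1, 3, 1, 4, 2, 5), (1, 3, 2, 3, 2, 4), (1, 3, 2, 3, 3, 6),
    (1, 3, 3, 3, 3, 6), (1, 4, 1, 5, 2, 6), (1, 4, 2, 4, 2, 5), (2, 0, 3, 1, 4, 4), (2, 0, 4, 1, 5, 5), (2, 1, 3,
    1, 3, 3), (2, 1, 4, 1, 4, 4), (2, 1, 6, 1, 8, 9), (2, 1, 7, 1, 8, 9), (2, 1, 8, 1, 8, 9), (2, 2, 0, 4, 0, 3),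
    (2, 2, 0, 5, 0, 4), (2, 3, 0, 5, 0, 4), (2, 4, 0, 6, 0, 5), (3, 0, 0, 3, 0, 1), (3, 0, 0, 3, 1, 1), (3, 0, 0,
    4, 0, 1), (3, 0, 0, 5, 0, 1), (3, 0, 0, 7, 0, 3), (3, 0, 0, 10, 0, 3), (3, 0, 3, 1, 3, 3), (3, 0, 4, 1, 4, 4),
    (3, 1, 0, 2, 0, 1), (3, 1, 0, 7, 0, 4), (3, 1, 1, 1, 1, 1), (3, 2, 1, 4, 3, 4), (3, 2, 1, 4, 4, 6), (3, 3, 0,
    4, 0, 3), (3, 3, 3, 4, 5, 6), (3, 3, 4, 3, 4, 6), (3, 4, 4, 4, 4, 6), (4, 0, 0, 2, 1, 1), (4, 0, 0, 3, 0, 1),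
    (4, 0, 0, 4, 0, 1), (4, 0, 0, 4, 2, 3), (4, 0, 0, 4, 3, 3), (4, 0, 0, 6, 2, 3), (4, 0, 0, 7, 0, 3), (4, 0, 0,
    7, 2, 4), (4, 0, 0, 9, 0, 3), (4, 0, 0, 10, 0, 3), (4, 0, 0, 11, 0, 4), (4, 0, 1, 1, 1, 1), (4, 0, 2, 3, 4,
    4), (4, 0, 3, 1, 3, 3), (4, 1, 0, 2, 0, 1), (4, 1, 0, 9, 0, 5), (4, 2, 0, 6, 0, 3), (4, 2, 0, 7, 0, 4), (4, 2,
    1, 5, 4, 5), (4, 2, 3, 3, 3, 3), (4, 2, 4, 3, 4, 4), (4, 3, 3, 4, 5, 6), (5, 0, 0, 2, 1, 1), (5, 0, 0, 3, 0,
    1), (5, 0, 0, 5, 3, 4), (5, 0, 0, 9, 0, 4), (5, 0, 1, 1, 1, 1), (5, 0, 2, 4, 5, 5), (5, 1, 0, 2, 0, 1), (5, 1,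
    0, 7, 0, 4), (5, 1, 0, 8, 0, 4), (6, 0, 1, 1, 1, 1), (6, 0, 3, 3, 4, 4), (6, 2, 1, 4, 2, 3), (7, 0, 3, 3, 3,
    3), (7, 0, 3, 4, 4, 4), (7, 0, 4, 3, 4, 4), (7, 1, 1, 2, 1, 1), (7, 1, 1, 4, 2, 3), (7, 3, 2, 4, 2, 3), (8, 0,
    1, 2, 1, 1), (8, 1, 0, 3, 0, 1), (9, 1, 2, 4, 2, 3), (10, 1, 1, 2, 1, 1), (11, 0, 1, 2, 1, 1)]"

lemmas vecs_defs = vecs1_def vecs2_def vecs3_def vecs4_def vecs5_def vecs6_def vecs7_def vecs8_def

definition vecs :: "sv list list" where "vecs = [[], vecs1, vecs2, vecs3, vecs4, vecs5, vecs6, vecs7, vecs8]"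

lemma joinv_closed:
  "\<forall>r\<in>set vecs1. \<forall>w\<in>set vecs1. joinv r w \<in> set vecs2"
  "\<forall>r\<in>set vecs1. \<forall>w\<in>set vecs2. joinv r w \<in> set vecs3" "\<forall>r\<in>set vecs2. \<forall>w\<in>set vecs1. joinv r w \<in> set vecs3"
  "\<forall>r\<in>set vecs1. \<forall>w\<in>set vecs3. joinv r w \<in> set vecs4" "\<forall>r\<in>set vecs2. \<forall>w\<in>set vecs2. joinv r w \<in> set vecs4"
  "\<forall>r\<in>set vecs3. \<forall>w\<in>set vecs1. joinv r w \<in> set vecs4"
  "\<forall>r\<in>set vecs1. \<forall>w\<in>set vecs4. joinv r w \<in> set vecs5" "\<forall>r\<in>set vecs2. \<forall>w\<in>set vecs3. joinv r w \<in> set vecs5"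
  "\<forall>r\<in>set vecs3. \<forall>w\<in>set vecs2. joinv r w \<in> set vecs5" "\<forall>r\<in>set vecs4. \<forall>w\<in>set vecs1. joinv r w \<in> set vecs5"
  unfolding vecs_defs by simp_all

lemma joinv_closed6:
  "\<forall>r\<in>set vecs1. \<forall>w\<in>set vecs5. joinv r w \<in> set vecs6" "\<forall>r\<in>set vecs2. \<forall>w\<in>set vecs4. joinv r w \<in> set vecs6"
  "\<forall>r\<in>set vecs3. \<forall>w\<in>set vecs3. joinv r w \<in> set vecs6" "\<forall>r\<in>set vecs4. \<forall>w\<in>set vecs2. joinv r w \<in> set vecs6"
  "\<forall>r\<in>set vecs5. \<forall>w\<in>set vecs1. joinv r w \<in> set vecs6"
  unfolding vecs_defs by simp_all

lemma joinv_closed7: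
  "\<forall>r\<in>set vecs1. \<forall>w\<in>set vecs6. joinv r w \<in> set vecs7" "\<forall>r\<in>set vecs2. \<forall>w\<in>set vecs5. joinv r w \<in> set vecs7"
  "\<forall>r\<in>set vecs3. \<forall>w\<in>set vecs4. joinv r w \<in> set vecs7" "\<forall>r\<in>set vecs4. \<forall>w\<in>set vecs3. joinv r w \<in> set vecs7"
  "\<forall>r\<in>set vecs5. \<forall>w\<in>set vecs2. joinv r w \<in> set vecs7" "\<forall>r\<in>set vecs6. \<forall>w\<in>set vecs1. joinv r w \<in> set vecs7"
  unfolding vecs_defs by simp_all

lemma joinv_closed8:
  "\<forall>r\<in>set vecs1. \<forall>w\<in>set vecs7. joinv r w \<in> set vecs8" "\<forall>r\<in>set vecs2. \<forall>w\<in>set vecs6. joinv r w \<in> set vecs8"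
  "\<forall>r\<in>set vecs3. \<forall>w\<in>set vecs5. joinv r w \<in> set vecs8" "\<forall>r\<in>set vecs4. \<forall>w\<in>set vecs4. joinv r w \<in> set vecs8"
  "\<forall>r\<in>set vecs5. \<forall>w\<in>set vecs3. joinv r w \<in> set vecs8" "\<forall>r\<in>set vecs6. \<forall>w\<in>set vecs2. joinv r w \<in> set vecs8"
  "\<forall>r\<in>set vecs7. \<forall>w\<in>set vecs1. joinv r w \<in> set vecs8"
  unfolding vecs_defs by simp_all

lemma joinv_vecs:
  "\<forall>i\<in>{1..7}. \<forall>j\<in>{1..8-i}. \<forall>r\<in>set (vecs ! i). \<forall>w\<in>set (vecs ! j). joinv r w \<in> set (vecs ! (i + j))"
proof -
  have 1: "{1..7} = {1::nat, 2, 3, 4, 5, 6, 7}" "{1..1} = {1::nat}" "{1..2} = {1::nat, 2}" "{1..3} = {1::nat, 2, 3}"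
    "{1..4} = {1::nat, 2, 3, 4}" "{1..5} = {1::nat, 2, 3, 4, 5}" "{1..6} = {1::nat, 2, 3, 4, 5, 6}"
    by auto
  have 2: "vecs ! 1 = vecs1" "vecs ! 2 = vecs2" "vecs ! 3 = vecs3" "vecs ! 4 = vecs4" "vecs ! 5 = vecs5" "vecs ! 6 = vecs6"
    "vecs ! 7 = vecs7" "vecs ! 8 = vecs8"
    by (simp_all add: vecs_def)
  show ?thesis
    using joinv_closed joinv_closed6 joinv_closed7 joinv_closed8 unfolding 1(1)
    by (simp add: 1 2 del: One_nat_def) (simp add: 1 2 flip: One_nat_def)
qed

lemma vec_in_vecs: "nsz T \<le> 8 \<Longrightarrow> vec T \<in> set (vecs ! nsz T)"
proof (induction T)
  case (Vtx x)
  show ?case by (simp add: vecs_def vecs1_def)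
next
  case (Join R W)
  have "nsz R \<in> {1..7}" "nsz W \<in> {1..8 - nsz R}"
    using Join.prems nsz_pos[of R] nsz_pos[of W] by (auto simp del: nsz_pos)
  moreover have "vec R \<in> set (vecs ! nsz R)" "vec W \<in> set (vecs ! nsz W)"
    using Join by auto
  ultimately show ?case using joinv_vecs by simp
qed

subsection \<open>The tree bound\<close>

definition lam :: real where "lam = root 3 3"

lemma lam3: "lam ^ 3 = 3"
  by (simp add: lam_def)

lemma lam_pos [simp]: "lam > 0"
  by (simp add: lam_def)

text \<open>Cubing turns the estimates for \<open>lam\<close> and its square into rational
  comparisons with 3 and 9.\<close>

lemma lam_gt: "1.442 < lam"
proof (rule power_less_imp_less_base[of _ 3])
  show "1.442 ^ 3 < lam ^ 3" unfolding lam3 by (simp add: power3_eq_cube)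
qed (simp add: less_imp_le)

lemma lam_lt: "lam < 1.4423"
proof (rule power_less_imp_less_base[of _ 3])
  show "lam ^ 3 < 1.4423 ^ 3" unfolding lam3 by (simp add: power3_eq_cube)
qed simp

lemma lam2_gt: "2.08 < lam\<^sup>2"
proof (rule power_less_imp_less_base[of _ 3])
  have "(lam\<^sup>2) ^ 3 = (lam ^ 3)\<^sup>2" by (simp flip: power_mult)
  then show "2.08 ^ 3 < (lam\<^sup>2) ^ 3" unfolding lam3 by (simp add: power3_eq_cube)
qed simp

lemma lam2_lt: "lam\<^sup>2 < 2.0802"
proof (rule power_less_imp_less_base[of _ 3])
  have "(lam\<^sup>2) ^ 3 = (lam ^ 3)\<^sup>2" by (simp flip: power_mult)
  then show "(lam\<^sup>2) ^ 3 < 2.0802 ^ 3" unfolding lam3 by (simp add: power3_eq_cube)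
qed simp

lemma lam_pow_add3: "lam ^ (k + 3) = 3 * lam ^ k"
  by (simp add: power_add lam3)

lemma lam_pow_mult3: "lam ^ (3 * k) = 3 ^ k"
  by (simp add: power_mult lam3)

definition tb :: "nat \<Rightarrow> real" where "tb n = lam ^ (n - 1) + (real n - 1) / 3"

text \<open>Bernoulli's inequality gives a lower bound linear in \<open>k\<close>, which linear
  arithmetic can weigh against the summand \<open>(n - 1) / 3\<close> of \<open>tb\<close>.\<close>

lemma lam_pow_ge: "lam ^ (j + k) \<ge> lam ^ j * (1 + 0.442 * real k)"
proof -
  have "1 + real k * 0.442 \<le> (1 + 0.442) ^ k" by (rule Bernoulli_inequality) simp
  also have "\<dots> \<le> lam ^ k" using lam_gt by (intro power_mono) auto
  finally show ?thesis by (simp add: power_add mult_left_mono mult.commute)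
qed

lemma lam_pow_eval: "lam ^ 6 = 9" "lam ^ 7 = 9 * lam" "lam ^ 8 = 9 * lam\<^sup>2" "lam ^ 9 = 27" "lam ^ 10 = 27 * lam"
  "lam ^ 11 = 27 * lam\<^sup>2" "lam ^ 12 = 81" "lam ^ 13 = 81 * lam" "lam ^ 14 = 81 * lam\<^sup>2" "lam ^ 15 = 243"
  "lam ^ 16 = 243 * lam" "lam ^ 17 = 243 * lam\<^sup>2" "lam ^ 3 = 3" "lam ^ 4 = 3 * lam" "lam ^ 5 = 3 * lam\<^sup>2"
  using lam3 lam_pow_add3[of 1] lam_pow_add3[of 2] lam_pow_add3[of 3] lam_pow_add3[of 4] lam_pow_add3[of 5]
    lam_pow_add3[of 6] lam_pow_add3[of 7] lam_pow_add3[of 8] lam_pow_add3[of 9] lam_pow_add3[of 10]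
    lam_pow_add3[of 11] lam_pow_add3[of 12] lam_pow_add3[of 13] lam_pow_add3[of 14]
  by simp_all

text \<open>The maximum of \<open>\<Phi>\<close> over the non-extremal trees of order \<open>n \<le> 9\<close>, continued by the largest
  integer below \<open>tb n\<close>.\<close>

definition sc :: "nat \<Rightarrow> nat" where
  "sc n = [0, 0, 0, 0, 3, 4, 6, 10, 14, 19, 29, 42, 59, 84, 121, 173, 247] ! n"

lemma sc_less_tb: "4 \<le> n \<Longrightarrow> n \<le> 16 \<Longrightarrow> real (sc n) < tb n"
proof -
  assume "4 \<le> n" "n \<le> 16"
  then have "n = 4 \<or> n = 5 \<or> n = 6 \<or> n = 7 \<or> n = 8 \<or> n = 9 \<or> n = 10 \<or> n = 11 \<or> n = 12 \<or> n = 13 \<or>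
    n = 14 \<or> n = 15 \<or> n = 16" by presburger
  then show ?thesis
    using lam_gt lam2_gt by (elim disjE) (simp_all add: sc_def tb_def lam_pow_eval)
qed

text \<open>The strict bound serves the equality case for trees; the table up to order 9 serves the
  forests and the tightest steps of the induction.\<close>

definition lesser :: "'a rtree \<Rightarrow> bool" where
  "lesser T \<longleftrightarrow> real (vg T) < tb (nsz T) \<and> (nsz T \<le> 9 \<longrightarrow> vg T \<le> sc (nsz T))"

text \<open>With a single branch this is K_{1,3} seen from a leaf, so K_{1,3} needs no class of its
  own.\<close>

definition Tstar_like :: "'a rtree \<Rightarrow> bool" where
  "Tstar_like T \<longleftrightarrow> (\<exists>x Ws. ueq T (att (Vtx x) Ws) \<and> (\<forall>A\<in>set Ws. isP3c A))"

definition K14_like :: "'a rtree \<Rightarrow> bool" where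
  "K14_like T \<longleftrightarrow> (\<exists>x p q r s. ueq T (Join (Join (Join (Join (Vtx x) (Vtx p)) (Vtx q)) (Vtx r)) (Vtx s)))"

definition T8_like :: "'a rtree \<Rightarrow> bool" where
  "T8_like T \<longleftrightarrow> (\<exists>x y A B. isP3c A \<and> isP3c B \<and> ueq T (Join (Join (Vtx x) A) (Join (Vtx y) B)))"

lemma lesserI: "vg T \<le> sc (nsz T) \<Longrightarrow> 4 \<le> nsz T \<Longrightarrow> nsz T \<le> 16 \<Longrightarrow> lesser T"
  unfolding lesser_def using sc_less_tb[of "nsz T"] by auto

lemma lesserI2: "real (vg T) < tb (nsz T) \<Longrightarrow> 10 \<le> nsz T \<Longrightarrow> lesser T"
  unfolding lesser_def by auto

text \<open>Each P_3 multiplies \<open>vo\<close> by 3 and adds 1 to \<open>vd\<close>, whichever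
  way it is hung. Hung at an end it also adds 1 to \<open>vb\<close>, and \<open>vb\<close> does not
  count towards \<open>vg\<close>: every such branch costs exactly one set.\<close>

lemma star_vals:
  fixes x :: 'a
  assumes "\<forall>A\<in>set Ws. isP3 A"
  defines "T \<equiv> att (Vtx x) Ws"
  shows "va T + vb T + 1 = 3 ^ length Ws" "vc T = 1" "vd T = length Ws" "ve T = 1" "vf T = 1"
    "nsz T = 3 * length Ws + 1" "vb T = length (filter isP3e Ws)"
proof -
  have "va T + vb T + 1 = 3 ^ length Ws \<and> vc T = 1 \<and> vd T = length Ws \<and> ve T = 1 \<and> vf T = 1 \<and>
    nsz T = 3 * length Ws + 1 \<and> vb T = length (filter isP3e Ws)"
    using assms(1) unfolding T_def
  proof (induction Ws rule: rev_induct)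
    case (snoc A Ws)
    then consider "isP3c A" "\<not> isP3e A" | "isP3e A" unfolding isP3_def isP3c_def isP3e_def by auto
    then show ?case
    proof cases
      case 1
      then show ?thesis using snoc by (auto simp: isP3c_def)
    next
      case 2
      then show ?thesis using snoc by (auto simp: isP3e_def)
    qed
  qed simp
  then show "va T + vb T + 1 = 3 ^ length Ws" "vc T = 1" "vd T = length Ws" "ve T = 1" "vf T = 1"
    "nsz T = 3 * length Ws + 1" "vb T = length (filter isP3e Ws)" by auto
qed

lemma star_vg:
  assumes "\<forall>A\<in>set Ws. isP3 A"
  shows "vg (att (Vtx x) Ws) + length (filter isP3e Ws) = 3 ^ length Ws + length Ws"
  using star_vals[OF assms, of x] by (simp add: vg_def)

lemma tb_mod1: "tb (3 * r + 1) = 3 ^ r + real r"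
  by (simp add: tb_def lam_pow_mult3)

lemma star_cases:
  assumes "\<forall>A\<in>set Ws. isP3 A" "ueq T (att (Vtx x) Ws)" "nsz T \<ge> 4"
  shows "lesser T \<or> Tstar_like T"
proof (cases "\<forall>A\<in>set Ws. isP3c A")
  case True
  then show ?thesis using assms(2) Tstar_like_def by blast
next
  case False
  then have "filter isP3e Ws \<noteq> []" using assms(1) by (auto simp: isP3_def filter_empty_conv)
  then have *: "vg T < 3 ^ length Ws + length Ws"
    using star_vg[OF assms(1), of x] ueq_vg[OF assms(2)] by (cases "filter isP3e Ws") auto
  have n: "nsz T = 3 * length Ws + 1"
    using ueq_nsz[OF assms(2)] star_vals(6)[OF assms(1)] by simp
  have "real (vg T) < real (3 ^ length Ws + length Ws)" using * by linarith
  then have "real (vg T) < tb (nsz T)" unfolding n tb_mod1 by simp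
  moreover have "vg T \<le> sc (nsz T)" if "nsz T \<le> 9"
  proof -
    have "length Ws = 1 \<or> length Ws = 2" using that n assms(3) by linarith
    then show ?thesis using * n by (elim disjE) (simp_all add: sc_def)
  qed
  ultimately show ?thesis by (simp add: lesser_def)
qed

lemma K14_vals:
  "nsz (Join (Join (Join (Join (Vtx x) (Vtx p)) (Vtx q)) (Vtx r)) (Vtx s)) = 5"
  "vg (Join (Join (Join (Join (Vtx x) (Vtx p)) (Vtx q)) (Vtx r)) (Vtx s)) = 5"
  by (simp_all add: vg_def)

lemma special_vg:
  assumes "nsz T \<ge> 4"
  shows "Tstar_like T \<Longrightarrow> nsz T mod 3 = 1 \<and> real (vg T) = tb (nsz T) \<and> vg T = 3 ^ (nsz T div 3) + nsz T div 3"
    and "K14_like T \<Longrightarrow> nsz T = 5 \<and> vg T = 5"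
    and "T8_like T \<Longrightarrow> nsz T = 8 \<and> vg T = 15"
proof -
  assume "Tstar_like T"
  then obtain x Ws where T: "ueq T (att (Vtx x) Ws)" and Ws: "\<forall>A\<in>set Ws. isP3c A"
    unfolding Tstar_like_def by blast
  have "\<not> isP3e A" if "isP3c A" for A :: "'a rtree" using that by (auto simp: isP3c_def isP3e_def)
  then have "filter isP3e Ws = []" using Ws by (auto simp: filter_empty_conv)
  moreover have P3: "\<forall>A\<in>set Ws. isP3 A" using Ws by (auto simp: isP3_def)
  ultimately have g: "vg T = 3 ^ length Ws + length Ws"
    using star_vg[OF P3, of x] ueq_vg[OF T] by simp
  have n: "nsz T = 3 * length Ws + 1" using star_vals(6)[OF P3] ueq_nsz[OF T] by simp
  have n3: "nsz T div 3 = length Ws" using n by simp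
  show "nsz T mod 3 = 1 \<and> real (vg T) = tb (nsz T) \<and> vg T = 3 ^ (nsz T div 3) + nsz T div 3"
    unfolding n3 using n g tb_mod1[of "length Ws"] by simp
next
  assume "K14_like T"
  then obtain x p q r s where T: "ueq T (Join (Join (Join (Join (Vtx x) (Vtx p)) (Vtx q)) (Vtx r)) (Vtx s))"
    unfolding K14_like_def by blast
  show "nsz T = 5 \<and> vg T = 5" using K14_vals ueq_nsz[OF T] ueq_vg[OF T] by simp
next
  assume "T8_like T"
  then obtain x y A B where "isP3c A" "isP3c B" and T: "ueq T (Join (Join (Vtx x) A) (Join (Vtx y) B))"
    unfolding T8_like_def by blast
  then show "nsz T = 8 \<and> vg T = 15"
    unfolding ueq_nsz[OF T] ueq_vg[OF T] by (auto simp: vg_def isP3c_def)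
qed

lemma special_le_tb:
  assumes "nsz T \<ge> 4" "lesser T \<or> Tstar_like T \<or> K14_like T \<or> T8_like T"
  shows "real (vg T) \<le> tb (nsz T)"
proof -
  have "5 \<le> tb 5" "15 \<le> tb 8"
    using lam_gt lam2_gt by (simp_all add: tb_def lam_pow_eval)
  then show ?thesis using assms special_vg[OF assms(1)] by (auto simp: lesser_def)
qed

subsection \<open>Values of the reducible forms\<close>

lemma leaves3_vg:
  "vg (Join (Join (Join S (Vtx x)) (Vtx y)) (Vtx z)) = va S + vb S + vc S + vd S + 3 * vf S"
  by (simp add: vg_def)

lemma P2_P2_vg:
  "isP2 A \<Longrightarrow> isP2 B \<Longrightarrow> vg (Join (Join S A) B) = va S + vb S + vc S + vd S + ve S + 2 * vf S"
  by (auto simp: vg_def isP2_def)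

lemma L_P2_vg:
  "isL A \<Longrightarrow> isP2 B \<Longrightarrow> vg (Join (Join S A) B) = va S + vb S + vc S + vd S + 2 * vf S"
  by (auto simp: vg_def isP2_def isL_def)

lemma P3_P2_vg:
  "isP3 A \<Longrightarrow> isP2 B \<Longrightarrow> vg (Join (Join S A) B) \<le> 3 * va S + 3 * vb S + 3 * vc S + vd S + ve S + 2 * vf S"
  by (auto simp: vg_def is_defs)

text \<open>Of the two trees covered by \<open>isK\<close>, the star K_{1,3} has the larger
  coefficients; P_4 is covered by the inequality.\<close>

lemma K_P2_vg:
  "isK A \<Longrightarrow> isP2 B \<Longrightarrow> vg (Join (Join S A) B) \<le> 4 * va S + 4 * vb S + 4 * vc S + 3 * vd S + 2 * ve S + 4 * vf S"
  by (auto simp: vg_def is_defs)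

lemma L_P3_vg:
  "isL A \<Longrightarrow> isP3 B \<Longrightarrow> vg (Join (Join S A) B) \<le> 3 * va S + 3 * vb S + 2 * vc S + vd S + 2 * vf S"
  by (auto simp: vg_def is_defs)

lemma L_K_vg:
  "isL A \<Longrightarrow> isK B \<Longrightarrow> vg (Join (Join S A) B) \<le> 4 * va S + 4 * vb S + 2 * vc S + 3 * vd S + 4 * vf S"
  by (auto simp: vg_def is_defs)

lemma K_K_vg:
  "isK A \<Longrightarrow> isK B \<Longrightarrow> vg (Join (Join S A) B) \<le> 16 * va S + 12 * vb S + 8 * vc S + 9 * vd S + 4 * ve S + 6 * vf S"
  by (auto simp: vg_def is_defs)

lemma P3_K_vg:
  "isP3 A \<Longrightarrow> isK B \<Longrightarrow> vg (Join (Join S A) B) \<le> 12 * va S + 10 * vb S + 9 * vc S + 3 * vd S + 2 * ve S + 4 * vf S"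
  by (auto simp: vg_def is_defs)

lemma XR_vg:
  "isK K \<Longrightarrow> vg (Join (Join (Vtx x) K) S) \<le> 4 * va S + 3 * vb S + vc S + 4 * vd S + 2 * ve S + 3 * vf S"
  by (auto simp: vg_def is_defs)

text \<open>The factor of \<open>vg S\<close> is \<open>va + vb\<close> of the star, which is one
  less than a power of 3; the summand \<open>vg S\<close> on the left avoids a subtraction. The sets
  counted by \<open>vb\<close> are treated as if they were counted by \<open>va\<close>.\<close>

lemma starR_vg:
  assumes "\<forall>A\<in>set Ws. isP3 A"
  shows "vg (Join (att (Vtx x) Ws) S) + vg S
    \<le> 3 ^ length Ws * vg S + length Ws * vo S + (va S + vb S + vd S + vf S)"
proof -
  define W where "W = att (Vtx x) Ws"
  note v = star_vals[OF assms, of x, folded W_def]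
  have "vg (Join W S) + vg S \<le> (va W + vb W + 1) * vg S + vd W * vo S + (va S + vb S + vd S + vf S)"
    using v(2,4,5) unfolding vg_def vo_def by (simp add: algebra_simps)
  then show ?thesis unfolding v(1) v(3) unfolding W_def .
qed

text \<open>Trees of smaller order which represent the linear forms used to estimate the forms above.\<close>

lemma gadget_vg:
  "vg (Join S (Vtx x)) = va S + vb S + vd S + vf S"
  "vg (Join (Join S (Vtx x)) (Vtx y)) = va S + vb S + vc S + vd S + 2 * vf S"
  "vg (Join S (Join (Join (Vtx x) (Vtx y)) (Vtx z))) = 3 * va S + 2 * vb S + 2 * vc S + vd S + ve S + vf S"
  "vg (Join S (Join (Vtx w) (Join (Join (Vtx x) (Vtx y)) (Vtx z)))) =
     4 * va S + 2 * vb S + vc S + 3 * vd S + 2 * ve S + vf S"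
  by (simp_all add: vg_def)

lemma gadget_nsz:
  "nsz (Join S (Vtx x)) = nsz S + 1"
  "nsz (Join (Join S (Vtx x)) (Vtx y)) = nsz S + 2"
  "nsz (Join S (Join (Join (Vtx x) (Vtx y)) (Vtx z))) = nsz S + 3"
  "nsz (Join S (Join (Vtx w) (Join (Join (Vtx x) (Vtx y)) (Vtx z)))) = nsz S + 4"
  by simp_all

subsection \<open>Small cases\<close>

lemma vecs_all:
  "(\<forall>k\<in>{1..8}. \<forall>v\<in>set (vecs ! k). P k v) \<longleftrightarrow>
     list_all (P 1) vecs1 \<and> list_all (P 2) vecs2 \<and> list_all (P 3) vecs3 \<and> list_all (P 4) vecs4 \<and>
     list_all (P 5) vecs5 \<and> list_all (P 6) vecs6 \<and> list_all (P 7) vecs7 \<and> list_all (P 8) vecs8"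
proof -
  have "{1..8} = {1::nat, 2, 3, 4, 5, 6, 7, 8}" by auto
  then show ?thesis by (simp add: vecs_def list_all_iff)
qed

lemma vecs_cases:
  assumes "nsz S \<le> 8"
    and "list_all (P 1) vecs1 \<and> list_all (P 2) vecs2 \<and> list_all (P 3) vecs3 \<and> list_all (P 4) vecs4 \<and>
      list_all (P 5) vecs5 \<and> list_all (P 6) vecs6 \<and> list_all (P 7) vecs7 \<and> list_all (P 8) vecs8"
  shows "P (nsz S) (va S, vb S, vc S, vd S, ve S, vf S)"
proof -
  have "nsz S \<in> {1..8}" using assms(1) nsz_pos[of S] by (auto simp del: nsz_pos)
  moreover have "\<forall>k\<in>{1..8}. \<forall>v\<in>set (vecs ! k). P k v" using assms(2) unfolding vecs_all .
  ultimately show ?thesis using vec_in_vecs[OF assms(1)] vec_eq[of S] by metis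
qed

text \<open>The omitted orders 1 and 2 of \<open>S\<close> produce K_{1,3} and K_{1,4}, which exceed
  the table.\<close>

lemma small_leaves3: "nsz S \<le> 8 \<Longrightarrow> 3 \<le> nsz S \<Longrightarrow>
    va S + vb S + vc S + vd S + 3 * vf S \<le> sc (nsz S + 3)"
  using vecs_cases[of S "\<lambda>k (a, b, c, d, e, f). 3 \<le> k \<longrightarrow> a + b + c + d + 3 * f \<le> sc (k + 3)"]
  by (simp add: vecs_defs sc_def)

lemma small_P2_P2: "nsz S \<le> 8 \<Longrightarrow>
    va S + vb S + vc S + vd S + ve S + 2 * vf S \<le> sc (nsz S + 4)"
  using vecs_cases[of S "\<lambda>k (a, b, c, d, e, f). a + b + c + d + e + 2 * f \<le> sc (k + 4)"]
  by (simp add: vecs_defs sc_def)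

lemma small_L_P2: "nsz S \<le> 8 \<Longrightarrow>
    va S + vb S + vc S + vd S + 2 * vf S \<le> sc (nsz S + 3)"
  using vecs_cases[of S "\<lambda>k (a, b, c, d, e, f). a + b + c + d + 2 * f \<le> sc (k + 3)"]
  by (simp add: vecs_defs sc_def)

lemma small_P3_P2: "nsz S \<le> 8 \<Longrightarrow>
    3 * va S + 3 * vb S + 3 * vc S + vd S + ve S + 2 * vf S \<le> sc (nsz S + 5)"
  using vecs_cases[of S "\<lambda>k (a, b, c, d, e, f). 3 * a + 3 * b + 3 * c + d + e + 2 * f \<le> sc (k + 5)"]
  by (simp add: vecs_defs sc_def)

lemma small_K_P2: "nsz S \<le> 8 \<Longrightarrow>
    4 * va S + 4 * vb S + 4 * vc S + 3 * vd S + 2 * ve S + 4 * vf S \<le> sc (nsz S + 6)"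
  using vecs_cases[of S "\<lambda>k (a, b, c, d, e, f). 4 * a + 4 * b + 4 * c + 3 * d + 2 * e + 4 * f \<le> sc (k + 6)"]
  by (simp add: vecs_defs sc_def)

lemma small_L_P3: "nsz S \<le> 8 \<Longrightarrow>
    3 * va S + 3 * vb S + 2 * vc S + vd S + 2 * vf S \<le> sc (nsz S + 4)"
  using vecs_cases[of S "\<lambda>k (a, b, c, d, e, f). 3 * a + 3 * b + 2 * c + d + 2 * f \<le> sc (k + 4)"]
  by (simp add: vecs_defs sc_def)

text \<open>Order 2 is omitted because it produces \<open>T_star 7\<close>, with 11 sets against the
  table value 10.\<close>

lemma small_L_K: "nsz S \<le> 8 \<Longrightarrow> nsz S \<noteq> 2 \<Longrightarrow>
    4 * va S + 4 * vb S + 2 * vc S + 3 * vd S + 4 * vf S \<le> sc (nsz S + 5)"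
  using vecs_cases[of S "\<lambda>k (a, b, c, d, e, f). k \<noteq> 2 \<longrightarrow> 4 * a + 4 * b + 2 * c + 3 * d + 4 * f \<le> sc (k + 5)"]
  by (simp add: vecs_defs sc_def)

lemma small_K_K: "nsz S \<le> 8 \<Longrightarrow>
    16 * va S + 12 * vb S + 8 * vc S + 9 * vd S + 4 * ve S + 6 * vf S \<le> sc (nsz S + 8)"
  using vecs_cases[of S "\<lambda>k (a, b, c, d, e, f). 16 * a + 12 * b + 8 * c + 9 * d + 4 * e + 6 * f \<le> sc (k + 8)"]
  by (simp add: vecs_defs sc_def)

text \<open>Order 1 is omitted because it produces \<open>T_star_8\<close>, with 15 sets against the
  table value 14.\<close>

lemma small_P3_K: "nsz S \<le> 8 \<Longrightarrow> 2 \<le> nsz S \<Longrightarrow>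
    12 * va S + 10 * vb S + 9 * vc S + 3 * vd S + 2 * ve S + 4 * vf S \<le> sc (nsz S + 7)"
  using vecs_cases[of S "\<lambda>k (a, b, c, d, e, f). 2 \<le> k \<longrightarrow> 12 * a + 10 * b + 9 * c + 3 * d + 2 * e + 4 * f \<le> sc (k + 7)"]
  by (simp add: vecs_defs sc_def)

lemma small_XR: "nsz S \<le> 8 \<Longrightarrow> 4 \<le> nsz S \<Longrightarrow>
    4 * va S + 3 * vb S + vc S + 4 * vd S + 2 * ve S + 3 * vf S \<le> sc (nsz S + 5)"
  using vecs_cases[of S "\<lambda>k (a, b, c, d, e, f). 4 \<le> k \<longrightarrow> 4 * a + 3 * b + c + 4 * d + 2 * e + 3 * f \<le> sc (k + 5)"]
  by (simp add: vecs_defs sc_def)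

text \<open>The form is \<open>starR_vg\<close> with two branches: 8 times \<open>vg\<close>, plus 2
  times \<open>vo\<close>, plus the form of \<open>S\<close> with a leaf attached.\<close>

lemma small_starR: "nsz S \<le> 7 \<Longrightarrow> 4 \<le> nsz S \<Longrightarrow>
    11 * va S + 3 * vb S + 2 * vc S + 9 * vd S + 8 * ve S + vf S \<le> sc (nsz S + 7)"
  using vecs_cases[of S "\<lambda>k (a, b, c, d, e, f). 4 \<le> k \<and> k \<le> 7 \<longrightarrow> 11 * a + 3 * b + 2 * c + 9 * d + 8 * e + f \<le> sc (k + 7)"]
  by (simp add: vecs_defs sc_def)

lemma small_vg: "nsz S \<le> 3 \<Longrightarrow> vg S \<le> (if nsz S = 3 then 3 else 1)"
  using vecs_cases[of S "\<lambda>k (a, b, c, d, e, f). k \<le> 3 \<longrightarrow> a + d + e \<le> (if k = 3 then 3 else 1)"]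
  by (simp add: vecs_defs vg_def split: if_splits)

lemma small_vo_vg:
  "nsz S \<le> 8 \<Longrightarrow> vo S \<le> [0, 1, 1, 1, 3, 4, 5, 9, 12] ! nsz S"
  "nsz S \<le> 8 \<Longrightarrow> vg S \<le> [0, 1, 1, 3, 4, 5, 6, 11, 15] ! nsz S"
  using vecs_cases[of S "\<lambda>k (a, b, c, d, e, f). a + b + c \<le> [0, 1, 1, 1, 3, 4, 5, 9, 12] ! k"]
    vecs_cases[of S "\<lambda>k (a, b, c, d, e, f). a + d + e \<le> [0, 1, 1, 3, 4, 5, 6, 11, 15] ! k"]
  by (simp_all add: vecs_defs vo_def vg_def)

text \<open>The general bound \<open>lam ^ 8\<close> would only give 18, which is too weak for two
  branches \<open>K\<close> at a tree of order 9.\<close>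

lemma vo_9: "nsz S = 9 \<Longrightarrow> vo S \<le> 16"
proof (cases S)
  case (Join R W)
  assume "nsz S = 9"
  then have n: "nsz R + nsz W = 9" "nsz R \<noteq> 0" "nsz W \<noteq> 0" using Join by auto
  then have "vo R * vg W \<le> [0, 1, 1, 1, 3, 4, 5, 9, 12] ! nsz R * [0, 1, 1, 3, 4, 5, 6, 11, 15] ! nsz W"
    by (intro mult_le_mono small_vo_vg) linarith+
  moreover have "nsz R = 1 \<and> nsz W = 8 \<or> nsz R = 2 \<and> nsz W = 7 \<or> nsz R = 3 \<and> nsz W = 6 \<or>
      nsz R = 4 \<and> nsz W = 5 \<or> nsz R = 5 \<and> nsz W = 4 \<or> nsz R = 6 \<and> nsz W = 3 \<or>
      nsz R = 7 \<and> nsz W = 2 \<or> nsz R = 8 \<and> nsz W = 1"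
    using n by presburger
  ultimately show ?thesis unfolding Join vo_Join by (elim disjE) (simp_all del: One_nat_def)
qed simp

subsection \<open>The induction\<close>

text \<open>The induction hypothesis for trees below order \<open>N\<close>; the
  \<open>itself\<close> argument carries the vertex type, which \<open>N\<close> does not
  mention.\<close>

definition bounded_upto :: "'a itself \<Rightarrow> nat \<Rightarrow> bool" where
  "bounded_upto _ N \<longleftrightarrow> (\<forall>U :: 'a rtree. nsz U < N \<longrightarrow> 4 \<le> nsz U \<longrightarrow>
     lesser U \<or> Tstar_like U \<or> K14_like U \<or> T8_like U)"

lemma bounded_tb:
  assumes "bounded_upto TYPE('a) N" "nsz (U :: 'a rtree) < N" "4 \<le> nsz U"
  shows "real (vg U) \<le> tb (nsz U)"
  using special_le_tb[OF assms(3)] assms unfolding bounded_upto_def by blast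

lemma tb_le_lam_pow:
  assumes "4 \<le> n"
  shows "tb n \<le> lam ^ n"
proof -
  obtain k where n: "n = 4 + k" using assms le_Suc_ex by blast
  define x where "x = lam ^ (3 + k)"
  have "x \<ge> 3 * (1 + 0.442 * real k)" using lam_pow_ge[of 3 k] by (simp add: lam3 x_def)
  moreover have "1.442 * x \<le> lam ^ n"
    using lam_gt unfolding n x_def by (simp add: power_add eval_nat_numeral)
  moreover have "tb n = x + (real k + 3) / 3" unfolding tb_def n x_def by simp
  moreover have "real k \<ge> 0" by simp
  ultimately show ?thesis by (simp add: field_simps)
qed

text \<open>\<open>vo\<close> is the product of \<open>vg\<close> over the branches of the root.
  Each factor is at most \<open>lam\<close> to the order of its branch, and these orders add up to
  \<open>nsz S - 1\<close>.\<close>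

lemma bounded_vo:
  assumes "bounded_upto TYPE('a) N" "nsz (S :: 'a rtree) \<le> N"
  shows "real (vo S) \<le> lam ^ (nsz S - 1)"
  using assms(2)
proof (induction S)
  case (Join R W)
  have "nsz W < N" using Join.prems nsz_pos[of R] by (simp del: nsz_pos)
  have W: "real (vg W) \<le> lam ^ nsz W"
  proof (cases "nsz W \<ge> 4")
    case True
    then show ?thesis using bounded_tb[OF assms(1) \<open>nsz W < N\<close>] tb_le_lam_pow[of "nsz W"] by simp
  next
    case False
    then have "vg W \<le> (if nsz W = 3 then 3 else 1)" by (intro small_vg) simp
    moreover have "1 \<le> lam ^ nsz W" using lam_gt by (intro one_le_power) simp
    ultimately show ?thesis using lam3 by (auto split: if_splits)
  qed
  have "real (vo R) * real (vg W) \<le> lam ^ (nsz R - 1) * lam ^ nsz W"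
    using Join W by (intro mult_mono) auto
  moreover have "nsz (Join R W) - 1 = nsz R - 1 + nsz W" using nsz_pos[of R] by (simp del: nsz_pos)
  ultimately show ?case by (simp only: vo_Join of_nat_mult power_add)
qed (simp add: vo_Vtx)

lemma tb_shift:
  assumes "nsz S = j + 1"
  shows "tb (nsz S) = lam ^ j + real j / 3"
    "tb (nsz S + 1) = lam * lam ^ j + (real j + 1) / 3"
    "tb (nsz S + 2) = lam\<^sup>2 * lam ^ j + (real j + 2) / 3"
    "tb (nsz S + 3) = 3 * lam ^ j + (real j + 3) / 3"
    "tb (nsz S + 4) = 3 * (lam * lam ^ j) + (real j + 4) / 3"
    "tb (nsz S + 5) = 3 * (lam\<^sup>2 * lam ^ j) + (real j + 5) / 3"
    "tb (nsz S + 6) = 9 * lam ^ j + (real j + 6) / 3"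
    "tb (nsz S + 7) = 9 * (lam * lam ^ j) + (real j + 7) / 3"
    "tb (nsz S + 8) = 9 * (lam\<^sup>2 * lam ^ j) + (real j + 8) / 3"
  using lam_pow_eval(1-3,13-15) assms by (simp_all add: tb_def power_add power2_eq_square flip: power_Suc2)

lemma lam_units:
  "lam * lam ^ j \<ge> 1.442 * lam ^ j" "lam * lam ^ j \<le> 1.4423 * lam ^ j"
  "lam\<^sup>2 * lam ^ j \<ge> 2.08 * lam ^ j" "lam\<^sup>2 * lam ^ j \<le> 2.0802 * lam ^ j"
  using lam_gt lam_lt lam2_gt lam2_lt by (simp_all add: mult_right_mono less_imp_le)

text \<open>The anchors are \<open>lam ^ 8 = 9 * lam\<^sup>2 > 18.72\<close> and
  \<open>lam ^ 10 = 27 * lam > 38.93\<close>; the slopes are 0.442 times the anchors, rounded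
  down.\<close>

lemma lam_pow_linear:
  "8 \<le> j \<Longrightarrow> lam ^ j \<ge> 18.72 + 8.27 * (real j - 8)"
  "10 \<le> j \<Longrightarrow> lam ^ j \<ge> 38.93 + 17.2 * (real j - 10)"
proof -
  assume "8 \<le> j"
  then obtain k where j: "j = 8 + k" using le_Suc_ex by blast
  have "18.72 * (1 + 0.442 * real k) \<le> lam ^ 8 * (1 + 0.442 * real k)"
    unfolding lam_pow_eval using lam2_gt by (intro mult_right_mono) auto
  then show "lam ^ j \<ge> 18.72 + 8.27 * (real j - 8)" using lam_pow_ge[of 8 k] unfolding j by simp
next
  assume "10 \<le> j"
  then obtain k where j: "j = 10 + k" using le_Suc_ex by blast
  have "38.93 * (1 + 0.442 * real k) \<le> lam ^ 10 * (1 + 0.442 * real k)"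
    unfolding lam_pow_eval using lam_gt by (intro mult_right_mono) auto
  then show "lam ^ j \<ge> 38.93 + 17.2 * (real j - 10)" using lam_pow_ge[of 10 k] unfolding j by simp
qed

text \<open>The numbers \<open>x\<close>, \<open>y\<close>, \<open>z\<close> are three consecutive powers of \<open>lam\<close>; hiding them makes all estimates
  linear.\<close>

definition units :: "'a rtree \<Rightarrow> nat \<Rightarrow> real \<Rightarrow> real \<Rightarrow> real \<Rightarrow> bool" where
  "units S j x y z \<longleftrightarrow> nsz S = j + 1 \<and> 8 \<le> j \<and> x = lam ^ j \<and> y = lam * lam ^ j \<and> z = lam\<^sup>2 * lam ^ j"

lemma units_ex:
  assumes "nsz S \<ge> 9"
  obtains j x y z where "units S j x y z"
  using assms by (intro that[of "nsz S - 1"]) (auto simp: units_def)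

lemma unitsD:
  assumes "units S j x y z"
  shows "lam ^ (nsz S - 1) = x"
    "tb (nsz S) = x + real j / 3" "tb (nsz S + 1) = y + real j / 3 + 1 / 3" "tb (nsz S + 2) = z + real j / 3 + 2 / 3"
    "tb (nsz S + 3) = 3 * x + real j / 3 + 3 / 3" "tb (nsz S + 4) = 3 * y + real j / 3 + 4 / 3"
    "tb (nsz S + 5) = 3 * z + real j / 3 + 5 / 3" "tb (nsz S + 6) = 9 * x + real j / 3 + 6 / 3"
    "tb (nsz S + 7) = 9 * y + real j / 3 + 7 / 3" "tb (nsz S + 8) = 9 * z + real j / 3 + 8 / 3"
  using assms tb_shift[of S j] by (simp_all add: units_def add_divide_distrib)

text \<open>The constants come from the linear bounds: 47.44 = 8 * 8.27 - 18.72 and 133.07 = 10 *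
  17.2 - 38.93.\<close>

lemma units_bounds:
  assumes "units S j x y z"
  shows "8 \<le> j" "1.442 * x \<le> y" "y \<le> 1.4423 * x" "2.08 * x \<le> z" "z \<le> 2.0802 * x"
    "8.27 * real j \<le> x + 47.44" "10 \<le> j \<Longrightarrow> 17.2 * real j \<le> x + 133.07" "nsz S = j + 1"
  using assms lam_units[of j] lam_pow_linear[of j] unfolding units_def by (simp_all add: field_simps)

lemma gadget_bounds:
  assumes "bounded_upto TYPE('a) N" "nsz (S :: 'a rtree) \<ge> 4"
  shows "nsz S < N \<Longrightarrow> real (va S) + real (vd S) + real (ve S) \<le> tb (nsz S)"
    "nsz S + 1 < N \<Longrightarrow> real (va S) + real (vb S) + real (vd S) + real (vf S) \<le> tb (nsz S + 1)"
    "nsz S + 2 < N \<Longrightarrow> real (va S) + real (vb S) + real (vc S) + real (vd S) + 2 * real (vf S) \<le> tb (nsz S + 2)"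
    "nsz S + 3 < N \<Longrightarrow> 3 * real (va S) + 2 * real (vb S) + 2 * real (vc S) + real (vd S) + real (ve S) + real (vf S)
       \<le> tb (nsz S + 3)"
    "nsz S + 4 < N \<Longrightarrow> 4 * real (va S) + 2 * real (vb S) + real (vc S) + 3 * real (vd S) + 2 * real (ve S) + real (vf S)
       \<le> tb (nsz S + 4)"
    "nsz S \<le> N \<Longrightarrow> real (va S) + real (vb S) + real (vc S) \<le> lam ^ (nsz S - 1)"
proof -
  \<comment> \<open>One label may be used for all new vertices, since \<open>vg\<close> does not see
    labels; distinctness matters only for graphs.\<close>
  fix u :: 'a
  have *: "nsz (G :: 'a rtree) < N \<Longrightarrow> nsz S \<le> nsz G \<Longrightarrow> real (vg G) \<le> tb (nsz G)" for G
    using bounded_tb[OF assms(1), of G] assms(2) by linarith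
  show "nsz S < N \<Longrightarrow> real (va S) + real (vd S) + real (ve S) \<le> tb (nsz S)"
    using *[of S] by (simp add: vg_def)
  show "nsz S + 1 < N \<Longrightarrow> real (va S) + real (vb S) + real (vd S) + real (vf S) \<le> tb (nsz S + 1)"
    using *[of "Join S (Vtx u)"] unfolding gadget_vg gadget_nsz by simp
  show "nsz S + 2 < N \<Longrightarrow> real (va S) + real (vb S) + real (vc S) + real (vd S) + 2 * real (vf S) \<le> tb (nsz S + 2)"
    using *[of "Join (Join S (Vtx u)) (Vtx u)"] unfolding gadget_vg gadget_nsz by simp
  show "nsz S + 3 < N \<Longrightarrow> 3 * real (va S) + 2 * real (vb S) + 2 * real (vc S) + real (vd S) + real (ve S) + real (vf S)
       \<le> tb (nsz S + 3)"
    using *[of "Join S (Join (Join (Vtx u) (Vtx u)) (Vtx u))"] unfolding gadget_vg gadget_nsz by simp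
  show "nsz S + 4 < N \<Longrightarrow> 4 * real (va S) + 2 * real (vb S) + real (vc S) + 3 * real (vd S) + 2 * real (ve S) + real (vf S)
       \<le> tb (nsz S + 4)"
    using *[of "Join S (Join (Vtx u) (Join (Join (Vtx u) (Vtx u)) (Vtx u)))"] unfolding gadget_vg gadget_nsz by simp
  show "nsz S \<le> N \<Longrightarrow> real (va S) + real (vb S) + real (vc S) \<le> lam ^ (nsz S - 1)"
    using bounded_vo[OF assms(1), of S] by (simp add: vo_def)
qed

text \<open>Using \<open>vf R <= vo R\<close>, both factors of \<open>vf S = vf R * vo W\<close>
  lose one power of \<open>lam\<close> against their order, so one more power is gained than in the
  bound for \<open>vo\<close>.\<close>

lemma bounded_vf:
  assumes "bounded_upto TYPE('a) N" "nsz (S :: 'a rtree) \<le> N" "nsz S \<ge> 2"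
  shows "1.442 * real (vf S) \<le> lam ^ (nsz S - 1)"
proof (cases S)
  case (Join R W)
  have 1: "nsz R \<le> N" "nsz W \<le> N" using assms(2) Join by auto
  have "vf S \<le> vo R * vo W" unfolding Join vf_Join' using vf_le_vo by (intro mult_le_mono) auto
  then have "real (vf S) \<le> real (vo R) * real (vo W)" by (metis of_nat_le_iff of_nat_mult)
  also have "\<dots> \<le> lam ^ (nsz R - 1) * lam ^ (nsz W - 1)"
    using bounded_vo[OF assms(1)] 1 by (intro mult_mono) (auto simp: less_imp_le)
  finally have "1.442 * real (vf S) \<le> lam * (lam ^ (nsz R - 1) * lam ^ (nsz W - 1))"
    using lam_gt by (intro mult_mono) auto
  moreover have "nsz S - 1 = Suc (nsz R - 1 + (nsz W - 1))"
    using Join nsz_pos[of R] nsz_pos[of W] by (simp del: nsz_pos)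
  ultimately show ?thesis by (simp add: power_add)
qed (use assms in simp)

lemma real_ineqs:
  "real (vc S) \<le> real (ve S)" "real (ve S) \<le> real (vf S)"
  "real (vb S) + real (vc S) \<le> real (vd S) + real (ve S)"
  "real (vf S) \<le> real (va S) + real (vb S) + real (vc S)"
  using v_ineqs[of S] by (auto simp: vo_def simp flip: of_nat_add)

text \<open>From order 9 on, one nonnegative combination of gadget bounds suffices for each of these
  forms: it needs less than the available multiple of \<open>x\<close>, \<open>y\<close> or
  \<open>z\<close>, and the difference outweighs the terms linear in \<open>j\<close>.\<close>

lemma large_simple:
  assumes "bounded_upto TYPE('a) N" "nsz (S :: 'a rtree) \<ge> 9"
  shows "nsz S + 3 \<le> N \<Longrightarrow> real (va S + vb S + vc S + vd S + 3 * vf S) < tb (nsz S + 3)"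
    "nsz S + 4 \<le> N \<Longrightarrow> real (va S + vb S + vc S + vd S + ve S + 2 * vf S) < tb (nsz S + 4)"
    "nsz S + 3 \<le> N \<Longrightarrow> real (va S + vb S + vc S + vd S + 2 * vf S) < tb (nsz S + 3)"
    "nsz S + 5 \<le> N \<Longrightarrow> real (3 * va S + 3 * vb S + 3 * vc S + vd S + ve S + 2 * vf S) < tb (nsz S + 5)"
    "nsz S + 6 \<le> N \<Longrightarrow> real (4 * va S + 4 * vb S + 4 * vc S + 3 * vd S + 2 * ve S + 4 * vf S) < tb (nsz S + 6)"
    "nsz S + 4 \<le> N \<Longrightarrow> real (3 * va S + 3 * vb S + 2 * vc S + vd S + 2 * vf S) < tb (nsz S + 4)"
    "nsz S + 5 \<le> N \<Longrightarrow> real (4 * va S + 4 * vb S + 2 * vc S + 3 * vd S + 4 * vf S) < tb (nsz S + 5)"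
    "nsz S + 7 \<le> N \<Longrightarrow>
      real (12 * va S + 10 * vb S + 9 * vc S + 3 * vd S + 2 * ve S + 4 * vf S) < tb (nsz S + 7)"
proof -
  from assms(2) obtain j x y z where U0: "units S j x y z" by (rule units_ex)
  note U = unitsD[OF U0]
  note X = units_bounds(1-6)[OF U0]
  have 4: "4 \<le> nsz S" using assms(2) by simp
  note G = gadget_bounds[OF assms(1) 4, unfolded U]
  note F = real_ineqs[of S]
  {
    assume N: "nsz S + 3 \<le> N"
    \<comment> \<open>0.694 is 1 / 1.442 rounded up.\<close>
    have f: "real (vf S) \<le> 0.694 * x" using bounded_vf[OF assms(1), of S] N assms(2) U(1) by simp
    have "real (va S + vb S + vc S + vd S + 3 * vf S) \<le> (z + real j / 3 + 2 / 3) + 0.694 * x"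
      using G(3) f N by simp
    also have "\<dots> < 3 * x + real j / 3 + 3 / 3" using X by simp
    finally show "real (va S + vb S + vc S + vd S + 3 * vf S) < tb (nsz S + 3)" unfolding U .
    have "real (va S + vb S + vc S + vd S + 2 * vf S) \<le> (z + real j / 3 + 2 / 3)"
      using G(3) N by simp
    also have "\<dots> < 3 * x + real j / 3 + 3 / 3" using X by simp
    finally show "real (va S + vb S + vc S + vd S + 2 * vf S) < tb (nsz S + 3)" unfolding U .
  next
    assume N: "nsz S + 4 \<le> N"
    have "real (va S + vb S + vc S + vd S + ve S + 2 * vf S) \<le> (z + real j / 3 + 2 / 3) + x"
      using G(3,6) F(2,4) N by simp
    also have "\<dots> < 3 * y + real j / 3 + 4 / 3" using X by simp
    finally show "real (va S + vb S + vc S + vd S + ve S + 2 * vf S) < tb (nsz S + 4)" unfolding U .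
    have "real (3 * va S + 3 * vb S + 2 * vc S + vd S + 2 * vf S) \<le> (z + real j / 3 + 2 / 3) + 2 * x"
      using G(3,6) N by simp
    also have "\<dots> < 3 * y + real j / 3 + 4 / 3" using X by simp
    finally show "real (3 * va S + 3 * vb S + 2 * vc S + vd S + 2 * vf S) < tb (nsz S + 4)" unfolding U .
  next
    assume N: "nsz S + 5 \<le> N"
    have "real (3 * va S + 3 * vb S + 3 * vc S + vd S + ve S + 2 * vf S) \<le> (z + real j / 3 + 2 / 3) + 3 * x"
      using G(3,6) F(2,4) N by simp
    also have "\<dots> < 3 * z + real j / 3 + 5 / 3" using X by simp
    finally show "real (3 * va S + 3 * vb S + 3 * vc S + vd S + ve S + 2 * vf S) < tb (nsz S + 5)" unfolding U .
    have "real (4 * va S + 4 * vb S + 2 * vc S + 3 * vd S + 4 * vf S) \<le> 2 * (y + real j / 3 + 1 / 3) + x + (z + real j / 3 + 2 / 3)"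
      using G(2,3,6) N by simp
    also have "\<dots> < 3 * z + real j / 3 + 5 / 3" using X by simp
    finally show "real (4 * va S + 4 * vb S + 2 * vc S + 3 * vd S + 4 * vf S) < tb (nsz S + 5)" unfolding U .
  next
    assume N: "nsz S + 6 \<le> N"
    have "real (4 * va S + 4 * vb S + 4 * vc S + 3 * vd S + 2 * ve S + 4 * vf S) \<le> 2 * (z + real j / 3 + 2 / 3) + 2 * x + 2 * (x + real j / 3)"
      using G(1,3,6) N by simp
    also have "\<dots> < 9 * x + real j / 3 + 6 / 3" using X by simp
    finally show "real (4 * va S + 4 * vb S + 4 * vc S + 3 * vd S + 2 * ve S + 4 * vf S) < tb (nsz S + 6)" unfolding U .
  next
    assume N: "nsz S + 7 \<le> N"
    \<comment> \<open>The combination matches the coefficients of \<open>va\<close> and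
      \<open>vf\<close> exactly; 7/3 times \<open>vb + vc <= vd + ve\<close> converts its surplus in
      \<open>vd\<close>, \<open>ve\<close> into the missing \<open>vb\<close>,
      \<open>vc\<close>.\<close>
    have "real (12 * va S + 10 * vb S + 9 * vc S + 3 * vd S + 2 * ve S + 4 * vf S) \<le> 3 * (3 * x + real j / 3 + 3 / 3) + 2 / 3 * (3 * y + real j / 3 + 4 / 3) + 1 / 3 * (y + real j / 3 + 1 / 3)"
      using G(2,4,5) F(3) N by (simp add: add_divide_distrib)
    also have "\<dots> < 9 * y + real j / 3 + 7 / 3" using X by (simp add: add_divide_distrib)
    finally show "real (12 * va S + 10 * vb S + 9 * vc S + 3 * vd S + 2 * ve S + 4 * vf S) < tb (nsz S + 7)" unfolding U .
  }
qed

text \<open>The slack in \<open>9 * z\<close> is about 0.7 times \<open>x\<close>; it exceeds the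
  accumulated linear terms only from order 11 on. Orders 9 and 10 need integer parts of the gadget
  bounds.\<close>

lemma large_K_K:
  assumes "bounded_upto TYPE('a) N" "nsz (S :: 'a rtree) \<ge> 9" "nsz S + 8 \<le> N"
    and sm: "\<forall>U :: 'a rtree. nsz U = 9 \<longrightarrow> nsz U < N \<longrightarrow> vg U \<le> 19"
  shows "real (16 * va S + 12 * vb S + 8 * vc S + 9 * vd S + 4 * ve S + 6 * vf S) < tb (nsz S + 8)"
proof -
  have 4: "4 \<le> nsz S" using assms(2) by auto
  note G = gadget_bounds[OF assms(1) 4]
  note F = real_ineqs[of S]
  consider "nsz S = 9" | "nsz S = 10" | "nsz S \<ge> 11" using assms(2) by linarith
  then show ?thesis
  proof cases
    case 1
    have "va S + vd S + ve S \<le> 19" using sm 1 assms(3) by (auto simp: vg_def)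
    moreover have "va S + vb S + vd S + vf S \<le> 30"
      using G(2) 1 assms(3) by (simp add: tb_def lam_pow_eval flip: of_nat_add)
    moreover have "va S + vb S + vc S + vd S + 2 * vf S \<le> 42"
    proof -
      have "real (va S + vb S + vc S + vd S + 2 * vf S) < 43"
        using G(3) 1 assms(3) lam_lt by (simp add: tb_def lam_pow_eval)
      then show ?thesis by linarith
    qed
    moreover have "va S + vb S + vc S \<le> 16" using vo_9[OF 1] by (simp add: vo_def)
    \<comment> \<open>These multipliers reproduce the six coefficients of the form exactly.\<close>
    ultimately have "4 * (va S + vd S + ve S) + 4 * (va S + vb S + vd S + vf S) +
        (va S + vb S + vc S + vd S + 2 * vf S) + 7 * (va S + vb S + vc S) \<le> 4 * 19 + 4 * 30 + 42 + 7 * 16"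
      by (intro add_mono mult_le_mono2)
    then have "16 * va S + 12 * vb S + 8 * vc S + 9 * vd S + 4 * ve S + 6 * vf S \<le> 350" by simp
    moreover have "350 < tb 17" using lam_gt by (simp add: tb_def lam_pow_eval)
    ultimately show ?thesis using 1 by simp
  next
    case 2
    have "real (va S + vb S + vd S + vf S) < 43"
      using G(2) 2 assms(3) lam_lt by (simp add: tb_def lam_pow_eval)
    then have "va S + vb S + vd S + vf S \<le> 42" by linarith
    moreover have "3 * va S + 2 * vb S + 2 * vc S + vd S + ve S + vf S \<le> 85"
    proof -
      have "real (3 * va S + 2 * vb S + 2 * vc S + vd S + ve S + vf S) \<le> 85"
        using G(4) 2 assms(3) by (simp add: tb_def lam_pow_eval)
      then show ?thesis by linarith
    qed
    moreover have "4 * va S + 2 * vb S + vc S + 3 * vd S + 2 * ve S + vf S \<le> 121"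
    proof -
      have "real (4 * va S + 2 * vb S + vc S + 3 * vd S + 2 * ve S + vf S) < 122"
        using G(5) 2 assms(3) lam_lt by (simp add: tb_def lam_pow_eval)
      then show ?thesis by linarith
    qed
    ultimately have "10 * (va S + vb S + vd S + vf S) +
        6 * (3 * va S + 2 * vb S + 2 * vc S + vd S + ve S + vf S) +
        5 * (4 * va S + 2 * vb S + vc S + 3 * vd S + 2 * ve S + vf S) \<le> 10 * 42 + 6 * 85 + 5 * 121"
      by (intro add_mono mult_le_mono2)
    \<comment> \<open>Together with the preceding sum this yields three times the form, bounded by
      1535. Division by 3 rounds down to 511, just below \<open>tb 18\<close>.\<close>
    moreover have "3 * ve S + 4 * (vb S + vc S) + 3 * vc S \<le> 3 * vf S + 4 * (vd S + ve S) + 3 * ve S"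
      by (rule add_mono[OF add_mono[OF mult_le_mono2[OF v_ineqs(2)] mult_le_mono2[OF v_ineqs(3)]] mult_le_mono2[OF v_ineqs(1)]])
    ultimately have "16 * va S + 12 * vb S + 8 * vc S + 9 * vd S + 4 * ve S + 6 * vf S \<le> 511" by simp
    moreover have "511 < tb 18" using lam2_gt by (simp add: tb_def lam_pow_eval)
    ultimately show ?thesis using 2 by simp
  next
    case 3
    from assms(2) obtain j x y z where U0: "units S j x y z" by (rule units_ex)
    note U = unitsD[OF U0]
    note X = units_bounds[OF U0]
    have j: "10 \<le> j" using 3 X(8) by simp
    have N: "nsz S + 1 < N" "nsz S + 3 < N" "nsz S + 4 < N" using assms(3) by auto
    \<comment> \<open>The multipliers are those of order 10 (10, 6 and 5), divided by 3.\<close>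
    have "real (16 * va S + 12 * vb S + 8 * vc S + 9 * vd S + 4 * ve S + 6 * vf S)
        \<le> 10 / 3 * (y + real j / 3 + 1 / 3) + 2 * (3 * x + real j / 3 + 3 / 3) + 5 / 3 * (3 * y + real j / 3 + 4 / 3)"
      using G(2,4,5)[unfolded U] N F(1-3) by (simp add: add_divide_distrib)
    also have "\<dots> < 9 * z + real j / 3 + 8 / 3"
      using X(3,4) X(7)[OF j] j by (simp add: add_divide_distrib)
    finally show ?thesis unfolding U .
  qed
qed

text \<open>The first gadget form, twice the second and the third add up to the form, except that
  one \<open>vf\<close> stands in for a \<open>ve\<close>. At orders 9 and 10 the resulting integers
  121 and 173 are less than 0.2 below \<open>tb 14\<close> and \<open>tb 15\<close>.\<close>

lemma large_XR:
  assumes "bounded_upto TYPE('a) N" "nsz (S :: 'a rtree) \<ge> 9" "nsz S + 5 \<le> N"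
    and sm: "\<forall>U :: 'a rtree. nsz U = 9 \<longrightarrow> nsz U < N \<longrightarrow> vg U \<le> 19"
  shows "real (4 * va S + 3 * vb S + vc S + 4 * vd S + 2 * ve S + 3 * vf S) < tb (nsz S + 5)"
proof -
  have 4: "4 \<le> nsz S" using assms(2) by auto
  note G = gadget_bounds[OF assms(1) 4]
  note F = real_ineqs[of S]
  consider "nsz S = 9" | "nsz S = 10" | "nsz S \<ge> 11" using assms(2) by linarith
  then show ?thesis
  proof cases
    case 1
    have "va S + vd S + ve S \<le> 19" using sm 1 assms(3) by (auto simp: vg_def)
    moreover have "va S + vb S + vd S + vf S \<le> 30"
      using G(2) 1 assms(3) by (simp add: tb_def lam_pow_eval flip: of_nat_add)
    moreover have "va S + vb S + vc S + vd S + 2 * vf S \<le> 42"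
    proof -
      have "real (va S + vb S + vc S + vd S + 2 * vf S) < 43"
        using G(3) 1 assms(3) lam_lt by (simp add: tb_def lam_pow_eval)
      then show ?thesis by linarith
    qed
    ultimately have "(va S + vd S + ve S) + 2 * (va S + vb S + vd S + vf S) + (va S + vb S + vc S + vd S + 2 * vf S)
        \<le> 19 + 2 * 30 + 42"
      by (intro add_mono mult_le_mono2)
    then have "4 * va S + 3 * vb S + vc S + 4 * vd S + 2 * ve S + 3 * vf S \<le> 121"
      using ve_le_vf[of S] by simp
    moreover have "121 < tb 14" using lam_gt by (simp add: tb_def lam_pow_eval)
    ultimately show ?thesis using 1 by simp
  next
    case 2
    have "va S + vd S + ve S \<le> 30"
      using G(1) 2 assms(3) by (simp add: tb_def lam_pow_eval flip: of_nat_add)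
    moreover have "va S + vb S + vd S + vf S \<le> 42"
    proof -
      have "real (va S + vb S + vd S + vf S) < 43"
        using G(2) 2 assms(3) lam_lt by (simp add: tb_def lam_pow_eval)
      then show ?thesis by linarith
    qed
    moreover have "va S + vb S + vc S + vd S + 2 * vf S \<le> 59"
    proof -
      have "real (va S + vb S + vc S + vd S + 2 * vf S) < 60"
        using G(3) 2 assms(3) lam2_lt by (simp add: tb_def lam_pow_eval)
      then show ?thesis by linarith
    qed
    ultimately have "(va S + vd S + ve S) + 2 * (va S + vb S + vd S + vf S) + (va S + vb S + vc S + vd S + 2 * vf S)
        \<le> 30 + 2 * 42 + 59"
      by (intro add_mono mult_le_mono2)
    then have "4 * va S + 3 * vb S + vc S + 4 * vd S + 2 * ve S + 3 * vf S \<le> 173"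
      using ve_le_vf[of S] by simp
    moreover have "173 < tb 15" using lam2_gt by (simp add: tb_def lam_pow_eval)
    ultimately show ?thesis using 2 by simp
  next
    case 3
    from assms(2) obtain j x y z where U0: "units S j x y z" by (rule units_ex)
    note U = unitsD[OF U0]
    note X = units_bounds[OF U0]
    have j: "10 \<le> j" using 3 X(8) by simp
    have N: "nsz S < N" "nsz S + 1 < N" "nsz S + 2 < N" using assms(3) by auto
    have "real (4 * va S + 3 * vb S + vc S + 4 * vd S + 2 * ve S + 3 * vf S)
        \<le> (x + real j / 3) + 2 * (y + real j / 3 + 1 / 3) + (z + real j / 3 + 2 / 3)"
      using G(1-3)[unfolded U] N F(2) by simp
    also have "\<dots> < 3 * z + real j / 3 + 5 / 3"
      using X(3,4) X(7)[OF j] j by simp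
    finally show ?thesis unfolding U .
  qed
qed

text \<open>The multiplier of \<open>vg S\<close> grows like \<open>3 ^ r\<close> and only
  \<open>r\<close> multiplies \<open>vo S\<close>, so many branches help; for two branches the room
  appears once \<open>S\<close> has order at least 8.\<close>

lemma large_starR:
  assumes "bounded_upto TYPE('a) N" "nsz (S :: 'a rtree) \<ge> 4" "nsz S + 3 * r + 1 \<le> N"
    and "r \<ge> 3 \<or> r = 2 \<and> nsz S \<ge> 8" and V: "V + vg S \<le> 3 ^ r * vg S + r * vo S + (va S + vb S + vd S + vf S)"
  shows "real V < tb (nsz S + 3 * r + 1)"
proof -
  obtain j where j: "nsz S = j + 1" "3 \<le> j" using assms(2) by (intro that[of "nsz S - 1"]) auto
  note G = gadget_bounds[OF assms(1,2), unfolded tb_shift[OF j(1)]]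
  define P where "P = (3::real) ^ r"
  define x where "x = lam ^ j"
  define y where "y = lam * lam ^ j"
  have r2: "r \<ge> 2" using assms(4) by auto
  have P1: "P \<ge> 1" unfolding P_def by (intro one_le_power) simp
  have g: "real (vg S) \<le> x + real j / 3" using G(1) assms(3) r2 unfolding x_def by (simp add: vg_def)
  have o: "real (vo S) \<le> x" using G(6) assms(3) j unfolding x_def by (simp add: vo_def)
  have l: "real (va S + vb S + vd S + vf S) \<le> y + (real j + 1) / 3"
    using G(2) assms(3) r2 unfolding y_def by simp
  have "real V + real (vg S) \<le> P * real (vg S) + real r * real (vo S) + real (va S + vb S + vd S + vf S)"
    using of_nat_mono[OF V, where ?'a = real] unfolding P_def by simp
  then have "real V \<le> (P - 1) * real (vg S) + real r * real (vo S) + real (va S + vb S + vd S + vf S)"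
    by (simp add: algebra_simps)
  also have "\<dots> \<le> (P - 1) * (x + real j / 3) + real r * x + (y + (real j + 1) / 3)"
    using g o l P1 by (intro add_mono mult_left_mono) auto
  finally have V1: "real V \<le> (P - 1) * (x + real j / 3) + real r * x + (y + (real j + 1) / 3)" .
  \<comment> \<open>This is what remains of the claim when the bound \<open>V1\<close> is subtracted
    from \<open>tb\<close> and \<open>y\<close> is replaced by \<open>1.442 * x\<close>.\<close>
  have D: "real r * (x - 1) < (P - 1) * (0.442 * x - real j / 3)"
  proof (cases "r \<ge> 3")
    case True
    obtain i where i: "j = 3 + i" using j(2) le_Suc_ex by blast
    have x: "x \<ge> 3 + 1.326 * real i" using lam_pow_ge[of 3 i] unfolding x_def i by (simp add: lam3)
    obtain k where k: "r = 3 + k" using True le_Suc_ex by blast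
    have "27 * (1 + real k) \<le> 27 * 3 ^ k"
      using Bernoulli_inequality[of "2 :: real" k] by simp
    \<comment> \<open>Equality holds at \<open>r = 3\<close>, where
      \<open>3 ^ r - 1 = 26\<close>.\<close>
    then have P: "P - 1 \<ge> 26 / 3 * real r" unfolding P_def k by (simp add: power_add)
    have "real r * (x - 1) < real r * (26 / 3 * (0.442 * x - real j / 3))"
      using True x i by (intro mult_strict_left_mono) (auto simp: field_simps)
    also have "\<dots> = 26 / 3 * real r * (0.442 * x - real j / 3)" by simp
    also have "\<dots> \<le> (P - 1) * (0.442 * x - real j / 3)"
      using P x i by (intro mult_right_mono) (auto simp: field_simps)
    finally show ?thesis .
  next
    case False
    then have r: "r = 2" and j7: "7 \<le> j" using assms(4) j by auto
    obtain i where i: "j = 7 + i" using j7 le_Suc_ex by blast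
    have "9 * lam * (1 + 0.442 * real i) \<ge> 12.978 * (1 + 0.442 * real i)"
      using lam_gt by (intro mult_right_mono) auto
    then have x: "x \<ge> 12.978 * (1 + 0.442 * real i)"
      using lam_pow_ge[of 7 i] unfolding x_def i lam_pow_eval by linarith
    show ?thesis using x unfolding r P_def i by (simp add: field_simps)
  qed
  have y: "1.442 * x \<le> y" using lam_units(1)[of j] unfolding x_def y_def .
  have "(P - 1) * (1.442 * x) \<le> (P - 1) * y" using P1 y by (intro mult_left_mono) auto
  then have "real V < P * y + (real j + 1) / 3 + real r"
    using D V1 by (simp add: algebra_simps add_divide_distrib diff_divide_distrib)
  also have "\<dots> = tb (nsz S + 3 * r + 1)"
    unfolding tb_def j P_def y_def by (simp add: power_add lam_pow_mult3 add_divide_distrib)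
  finally show ?thesis .
qed

text \<open>The common end of the case analysis: if \<open>S\<close> has order at most 8, the table
  \<open>sc\<close> still covers the whole tree; otherwise the tree has order at least 10 and only
  \<open>tb\<close> is at stake.\<close>

lemma lesser_form:
  assumes "ueq T U" "nsz T = nsz S + k" "vg U \<le> E" "4 \<le> nsz S + k" "k \<le> 8"
    and "nsz S \<le> 8 \<Longrightarrow> E \<le> sc (nsz S + k)" "nsz S \<ge> 9 \<Longrightarrow> real E < tb (nsz S + k)"
    and k: "nsz S \<ge> 9 \<Longrightarrow> 1 \<le> k"
  shows "lesser T"
proof -
  have n: "nsz T = nsz S + k" "vg T \<le> E" using ueq_vg[OF assms(1)] assms(2,3) by auto
  show ?thesis
  proof (cases "nsz S \<le> 8")
    case True
    then show ?thesis using assms(4-6) n by (intro lesserI) auto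
  next
    case False
    then have "real (vg T) < tb (nsz T)" using n assms(7) by (auto intro: le_less_trans)
    then show ?thesis using False n k by (intro lesserI2) auto
  qed
qed

lemma nsz_1: "nsz S = 1 \<Longrightarrow> \<exists>x. S = Vtx x"
  using nsz_le3_item[of S] nsz_items[of S] by (auto simp: item_def isL_def)

lemma nsz_2: "nsz S = 2 \<Longrightarrow> \<exists>x y. S = Join (Vtx x) (Vtx y)"
  using nsz_le3_item[of S] nsz_items[of S] by (auto simp: item_def isP2_def)

lemma Tstar_likeI:
  "isP3c A \<Longrightarrow> ueq T (Join (Vtx x) A) \<Longrightarrow> Tstar_like T"
  "isP3c A \<Longrightarrow> isP3c B \<Longrightarrow> ueq T (Join (Join (Vtx x) A) B) \<Longrightarrow> Tstar_like T"
proof -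
  assume A: "isP3c A"
  show "ueq T (Join (Vtx x) A) \<Longrightarrow> Tstar_like T"
    using A unfolding Tstar_like_def by (intro exI[of _ x] exI[of _ "[A]"]) simp
  show "isP3c B \<Longrightarrow> ueq T (Join (Join (Vtx x) A) B) \<Longrightarrow> Tstar_like T"
    using A unfolding Tstar_like_def by (intro exI[of _ x] exI[of _ "[A, B]"]) simp
qed

text \<open>The exceptions surface where an estimate must leave out a small \<open>S\<close>:
  K_{1,3} and K_{1,4} with three leaves, \<open>T_star 7\<close> with a leaf and a \<open>K\<close>,
  \<open>T_star_8\<close> with a P_3 and a \<open>K\<close>. Further trees \<open>T_star n\<close>
  come from the irreducible stars.\<close>

theorem tree_dichotomy:
  "4 \<le> nsz T \<Longrightarrow> lesser T \<or> Tstar_like T \<or> K14_like T \<or> T8_like T"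
proof (induction "nsz T" arbitrary: T rule: less_induct)
  case (less T)
  have B: "bounded_upto TYPE('a) (nsz T)"
    unfolding bounded_upto_def using less.hyps by blast
  \<comment> \<open>No exceptional tree has order 9, so the table value 19 is available;
    \<open>tb 9\<close> would only give 21.\<close>
  have sm: "\<forall>U :: 'a rtree. nsz U = 9 \<longrightarrow> nsz U < nsz T \<longrightarrow> vg U \<le> 19"
  proof (intro allI impI)
    fix U :: "'a rtree" assume U: "nsz U = 9" "nsz U < nsz T"
    then have "lesser U \<or> Tstar_like U \<or> K14_like U \<or> T8_like U" using less.hyps[of U] by simp
    then show "vg U \<le> 19" using special_vg[of U] U by (auto simp: lesser_def sc_def)
  qed
  consider (leaves3) "leaves3 T" | (P2_P2) "pairform isP2 isP2 T" | (L_P2) "pairform isL isP2 T"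
    | (P3_P2) "pairform isP3 isP2 T" | (K_P2) "pairform isK isP2 T" | (L_P3) "pairform isL isP3 T"
    | (L_K) "pairform isL isK T" | (K_K) "pairform isK isK T" | (P3_K) "pairform isP3 isK T"
    | (irred) "\<not> reducible T"
    unfolding reducible_def by blast
  then show ?case
  proof cases
    case leaves3
    then obtain S x y z where T: "ueq T (Join (Join (Join S (Vtx x)) (Vtx y)) (Vtx z))"
      unfolding leaves3_def by blast
    have n: "nsz T = nsz S + 3" using ueq_nsz[OF T] by simp
    consider "nsz S = 1" | "nsz S = 2" | "nsz S \<ge> 3" using nsz_pos[of S] by linarith
    then show ?thesis
    proof cases
      case 1
      then obtain w where "S = Vtx w" using nsz_1 by blast
      \<comment> \<open>K_{1,3} seen from its leaf \<open>z\<close>.\<close>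
      then have "ueq T (Join (Vtx z) (Join (Join (Vtx w) (Vtx x)) (Vtx y)))"
        using T by (auto intro: ueq.intros)
      then show ?thesis using Tstar_likeI(1)[of "Join (Join (Vtx w) (Vtx x)) (Vtx y)" T z] by (auto simp: isP3c_def)
    next
      case 2
      then obtain v w where "S = Join (Vtx v) (Vtx w)" using nsz_2 by blast
      then show ?thesis using T unfolding K14_like_def by blast
    next
      case 3
      have "lesser T"
        by (rule lesser_form[OF T n eq_refl[OF leaves3_vg]])
          (use 3 n small_leaves3[of S] large_simple(1)[OF B, of S] in auto)
      then show ?thesis ..
    qed
  next
    case P2_P2
    then obtain S A C where *: "isP2 A" "isP2 C" and T: "ueq T (Join (Join S A) C)" unfolding pairform_def by blast
    have n: "nsz T = nsz S + 4" using ueq_nsz[OF T] nsz_items(2)[OF *(1)] nsz_items(2)[OF *(2)] by simp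
    have "lesser T"
      by (rule lesser_form[OF T n eq_refl[OF P2_P2_vg[OF *]]])
        (use n less.prems small_P2_P2[of S] large_simple(2)[OF B, of S] in auto)
    then show ?thesis ..
  next
    case L_P2
    then obtain S A C where *: "isL A" "isP2 C" and T: "ueq T (Join (Join S A) C)" unfolding pairform_def by blast
    have n: "nsz T = nsz S + 3" using ueq_nsz[OF T] nsz_items(1)[OF *(1)] nsz_items(2)[OF *(2)] by simp
    have "lesser T"
      by (rule lesser_form[OF T n eq_refl[OF L_P2_vg[OF *]]])
        (use n less.prems small_L_P2[of S] large_simple(3)[OF B, of S] in auto)
    then show ?thesis ..
  next
    case P3_P2
    then obtain S A C where *: "isP3 A" "isP2 C" and T: "ueq T (Join (Join S A) C)" unfolding pairform_def by blast
    have n: "nsz T = nsz S + 5" using ueq_nsz[OF T] nsz_items(3)[OF *(1)] nsz_items(2)[OF *(2)] by simp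
    have "lesser T"
      by (rule lesser_form[OF T n P3_P2_vg[OF *]])
        (use n small_P3_P2[of S] large_simple(4)[OF B, of S] in auto)
    then show ?thesis ..
  next
    case K_P2
    then obtain S A C where *: "isK A" "isP2 C" and T: "ueq T (Join (Join S A) C)" unfolding pairform_def by blast
    have n: "nsz T = nsz S + 6" using ueq_nsz[OF T] nsz_items(4)[OF *(1)] nsz_items(2)[OF *(2)] by simp
    have "lesser T"
      by (rule lesser_form[OF T n K_P2_vg[OF *]])
        (use n small_K_P2[of S] large_simple(5)[OF B, of S] in auto)
    then show ?thesis ..
  next
    case L_P3
    then obtain S A C where *: "isL A" "isP3 C" and T: "ueq T (Join (Join S A) C)" unfolding pairform_def by blast
    have n: "nsz T = nsz S + 4" using ueq_nsz[OF T] nsz_items(1)[OF *(1)] nsz_items(3)[OF *(2)] by simp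
    have "lesser T"
      by (rule lesser_form[OF T n L_P3_vg[OF *]])
        (use n small_L_P3[of S] large_simple(6)[OF B, of S] in auto)
    then show ?thesis ..
  next
    case L_K
    then obtain S A C where *: "isL A" "isK C" and T: "ueq T (Join (Join S A) C)" unfolding pairform_def by blast
    have n: "nsz T = nsz S + 5" using ueq_nsz[OF T] nsz_items(1)[OF *(1)] nsz_items(4)[OF *(2)] by simp
    show ?thesis
    proof (cases "nsz S = 2")
      case False
      have "lesser T"
        by (rule lesser_form[OF T n L_K_vg[OF *]])
          (use False n small_L_K[of S] large_simple(7)[OF B, of S] in auto)
      then show ?thesis ..
    next
      case True
      then obtain a b where S: "S = Join (Vtx a) (Vtx b)" using nsz_2 by blast
      obtain u where A: "A = Vtx u" using * by (auto simp: isL_def)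
      obtain y D where D: "isP3 D" "C = Join (Vtx y) D" using * by (auto simp: isK_def)
      show ?thesis
      proof (cases "isP3c D")
        case True
        \<comment> \<open>Seen from \<open>y\<close>, the tree has two copies of P_3 hung at their
          centres: \<open>D\<close>, and the one formed by \<open>S\<close> and
          \<open>A\<close>.\<close>
        have "ueq T (Join (Join (Vtx y) D) (Join (Join (Vtx a) (Vtx b)) (Vtx u)))"
          using T unfolding S A D by (blast intro: ueq.intros)
        then show ?thesis using Tstar_likeI(2) True by (metis isP3c_def)
      next
        case False
        then have "isP3e D" using D by (simp add: isP3_def)
        then have "vg T \<le> 10"
          unfolding ueq_vg[OF T] S A D by (auto simp: isP3e_def vg_def)
        then have "lesser T" using n True by (intro lesserI) (auto simp: sc_def)
        then show ?thesis ..
      qed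
    qed
  next
    case K_K
    then obtain S A C where *: "isK A" "isK C" and T: "ueq T (Join (Join S A) C)" unfolding pairform_def by blast
    have n: "nsz T = nsz S + 8" using ueq_nsz[OF T] nsz_items(4)[OF *(1)] nsz_items(4)[OF *(2)] by simp
    have "lesser T"
      by (rule lesser_form[OF T n K_K_vg[OF *]])
        (use n small_K_K[of S] large_K_K[OF B, of S] sm in auto)
    then show ?thesis ..
  next
    case P3_K
    then obtain S A C where *: "isP3 A" "isK C" and T: "ueq T (Join (Join S A) C)" unfolding pairform_def by blast
    have n: "nsz T = nsz S + 7" using ueq_nsz[OF T] nsz_items(3)[OF *(1)] nsz_items(4)[OF *(2)] by simp
    show ?thesis
    proof (cases "nsz S = 1")
      case False
      then have "2 \<le> nsz S" using nsz_pos[of S] by linarith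
      have "lesser T"
        by (rule lesser_form[OF T n P3_K_vg[OF *]])
          (use \<open>2 \<le> nsz S\<close> n small_P3_K[of S] large_simple(8)[OF B, of S] in auto)
      then show ?thesis ..
    next
      case True
      then obtain x where S: "S = Vtx x" using nsz_1 by blast
      obtain y D where D: "isP3 D" "C = Join (Vtx y) D" using * by (auto simp: isK_def)
      show ?thesis
      proof (cases "isP3c A \<and> isP3c D")
        case True
        then show ?thesis using T D S unfolding T8_like_def by blast
      next
        case False
        then have "isP3e A \<or> isP3e D" using D * by (auto simp: isP3_def)
        then have "vg T \<le> 14"
          unfolding ueq_vg[OF T] S D using * D by (auto simp: isP3_def isP3c_def isP3e_def vg_def)
        then have "lesser T" using n True by (intro lesserI) (auto simp: sc_def)
        then show ?thesis ..
      qed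
    qed
  next
    case irred
    from less.prems this show ?thesis
    proof (cases rule: tree_shapes)
      case (X x K)
      have "vg (Join (Vtx x) K) \<le> 4" using X by (auto simp: is_defs vg_def)
      moreover have "nsz T = 5" using ueq_nsz[OF X(2)] nsz_items(4)[OF X(1)] by simp
      ultimately have "lesser T" using ueq_vg[OF X(2)] by (intro lesserI) (auto simp: sc_def)
      then show ?thesis ..
    next
      case (star x Ws)
      show ?thesis using star_cases[OF star less.prems] by blast
    next
      case (XR x K R)
      have n: "nsz T = nsz R + 5" using ueq_nsz[OF XR(3)] nsz_items(4)[OF XR(1)] by simp
      have "lesser T"
        by (rule lesser_form[OF XR(3) n XR_vg[OF XR(1)]])
          (use n XR(2) small_XR[of R] large_XR[OF B, of R] sm in auto)
      then show ?thesis ..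
    next
      case (starR x Ws R)
      have n: "nsz T = nsz R + 3 * length Ws + 1" using ueq_nsz[OF starR(4)] star_vals(6)[OF starR(1)] by simp
      have V: "vg T + vg R \<le> 3 ^ length Ws * vg R + length Ws * vo R + (va R + vb R + vd R + vf R)"
        using starR_vg[OF starR(1), of x R] ueq_vg[OF starR(4)] by simp
      show ?thesis
      proof (cases "length Ws = 2 \<and> nsz R \<le> 7")
        case True
        then have "vg T \<le> 11 * va R + 3 * vb R + 2 * vc R + 9 * vd R + 8 * ve R + vf R"
          using V by (simp add: vg_def vo_def)
        also have "\<dots> \<le> sc (nsz R + 7)" using small_starR True starR by blast
        finally have "vg T \<le> sc (nsz T)" using n True by (simp add: add.commute)
        then have "lesser T" using n True by (intro lesserI) auto
        then show ?thesis ..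
      next
        case False
        then have "length Ws \<ge> 3 \<or> length Ws = 2 \<and> nsz R \<ge> 8" using starR(2) by linarith
        then have "real (vg T) < tb (nsz R + 3 * length Ws + 1)"
          using large_starR[OF B starR(3) _ _ V] n by simp
        then have "lesser T" using n starR(2,3) by (intro lesserI2) auto
        then show ?thesis ..
      qed
    qed
  qed
qed

section \<open>Counting maximal dissociation sets\<close>

definition dis :: "('a \<Rightarrow> 'a \<Rightarrow> bool) \<Rightarrow> 'a set \<Rightarrow> bool" where
  "dis A S \<longleftrightarrow> (\<forall>v\<in>S. \<forall>x\<in>S. \<forall>y\<in>S. A v x \<and> A v y \<longrightarrow> x = y)"

definition nb :: "('a \<Rightarrow> 'a \<Rightarrow> bool) \<Rightarrow> 'a set \<Rightarrow> 'a \<Rightarrow> bool" where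
  "nb A S v \<longleftrightarrow> (\<exists>x\<in>S. A v x)"

text \<open>A vertex outside a dissociation set \<open>S\<close> is blocked if it cannot be added to \<open>S\<close>.\<close>

definition blk :: "('a \<Rightarrow> 'a \<Rightarrow> bool) \<Rightarrow> 'a set \<Rightarrow> 'a \<Rightarrow> bool" where
  "blk A S v \<longleftrightarrow> (\<exists>x\<in>S. A v x \<and> (nb A S x \<or> (\<exists>y\<in>S. y \<noteq> x \<and> A v y)))"

definition mds :: "'a set \<Rightarrow> ('a \<Rightarrow> 'a \<Rightarrow> bool) \<Rightarrow> 'a set set" where
  "mds V A = {S. S \<subseteq> V \<and> dis A S \<and> (\<forall>v\<in>V - S. blk A S v)}"

lemma blk_nb: "blk A S v \<Longrightarrow> nb A S v"
  by (auto simp: blk_def nb_def)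

subsection \<open>The states of the root\<close>

text \<open>
  In the states \<open>CB\<close> and \<open>CC\<close> the root still has to be blocked by its future parent; in \<open>CF\<close> the root will be
  matched to its parent, so that its own neighbours count as blocked.
\<close>

definition CA where "CA L A r = {S. S \<subseteq> L \<and> dis A S \<and> r \<notin> S \<and> (\<forall>v\<in>L - S. v \<noteq> r \<longrightarrow> blk A S v) \<and> blk A S r}"
definition CB where
  "CB L A r = {S. S \<subseteq> L \<and> dis A S \<and> r \<notin> S \<and> (\<forall>v\<in>L - S. v \<noteq> r \<longrightarrow> blk A S v) \<and> \<not> blk A S r \<and> nb A S r}"
definition CC where
  "CC L A r = {S. S \<subseteq> L \<and> dis A S \<and> r \<notin> S \<and> (\<forall>v\<in>L - S. v \<noteq> r \<longrightarrow> blk A S v) \<and> \<not> blk A S r \<and> \<not> nb A S r}"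
definition CD where
  "CD L A r = {S. S \<subseteq> L \<and> dis A S \<and> r \<in> S \<and> (\<forall>v\<in>L - S. v \<noteq> r \<longrightarrow> blk A S v) \<and> nb A S r}"
definition CE where
  "CE L A r = {S. S \<subseteq> L \<and> dis A S \<and> r \<in> S \<and> (\<forall>v\<in>L - S. v \<noteq> r \<longrightarrow> blk A S v) \<and> \<not> nb A S r}"
definition CF where
  "CF L A r = {S. S \<subseteq> L \<and> dis A S \<and> r \<in> S \<and> (\<forall>v\<in>L - S. v \<noteq> r \<longrightarrow> blk A S v \<or> A v r) \<and> \<not> nb A S r}"

lemmas C_defs = CA_def CB_def CC_def CD_def CE_def CF_def

lemma mds_states: "r \<in> L \<Longrightarrow> mds L A = CA L A r \<union> CD L A r \<union> CE L A r"
  unfolding mds_def C_defs by (auto; metis)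

lemma C_disjoint:
  "CA L A r \<inter> CB L A r = {}" "CA L A r \<inter> CC L A r = {}" "CA L A r \<inter> CD L A r = {}" "CA L A r \<inter> CE L A r = {}"
  "CB L A r \<inter> CC L A r = {}" "CB L A r \<inter> CD L A r = {}" "CB L A r \<inter> CE L A r = {}"
  "CC L A r \<inter> CD L A r = {}" "CC L A r \<inter> CE L A r = {}" "CD L A r \<inter> CE L A r = {}"
  "CD L A r \<inter> CF L A r = {}" 
  unfolding C_defs by auto

lemma C_Pow: "CA L A r \<subseteq> Pow L" "CB L A r \<subseteq> Pow L" "CC L A r \<subseteq> Pow L" "CD L A r \<subseteq> Pow L"
  "CE L A r \<subseteq> Pow L" "CF L A r \<subseteq> Pow L"
  unfolding C_defs by auto

lemma C_finite: "finite L \<Longrightarrow> finite (CA L A r) \<and> finite (CB L A r) \<and> finite (CC L A r) \<and> finite (CD L A r) \<and>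
  finite (CE L A r) \<and> finite (CF L A r)"
  using C_Pow by (metis finite_Pow_iff finite_subset)

lemma card_C_Un:
  assumes "finite L"
  shows "card (CA L A r \<union> CD L A r \<union> CE L A r) = card (CA L A r) + card (CD L A r) + card (CE L A r)"
    "card (CD L A r \<union> CE L A r) = card (CD L A r) + card (CE L A r)"
    "card (CA L A r \<union> CB L A r \<union> CC L A r) = card (CA L A r) + card (CB L A r) + card (CC L A r)"
    "card (CA L A r \<union> CB L A r) = card (CA L A r) + card (CB L A r)"
  using C_disjoint[of L A r] C_finite[OF assms, of A r] by (simp_all add: card_Un_disjoint Int_Un_distrib2)

section \<open>Two disjoint graphs joined by an edge between their roots\<close>

definition graph_on :: "'a set \<Rightarrow> ('a \<Rightarrow> 'a \<Rightarrow> bool) \<Rightarrow> bool" where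
  "graph_on L A \<longleftrightarrow> finite L \<and> (\<forall>x y. A x y \<longrightarrow> x \<in> L \<and> y \<in> L \<and> A y x \<and> x \<noteq> y)"

lemma card_J:
  assumes disj: "L1 \<inter> L2 = {}"
    and "\<And>S T. S \<subseteq> L1 \<Longrightarrow> T \<subseteq> L2 \<Longrightarrow> S \<union> T \<in> X \<longleftrightarrow> (S, T) \<in> Y"
    and "X \<subseteq> Pow (L1 \<union> L2)" "Y \<subseteq> Pow L1 \<times> Pow L2"
  shows "card X = card Y"
proof -
  have "bij_betw (\<lambda>(S, T). S \<union> T) Y X"
  proof (rule bij_betw_byWitness[where f' = "\<lambda>U. (U \<inter> L1, U \<inter> L2)"])
    show "\<forall>p\<in>Y. (\<lambda>U. (U \<inter> L1, U \<inter> L2)) (case p of (S, T) \<Rightarrow> S \<union> T) = p"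
    proof
      fix p assume "p \<in> Y"
      then obtain S T where "p = (S, T)" "S \<subseteq> L1" "T \<subseteq> L2" using assms(4) by auto
      then show "(\<lambda>U. (U \<inter> L1, U \<inter> L2)) (case p of (S, T) \<Rightarrow> S \<union> T) = p" using disj by auto
    qed
    show "\<forall>U\<in>X. (case (U \<inter> L1, U \<inter> L2) of (S, T) \<Rightarrow> S \<union> T) = U" using assms(3) by auto
    show "(\<lambda>(S, T). S \<union> T) ` Y \<subseteq> X" using assms(2,4) by auto
    show "(\<lambda>U. (U \<inter> L1, U \<inter> L2)) ` X \<subseteq> Y"
    proof
      fix p assume "p \<in> (\<lambda>U. (U \<inter> L1, U \<inter> L2)) ` X"
      then obtain U where U: "U \<in> X" "p = (U \<inter> L1, U \<inter> L2)" by blast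
      then have "U = (U \<inter> L1) \<union> (U \<inter> L2)" using assms(3) by auto
      then show "p \<in> Y" using assms(2)[of "U \<inter> L1" "U \<inter> L2"] U by simp
    qed
  qed
  then show ?thesis by (rule bij_betw_same_card[symmetric])
qed

locale two_graphs =
  fixes L1 L2 :: "'a set" and A1 A2 A :: "'a \<Rightarrow> 'a \<Rightarrow> bool" and r1 r2 :: 'a
  assumes g1: "graph_on L1 A1" and g2: "graph_on L2 A2" and disj: "L1 \<inter> L2 = {}"
    and r1: "r1 \<in> L1" and r2: "r2 \<in> L2"
    and A: "\<And>x y. A x y \<longleftrightarrow> A1 x y \<or> A2 x y \<or> x = r1 \<and> y = r2 \<or> x = r2 \<and> y = r1"
begin

text \<open>Facts about the second side follow from those about the first by interpreting the locale
  with the sides exchanged.\<close>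

lemma swap: "two_graphs L2 L1 A2 A1 A r2 r1"
  using g1 g2 disj r1 r2 A by unfold_locales auto

context
  fixes S T
  assumes S: "S \<subseteq> L1" and T: "T \<subseteq> L2"
begin

lemma rs: "r1 \<in> S \<union> T \<longleftrightarrow> r1 \<in> S" "r2 \<in> S \<union> T \<longleftrightarrow> r2 \<in> T"
  using S T disj r1 r2 by auto

lemma nbJ: "v \<in> L1 \<Longrightarrow> nb A (S \<union> T) v \<longleftrightarrow> nb A1 S v \<or> v = r1 \<and> r2 \<in> T"
  using S T disj r1 r2 g1 g2 unfolding nb_def A graph_on_def by blast

lemma disJ: "dis A (S \<union> T) \<longleftrightarrow> dis A1 S \<and> dis A2 T \<and> \<not> (r1 \<in> S \<and> r2 \<in> T \<and> (nb A1 S r1 \<or> nb A2 T r2))"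
proof
  have *: "A1 v x \<Longrightarrow> v \<in> L1 \<and> x \<in> L1" "A2 v x \<Longrightarrow> v \<in> L2 \<and> x \<in> L2" for v x
    using g1 g2 by (auto simp: graph_on_def)
  show "dis A (S \<union> T)" if "dis A1 S \<and> dis A2 T \<and> \<not> (r1 \<in> S \<and> r2 \<in> T \<and> (nb A1 S r1 \<or> nb A2 T r2))"
    unfolding dis_def A
  proof (intro ballI impI)
    fix v x y assume "v \<in> S \<union> T" "x \<in> S \<union> T" "y \<in> S \<union> T"
      "(A1 v x \<or> A2 v x \<or> v = r1 \<and> x = r2 \<or> v = r2 \<and> x = r1) \<and> (A1 v y \<or> A2 v y \<or> v = r1 \<and> y = r2 \<or> v = r2 \<and> y = r1)"
    moreover have "x \<in> L1 \<Longrightarrow> x \<notin> L2" for x using disj by auto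
    ultimately show "x = y" using that * S T r1 r2 unfolding dis_def nb_def by (elim conjE disjE UnE) (metis subsetD)+
  qed
  assume d: "dis A (S \<union> T)"
  have "dis A1 S" "dis A2 T" using d unfolding dis_def A by blast+
  moreover have "\<not> nb A1 S r1" "\<not> nb A2 T r2" if "r1 \<in> S" "r2 \<in> T"
  proof -
    have "A1 r1 x \<Longrightarrow> x \<in> S \<Longrightarrow> x = r2" "A2 r2 y \<Longrightarrow> y \<in> T \<Longrightarrow> y = r1" for x y
      using d that unfolding dis_def A by blast+
    then show "\<not> nb A1 S r1" "\<not> nb A2 T r2"
      using * disj r1 r2 unfolding nb_def by blast+
  qed
  ultimately show "dis A1 S \<and> dis A2 T \<and> \<not> (r1 \<in> S \<and> r2 \<in> T \<and> (nb A1 S r1 \<or> nb A2 T r2))" by blast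
qed

text \<open>Away from the roots the new edge acts in only one way: it gives \<open>r1\<close> a
  neighbour in the set, which blocks the other neighbours of \<open>r1\<close>. State
  \<open>CF\<close> anticipates exactly this.\<close>

lemma blkJ: "v \<in> L1 \<Longrightarrow> v \<noteq> r1 \<Longrightarrow> blk A (S \<union> T) v \<longleftrightarrow> blk A1 S v \<or> A1 v r1 \<and> r1 \<in> S \<and> r2 \<in> T"
proof -
  assume v: "v \<in> L1" "v \<noteq> r1"
  have Av: "A v x \<longleftrightarrow> A1 v x" for x using v r2 disj g2 unfolding A graph_on_def by blast
  have "x \<in> S \<union> T \<and> A1 v x \<longleftrightarrow> x \<in> S \<and> A1 v x" for x using S T disj g1 unfolding graph_on_def by blast
  moreover have "nb A (S \<union> T) x \<longleftrightarrow> nb A1 S x \<or> x = r1 \<and> r2 \<in> T" if "A1 v x" for x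
    using that g1 by (intro nbJ) (auto simp: graph_on_def)
  ultimately show ?thesis unfolding blk_def Av by blast
qed

lemma blkJr: "r1 \<notin> S \<Longrightarrow> blk A (S \<union> T) r1 \<longleftrightarrow> blk A1 S r1 \<or> r2 \<in> T \<and> (nb A1 S r1 \<or> nb A2 T r2)"
proof -
  assume r: "r1 \<notin> S"
  interpret sw: two_graphs L2 L1 A2 A1 A r2 r1 by (rule swap)
  have Av: "A r1 x \<longleftrightarrow> A1 r1 x \<or> x = r2" for x using r1 r2 disj g2 unfolding A graph_on_def by blast
  have ST: "x \<in> S \<union> T \<and> A1 r1 x \<longleftrightarrow> x \<in> S \<and> A1 r1 x" for x using S T disj g1 unfolding graph_on_def by blast
  have n1: "nb A (S \<union> T) x \<longleftrightarrow> nb A1 S x" if "A1 r1 x" for x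
  proof -
    have "x \<in> L1" "x \<noteq> r1" using that g1 by (auto simp: graph_on_def)
    then show ?thesis using nbJ[of x] by simp
  qed
  have n2: "nb A (S \<union> T) r2 \<longleftrightarrow> nb A2 T r2"
    using sw.nbJ[OF T S, of r2] r2 r by (simp add: Un_commute)
  have r2': "A1 r1 r2 = False" using g1 r2 disj unfolding graph_on_def by blast
  have "blk A (S \<union> T) r1 \<longleftrightarrow> (\<exists>x\<in>S \<union> T. A1 r1 x \<and> (nb A (S \<union> T) x \<or> (\<exists>y\<in>S \<union> T. y \<noteq> x \<and> (A1 r1 y \<or> y = r2)))) \<or>
      r2 \<in> T \<and> (nb A (S \<union> T) r2 \<or> (\<exists>y\<in>S \<union> T. y \<noteq> r2 \<and> A1 r1 y))"
    unfolding blk_def Av using rs by blast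
  also have "\<dots> \<longleftrightarrow> (\<exists>x\<in>S. A1 r1 x \<and> (nb A1 S x \<or> (\<exists>y\<in>S. y \<noteq> x \<and> A1 r1 y) \<or> r2 \<in> T)) \<or>
      r2 \<in> T \<and> (nb A2 T r2 \<or> (\<exists>y\<in>S. A1 r1 y))"
    using ST n1 n2 r2' rs(2) by (smt (verit, best))
  also have "\<dots> \<longleftrightarrow> blk A1 S r1 \<or> r2 \<in> T \<and> (nb A1 S r1 \<or> nb A2 T r2)"
    unfolding blk_def nb_def[of A1 S r1] by blast
  finally show ?thesis .
qed

end

text \<open>The recursion \<open>joinv\<close> on the level of sets. Both roots can be chosen only
  if neither has a chosen neighbour on its own side, which pairs \<open>CF\<close> with
  \<open>CF\<close>. If one root is chosen, it helps to block the other: alone it adds a second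
  chosen neighbour, and if already matched it blocks at once.\<close>

lemma statesJ:
  assumes S: "S \<subseteq> L1" and T: "T \<subseteq> L2"
  shows "S \<union> T \<in> CA (L1 \<union> L2) A r1 \<longleftrightarrow>
      S \<in> CA L1 A1 r1 \<and> T \<in> CA L2 A2 r2 \<union> CD L2 A2 r2 \<union> CE L2 A2 r2 \<or>
      S \<in> CB L1 A1 r1 \<and> T \<in> CD L2 A2 r2 \<union> CE L2 A2 r2 \<or> S \<in> CC L1 A1 r1 \<and> T \<in> CD L2 A2 r2" (is ?A)
    "S \<union> T \<in> CB (L1 \<union> L2) A r1 \<longleftrightarrow>
      S \<in> CB L1 A1 r1 \<and> T \<in> CA L2 A2 r2 \<or> S \<in> CC L1 A1 r1 \<and> T \<in> CE L2 A2 r2" (is ?B)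
    "S \<union> T \<in> CC (L1 \<union> L2) A r1 \<longleftrightarrow> S \<in> CC L1 A1 r1 \<and> T \<in> CA L2 A2 r2" (is ?C)
    "S \<union> T \<in> CD (L1 \<union> L2) A r1 \<longleftrightarrow>
      S \<in> CD L1 A1 r1 \<and> T \<in> CA L2 A2 r2 \<union> CB L2 A2 r2 \<union> CC L2 A2 r2 \<or> S \<in> CF L1 A1 r1 \<and> T \<in> CF L2 A2 r2" (is ?D)
    "S \<union> T \<in> CE (L1 \<union> L2) A r1 \<longleftrightarrow> S \<in> CE L1 A1 r1 \<and> T \<in> CA L2 A2 r2 \<union> CB L2 A2 r2" (is ?E)
    "S \<union> T \<in> CF (L1 \<union> L2) A r1 \<longleftrightarrow>
      S \<in> CF L1 A1 r1 \<and> T \<in> CA L2 A2 r2 \<union> CB L2 A2 r2 \<union> CC L2 A2 r2" (is ?F)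
proof -
  interpret sw: two_graphs L2 L1 A2 A1 A r2 r1 by (rule swap)
  note rs = rs[OF S T] and d = disJ[OF S T] and n1 = nbJ[OF S T r1]
  have b1: "\<And>v. v \<in> L1 \<Longrightarrow> v \<noteq> r1 \<Longrightarrow> blk A (S \<union> T) v \<longleftrightarrow> blk A1 S v \<or> A1 v r1 \<and> r1 \<in> S \<and> r2 \<in> T"
    and b2: "\<And>v. v \<in> L2 \<Longrightarrow> v \<noteq> r2 \<Longrightarrow> blk A (S \<union> T) v \<longleftrightarrow> blk A2 T v \<or> A2 v r2 \<and> r2 \<in> T \<and> r1 \<in> S"
    and b1r: "r1 \<notin> S \<Longrightarrow> blk A (S \<union> T) r1 \<longleftrightarrow> blk A1 S r1 \<or> r2 \<in> T \<and> (nb A1 S r1 \<or> nb A2 T r2)"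
    and b2r: "r2 \<notin> T \<Longrightarrow> blk A (S \<union> T) r2 \<longleftrightarrow> blk A2 T r2 \<or> r1 \<in> S \<and> (nb A2 T r2 \<or> nb A1 S r1)"
    using blkJ[OF S T] sw.blkJ[OF T S] blkJr[OF S T] sw.blkJr[OF T S] by (simp_all add: Un_commute)
  have ST: "S \<union> T \<subseteq> L1 \<union> L2 \<longleftrightarrow> True" "S \<subseteq> L1 \<longleftrightarrow> True" "T \<subseteq> L2 \<longleftrightarrow> True" using S T by auto
  have Ar: "A v r1 \<longleftrightarrow> A1 v r1 \<or> v = r2" for v
    using g2 r1 r2 disj unfolding A graph_on_def by blast
  \<comment> \<open>The root \<open>r2\<close> is kept apart from the rest of \<open>L2\<close>
    because the new edge changes its own blocking.\<close>
  have split: "(\<forall>v\<in>L1 \<union> L2 - (S \<union> T). v \<noteq> r1 \<longrightarrow> P v) \<longleftrightarrow>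
     (\<forall>v\<in>L1 - S. v \<noteq> r1 \<longrightarrow> P v) \<and> (\<forall>v\<in>L2 - T. v \<noteq> r2 \<longrightarrow> P v) \<and> (r2 \<notin> T \<longrightarrow> P r2)" for P
  proof -
    have e: "L1 \<union> L2 - (S \<union> T) = (L1 - S) \<union> (L2 - T)" using S T disj by blast
    have "r1 \<notin> L2" using disj r1 by blast
    then have "(\<forall>v\<in>L2 - T. v \<noteq> r1 \<longrightarrow> P v) \<longleftrightarrow> (\<forall>v\<in>L2 - T. v \<noteq> r2 \<longrightarrow> P v) \<and> (r2 \<notin> T \<longrightarrow> P r2)"
      (is "?l \<longleftrightarrow> ?r")
    proof (intro iffI conjI ballI impI)
      fix v assume ?r "v \<in> L2 - T"
      then show "P v" by (cases "v = r2") auto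
    qed (use \<open>r1 \<notin> L2\<close> r2 in auto)
    then show ?thesis unfolding e ball_Un by blast
  qed
  have base: "(\<forall>v\<in>L1 \<union> L2 - (S \<union> T). v \<noteq> r1 \<longrightarrow> blk A (S \<union> T) v) \<longleftrightarrow>
     (\<forall>v\<in>L1 - S. v \<noteq> r1 \<longrightarrow> blk A1 S v \<or> A1 v r1 \<and> r1 \<in> S \<and> r2 \<in> T) \<and>
     (\<forall>v\<in>L2 - T. v \<noteq> r2 \<longrightarrow> blk A2 T v \<or> A2 v r2 \<and> r2 \<in> T \<and> r1 \<in> S) \<and>
     (r2 \<notin> T \<longrightarrow> blk A2 T r2 \<or> r1 \<in> S \<and> (nb A2 T r2 \<or> nb A1 S r1))"
    unfolding split using b1 b2 b2r by auto
  \<comment> \<open>No condition on \<open>r2\<close> remains: it is adjacent to \<open>r1\<close>,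
    so \<open>CF\<close> counts it as blocked.\<close>
  have baseF: "(\<forall>v\<in>L1 \<union> L2 - (S \<union> T). v \<noteq> r1 \<longrightarrow> blk A (S \<union> T) v \<or> A v r1) \<longleftrightarrow>
     (\<forall>v\<in>L1 - S. v \<noteq> r1 \<longrightarrow> blk A1 S v \<or> A1 v r1) \<and>
     (\<forall>v\<in>L2 - T. v \<noteq> r2 \<longrightarrow> blk A2 T v \<or> A2 v r2 \<and> r2 \<in> T \<and> r1 \<in> S)"
  proof -
    have "A1 v r1 = False" if "v \<in> L2" for v using that g1 disj unfolding graph_on_def by blast
    moreover have "r2 \<notin> L1" using r2 disj by blast
    ultimately show ?thesis unfolding split Ar using b1 b2 b2r by auto
  qed
  note bn = blk_nb[of A1 S r1] blk_nb[of A2 T r2]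
  show ?A ?B ?C ?D ?E ?F
    unfolding C_defs mem_Collect_eq Un_iff rs[unfolded Un_iff] d base baseF n1 ST
    by (cases "r1 \<in> S"; cases "r2 \<in> T"; use bn b1r in auto)+
qed

lemma cardsJ:
  "card (CA (L1 \<union> L2) A r1) = card (CA L1 A1 r1) * (card (CA L2 A2 r2) + card (CD L2 A2 r2) + card (CE L2 A2 r2)) +
     card (CB L1 A1 r1) * (card (CD L2 A2 r2) + card (CE L2 A2 r2)) + card (CC L1 A1 r1) * card (CD L2 A2 r2)" (is ?A)
  "card (CB (L1 \<union> L2) A r1) = card (CB L1 A1 r1) * card (CA L2 A2 r2) + card (CC L1 A1 r1) * card (CE L2 A2 r2)" (is ?B)
  "card (CC (L1 \<union> L2) A r1) = card (CC L1 A1 r1) * card (CA L2 A2 r2)" (is ?C)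
  "card (CD (L1 \<union> L2) A r1) = card (CD L1 A1 r1) * (card (CA L2 A2 r2) + card (CB L2 A2 r2) + card (CC L2 A2 r2)) +
     card (CF L1 A1 r1) * card (CF L2 A2 r2)" (is ?D)
  "card (CE (L1 \<union> L2) A r1) = card (CE L1 A1 r1) * (card (CA L2 A2 r2) + card (CB L2 A2 r2))" (is ?E)
  "card (CF (L1 \<union> L2) A r1) = card (CF L1 A1 r1) * (card (CA L2 A2 r2) + card (CB L2 A2 r2) + card (CC L2 A2 r2))" (is ?F)
proof -
  have fin: "finite L1" "finite L2" using g1 g2 by (auto simp: graph_on_def)
  note f = C_finite[OF fin(1), of A1 r1] C_finite[OF fin(2), of A2 r2]
  note cU = card_C_Un[OF fin(2)] card_cartesian_product
  have P: "X \<subseteq> Pow L1 \<Longrightarrow> Z \<subseteq> Pow L2 \<Longrightarrow> X \<times> Z \<subseteq> Pow L1 \<times> Pow L2" for X Z by blast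
  have T: "(X \<times> Z) \<inter> (X' \<times> Z') = {}" if "X \<inter> X' = {}" for X X' :: "'a set set" and Z Z' :: "'a set set"
    using that by blast
  have "card (CA (L1 \<union> L2) A r1) = card (CA L1 A1 r1 \<times> (CA L2 A2 r2 \<union> CD L2 A2 r2 \<union> CE L2 A2 r2) \<union>
      CB L1 A1 r1 \<times> (CD L2 A2 r2 \<union> CE L2 A2 r2) \<union> CC L1 A1 r1 \<times> CD L2 A2 r2)"
    by (rule card_J[OF disj _ C_Pow(1)], simp add: statesJ(1), intro Un_least Sigma_mono C_Pow)
  also have "\<dots> = card (CA L1 A1 r1 \<times> (CA L2 A2 r2 \<union> CD L2 A2 r2 \<union> CE L2 A2 r2)) +
      card (CB L1 A1 r1 \<times> (CD L2 A2 r2 \<union> CE L2 A2 r2)) + card (CC L1 A1 r1 \<times> CD L2 A2 r2)"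
    by (subst card_Un_disjoint, (use f in simp)+, (simp add: Int_Un_distrib2 T C_disjoint), subst card_Un_disjoint)
      (use f in \<open>simp_all add: T C_disjoint\<close>)
  finally show ?A by (simp add: cU)
  have "card (CB (L1 \<union> L2) A r1) = card (CB L1 A1 r1 \<times> CA L2 A2 r2 \<union> CC L1 A1 r1 \<times> CE L2 A2 r2)"
    by (rule card_J[OF disj _ C_Pow(2)], simp add: statesJ(2), intro Un_least Sigma_mono C_Pow)
  also have "\<dots> = card (CB L1 A1 r1 \<times> CA L2 A2 r2) + card (CC L1 A1 r1 \<times> CE L2 A2 r2)"
    by (subst card_Un_disjoint) (use f in \<open>simp_all add: T C_disjoint\<close>)
  finally show ?B by (simp add: cU)
  have "card (CC (L1 \<union> L2) A r1) = card (CC L1 A1 r1 \<times> CA L2 A2 r2)"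
    by (rule card_J[OF disj _ C_Pow(3)], simp add: statesJ(3), intro Un_least Sigma_mono C_Pow)
  then show ?C by (simp add: cU)
  have "card (CD (L1 \<union> L2) A r1) = card (CD L1 A1 r1 \<times> (CA L2 A2 r2 \<union> CB L2 A2 r2 \<union> CC L2 A2 r2) \<union>
      CF L1 A1 r1 \<times> CF L2 A2 r2)"
    by (rule card_J[OF disj _ C_Pow(4)], simp add: statesJ(4), intro Un_least Sigma_mono C_Pow)
  also have "\<dots> = card (CD L1 A1 r1 \<times> (CA L2 A2 r2 \<union> CB L2 A2 r2 \<union> CC L2 A2 r2)) + card (CF L1 A1 r1 \<times> CF L2 A2 r2)"
    by (subst card_Un_disjoint) (use f in \<open>simp_all add: T C_disjoint\<close>)
  finally show ?D by (simp add: cU)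
  have "card (CE (L1 \<union> L2) A r1) = card (CE L1 A1 r1 \<times> (CA L2 A2 r2 \<union> CB L2 A2 r2))"
    by (rule card_J[OF disj _ C_Pow(5)], simp add: statesJ(5), intro Un_least Sigma_mono C_Pow)
  then show ?E by (simp add: cU)
  have "card (CF (L1 \<union> L2) A r1) = card (CF L1 A1 r1 \<times> (CA L2 A2 r2 \<union> CB L2 A2 r2 \<union> CC L2 A2 r2))"
    by (rule card_J[OF disj _ C_Pow(6)], simp add: statesJ(6), intro Un_least Sigma_mono C_Pow)
  then show ?F by (simp add: cU)
qed

end

subsection \<open>The graph of a rooted tree\<close>

primrec lab :: "'a rtree \<Rightarrow> 'a list" where
  "lab (Vtx x) = [x]"
| "lab (Join R W) = lab R @ lab W"

primrec eds :: "'a rtree \<Rightarrow> 'a set set" where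
  "eds (Vtx x) = {}"
| "eds (Join R W) = insert {rt R, rt W} (eds R \<union> eds W)"

definition ad :: "'a rtree \<Rightarrow> 'a \<Rightarrow> 'a \<Rightarrow> bool" where
  "ad T x y \<longleftrightarrow> {x, y} \<in> eds T"

lemma rt_in_lab [simp]: "rt T \<in> set (lab T)"
  by (induction T) auto

lemma length_lab: "length (lab T) = nsz T"
  by (induction T) auto

lemma ad_Join: "ad (Join R W) x y \<longleftrightarrow> ad R x y \<or> ad W x y \<or> x = rt R \<and> y = rt W \<or> x = rt W \<and> y = rt R"
  by (auto simp: ad_def doubleton_eq_iff)

lemma graph_on_ad: "distinct (lab T) \<Longrightarrow> graph_on (set (lab T)) (ad T)"
proof (induction T)
  case (Join R W)
  then have "rt R \<noteq> rt W" using rt_in_lab[of R] rt_in_lab[of W] by (auto simp del: rt_in_lab)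
  moreover have "graph_on (set (lab R)) (ad R)" "graph_on (set (lab W)) (ad W)" using Join by auto
  ultimately show ?case
    unfolding graph_on_def ad_Join lab.simps set_append by (metis UnCI finite_Un rt_in_lab)
qed (simp add: graph_on_def ad_def)

lemma card_states:
  assumes "distinct (lab T)"
  shows "card (CA (set (lab T)) (ad T) (rt T)) = va T \<and> card (CB (set (lab T)) (ad T) (rt T)) = vb T \<and>
    card (CC (set (lab T)) (ad T) (rt T)) = vc T \<and> card (CD (set (lab T)) (ad T) (rt T)) = vd T \<and>
    card (CE (set (lab T)) (ad T) (rt T)) = ve T \<and> card (CF (set (lab T)) (ad T) (rt T)) = vf T"
  using assms
proof (induction T)
  case (Vtx x)
  have *: "CA {x} (ad (Vtx x)) x = {}" "CB {x} (ad (Vtx x)) x = {}" "CC {x} (ad (Vtx x)) x = {{}}"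
    "CD {x} (ad (Vtx x)) x = {}" "CE {x} (ad (Vtx x)) x = {{x}}" "CF {x} (ad (Vtx x)) x = {{x}}"
    unfolding C_defs by (auto simp: ad_def nb_def blk_def dis_def)
  show ?case by (simp add: *)
next
  case (Join R W)
  interpret two_graphs "set (lab R)" "set (lab W)" "ad R" "ad W" "ad (Join R W)" "rt R" "rt W"
    using Join.prems graph_on_ad[of R] graph_on_ad[of W] by unfold_locales (auto simp: ad_Join)
  show ?case using Join cardsJ by simp
qed

lemma card_mds_tree:
  assumes "distinct (lab T)"
  shows "card (mds (set (lab T)) (ad T)) = vg T"
proof -
  have f: "finite (set (lab T))" by simp
  show ?thesis
    unfolding mds_states[OF rt_in_lab] vg_def using card_states[OF assms] card_C_Un(1)[OF f] by simp
qed

subsection \<open>Forests as lists of rooted trees\<close>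

definition flab :: "'a rtree list \<Rightarrow> 'a list" where "flab ts = concat (map lab ts)"
definition feds :: "'a rtree list \<Rightarrow> 'a set set" where "feds ts = (\<Union>T\<in>set ts. eds T)"

definition represents :: "'a rtree list \<Rightarrow> 'a ugraph \<Rightarrow> bool" where
  "represents ts G \<longleftrightarrow> distinct (flab ts) \<and> verts G = set (flab ts) \<and> edges G = feds ts"

lemma mds_disjoint_union:
  assumes g1: "graph_on V1 A1" and g2: "graph_on V2 A2" and disj: "V1 \<inter> V2 = {}"
  shows "card (mds (V1 \<union> V2) (\<lambda>x y. A1 x y \<or> A2 x y)) = card (mds V1 A1) * card (mds V2 A2)"
proof -
  let ?A = "\<lambda>x y. A1 x y \<or> A2 x y"
  have *: "A1 v x \<Longrightarrow> v \<in> V1 \<and> x \<in> V1" "A2 v x \<Longrightarrow> v \<in> V2 \<and> x \<in> V2" for v x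
    using g1 g2 by (auto simp: graph_on_def)
  have U: "S \<union> T \<in> mds (V1 \<union> V2) ?A \<longleftrightarrow> S \<in> mds V1 A1 \<and> T \<in> mds V2 A2" if S: "S \<subseteq> V1" and T: "T \<subseteq> V2" for S T
  proof -
    have Av: "v \<in> V1 \<Longrightarrow> ?A v x \<longleftrightarrow> A1 v x" "v \<in> V2 \<Longrightarrow> ?A v x \<longleftrightarrow> A2 v x" for v x using * disj by blast+
    have m: "x \<in> S \<union> T \<and> A1 v x \<longleftrightarrow> x \<in> S \<and> A1 v x" "x \<in> S \<union> T \<and> A2 v x \<longleftrightarrow> x \<in> T \<and> A2 v x" for v x
      using * S T disj by blast+
    have n: "v \<in> V1 \<Longrightarrow> nb ?A (S \<union> T) v \<longleftrightarrow> nb A1 S v" "v \<in> V2 \<Longrightarrow> nb ?A (S \<union> T) v \<longleftrightarrow> nb A2 T v" for v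
      unfolding nb_def using Av m by blast+
    have b: "v \<in> V1 \<Longrightarrow> blk ?A (S \<union> T) v \<longleftrightarrow> blk A1 S v" "v \<in> V2 \<Longrightarrow> blk ?A (S \<union> T) v \<longleftrightarrow> blk A2 T v" for v
    proof -
      assume v: "v \<in> V1"
      show "blk ?A (S \<union> T) v \<longleftrightarrow> blk A1 S v"
        unfolding blk_def Av(1)[OF v] using m(1) n(1) *(1) by blast
    next
      assume v: "v \<in> V2"
      show "blk ?A (S \<union> T) v \<longleftrightarrow> blk A2 T v"
        unfolding blk_def Av(2)[OF v] using m(2) n(2) *(2) by blast
    qed
    have d: "dis ?A (S \<union> T) \<longleftrightarrow> dis A1 S \<and> dis A2 T"
    proof -
      have "x \<in> V1 \<Longrightarrow> x \<notin> V2" for x using disj by blast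
      then show ?thesis unfolding dis_def using * S T by (smt (verit, best) UnCI UnE subsetD)
    qed
    have e: "V1 \<union> V2 - (S \<union> T) = (V1 - S) \<union> (V2 - T)" using S T disj by blast
    show ?thesis unfolding mds_def mem_Collect_eq d e ball_Un using S T b by auto
  qed
  have sub: "mds L A \<subseteq> Pow L" for L :: "'a set" and A by (auto simp: mds_def)
  have "card (mds (V1 \<union> V2) ?A) = card (mds V1 A1 \<times> mds V2 A2)"
    by (rule card_J[OF disj _ sub], simp add: U, intro Sigma_mono sub)
  then show ?thesis by (simp add: card_cartesian_product)
qed

lemma card_mds_forest:
  "distinct (flab ts) \<Longrightarrow> graph_on (set (flab ts)) (\<lambda>x y. {x, y} \<in> feds ts) \<and>
    card (mds (set (flab ts)) (\<lambda>x y. {x, y} \<in> feds ts)) = prod_list (map vg ts)"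
proof (induction ts)
  case Nil
  have "mds {} (\<lambda>x y :: 'a. False) = {{}}" by (auto simp: mds_def dis_def)
  then have "card (mds {} (\<lambda>x y :: 'a. False)) = 1" by (metis is_singletonI is_singleton_altdef)
  then show ?case by (simp add: flab_def feds_def graph_on_def)
next
  case (Cons T ts)
  have L: "set (flab (T # ts)) = set (lab T) \<union> set (flab ts)" by (simp add: flab_def)
  have A: "(\<lambda>x y. {x, y} \<in> feds (T # ts)) = (\<lambda>x y. ad T x y \<or> {x, y} \<in> feds ts)"
    by (auto simp: feds_def ad_def)
  have d: "distinct (lab T)" "distinct (flab ts)" "set (lab T) \<inter> set (flab ts) = {}"
    using Cons.prems by (auto simp: flab_def)
  have g: "graph_on (set (lab T)) (ad T)" "graph_on (set (flab ts)) (\<lambda>x y. {x, y} \<in> feds ts)"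
    using graph_on_ad[OF d(1)] Cons.IH[OF d(2)] by auto
  have "graph_on (set (lab T) \<union> set (flab ts)) (\<lambda>x y. ad T x y \<or> {x, y} \<in> feds ts)"
    using g unfolding graph_on_def by auto
  then show ?case
    unfolding L A using mds_disjoint_union[OF g d(3)] card_mds_tree[OF d(1)] Cons.IH[OF d(2)] by simp
qed

text \<open>Subsets of dissociation sets are dissociation sets, so maximality can be tested by
  adding single vertices, and a vertex can be added exactly if it is not blocked.\<close>

lemma maximal_dissociation_set_mds:
  assumes "simple_graph G"
  shows "{S. maximal_dissociation_set G S} = mds (verts G) (adj G)"
proof -
  have fin: "finite (verts G)" using assms by (simp add: simple_graph_def)
  have irr: "\<not> adj G x x" for x
    using assms unfolding simple_graph_def adj_def by (metis doubleton_eq_iff insert_absorb2)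
  have sym: "adj G x y \<longleftrightarrow> adj G y x" for x y by (simp add: adj_def insert_commute)
  have ds: "dissociation_set G S \<longleftrightarrow> S \<subseteq> verts G \<and> dis (adj G) S" for S
  proof -
    have "vertex_degree (induced G S) v \<le> 1 \<longleftrightarrow> (\<forall>x\<in>S. \<forall>y\<in>S. adj G v x \<and> adj G v y \<longrightarrow> x = y)"
      if "S \<subseteq> verts G" "v \<in> S" for v
    proof -
      have "{u \<in> verts (induced G S). adj (induced G S) v u} = {u \<in> S. adj G v u}"
        using that by (auto simp: induced_def adj_def)
      moreover have "finite {u \<in> S. adj G v u}" using finite_subset[OF that(1) fin] by simp
      ultimately show ?thesis unfolding vertex_degree_def
        by (simp add: card_le_Suc0_iff_eq) blast
    qed
    then show ?thesis unfolding dissociation_set_def dis_def by blast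
  qed
  have hered: "dis (adj G) S \<Longrightarrow> S' \<subseteq> S \<Longrightarrow> dis (adj G) S'" for S S' unfolding dis_def by blast
  have ins: "dis (adj G) (insert v S) \<longleftrightarrow> \<not> blk (adj G) S v" if "dis (adj G) S" "v \<notin> S" for v S
  proof
    assume d: "dis (adj G) (insert v S)"
    show "\<not> blk (adj G) S v"
    proof
      assume "blk (adj G) S v"
      then obtain x where x: "x \<in> S" "adj G v x" "(\<exists>y\<in>S. adj G x y) \<or> (\<exists>y\<in>S. y \<noteq> x \<and> adj G v y)"
        unfolding blk_def nb_def by blast
      then show False using d that sym unfolding dis_def by (metis insertCI)
    qed
  next
    assume b: "\<not> blk (adj G) S v"
    have 1: "adj G v x \<Longrightarrow> x \<in> S \<Longrightarrow> y \<in> S \<Longrightarrow> \<not> adj G x y" for x y using b unfolding blk_def nb_def by blast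
    have 2: "adj G v x \<Longrightarrow> x \<in> S \<Longrightarrow> y \<in> S \<Longrightarrow> adj G v y \<Longrightarrow> x = y" for x y using b unfolding blk_def by blast
    show "dis (adj G) (insert v S)"
      unfolding dis_def
    proof (intro ballI impI)
      fix u x y assume "u \<in> insert v S" "x \<in> insert v S" "y \<in> insert v S" "adj G u x \<and> adj G u y"
      then show "x = y" using 1 2 sym irr that(1) unfolding dis_def by (elim insertE) metis+
    qed
  qed
  show ?thesis
  proof (intro set_eqI iffI)
    fix S assume "S \<in> {S. maximal_dissociation_set G S}"
    then have S: "S \<subseteq> verts G" "dis (adj G) S" "\<And>S'. S' \<subseteq> verts G \<Longrightarrow> dis (adj G) S' \<Longrightarrow> \<not> S \<subset> S'"
      unfolding maximal_dissociation_set_def ds by blast+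
    have "blk (adj G) S v" if "v \<in> verts G - S" for v
      using S(3)[of "insert v S"] S(1,2) ins that by blast
    then show "S \<in> mds (verts G) (adj G)" using S(1,2) by (simp add: mds_def)
  next
    fix S assume "S \<in> mds (verts G) (adj G)"
    then have S: "S \<subseteq> verts G" "dis (adj G) S" "\<And>v. v \<in> verts G - S \<Longrightarrow> blk (adj G) S v"
      by (auto simp: mds_def)
    have False if S': "S' \<subseteq> verts G" "dis (adj G) S'" "S \<subset> S'" for S'
    proof -
      obtain v where v: "v \<in> S'" "v \<notin> S" using S' by blast
      then have "dis (adj G) (insert v S)" using hered[OF S'(2), of "insert v S"] S'(3) by blast
      then show False using ins[OF S(2) v(2)] S(3)[of v] S'(1) v by blast
    qed
    then show "S \<in> {S. maximal_dissociation_set G S}"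
      unfolding maximal_dissociation_set_def ds using S(1,2) by blast
  qed
qed

lemma eds_simple: "distinct (lab T) \<Longrightarrow> e \<in> eds T \<Longrightarrow> \<exists>u\<in>set (lab T). \<exists>v\<in>set (lab T). u \<noteq> v \<and> e = {u, v}"
proof (induction T)
  case (Join R W)
  then have "rt R \<noteq> rt W" using rt_in_lab[of R] rt_in_lab[of W] by (auto simp del: rt_in_lab)
  with Join show ?case by (auto 4 4)
qed simp

lemma represents_simple: "represents ts G \<Longrightarrow> simple_graph G"
  unfolding represents_def simple_graph_def
proof (intro conjI ballI)
  fix e assume G: "distinct (flab ts) \<and> verts G = set (flab ts) \<and> edges G = feds ts" and "e \<in> edges G"
  then obtain T where T: "T \<in> set ts" "e \<in> eds T" by (auto simp: feds_def)
  have "distinct (lab T)" using G T(1) by (auto simp: flab_def distinct_concat_iff)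
  from eds_simple[OF this T(2)] show "\<exists>u\<in>verts G. \<exists>v\<in>verts G. u \<noteq> v \<and> e = {u, v}"
    using G T(1) by (fastforce simp: flab_def)
qed simp

theorem represents_num_mds: "represents ts G \<Longrightarrow> \<Phi> G = prod_list (map vg ts)"
proof -
  assume G: "represents ts G"
  have "adj G = (\<lambda>x y. {x, y} \<in> feds ts)" using G by (intro ext) (auto simp: represents_def adj_def)
  then show ?thesis
    using card_mds_forest[of ts] G
    unfolding num_mds_def maximal_dissociation_set_mds[OF represents_simple[OF G]] represents_def by simp
qed

lemma represents_order: "represents ts G \<Longrightarrow> graph_order G = sum_list (map nsz ts)"
  unfolding represents_def graph_order_def
  using distinct_card[of "flab ts"] by (simp add: flab_def length_concat comp_def length_lab)

section \<open>Forests as graphs\<close>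

lemma req_graph: "req T U \<Longrightarrow> rt T = rt U \<and> set (lab T) = set (lab U) \<and> eds T = eds U"
  by (induction rule: req.induct) auto

lemma ueq_graph: "ueq T U \<Longrightarrow> set (lab T) = set (lab U) \<and> eds T = eds U"
proof (induction rule: ueq.induct)
  case (swap A B)
  show ?case by (auto simp: insert_commute)
qed (auto dest: req_graph)

text \<open>Distinctness means that the length equals the number of elements, so rearranged label
  lists inherit it.\<close>

lemma distinct_transfer: "set xs = set ys \<Longrightarrow> length xs = length ys \<Longrightarrow> distinct xs \<Longrightarrow> distinct ys"
  by (metis card_distinct distinct_card)

lemma represents_ueq:
  assumes "list_all2 ueq ts us" "represents ts G"
  shows "represents us G"
proof -
  have "set (flab ts) = set (flab us) \<and> length (flab ts) = length (flab us) \<and> feds ts = feds us"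
    using assms(1)
  proof (induction rule: list_all2_induct)
    case (Cons T ts U us)
    then show ?case using ueq_graph[of T U] ueq_nsz[of T U] by (auto simp: flab_def feds_def length_lab)
  qed simp
  then show ?thesis using assms(2) distinct_transfer unfolding represents_def by metis
qed

lemma represents_move: "represents (xs @ T # ys) G \<longleftrightarrow> represents (T # xs @ ys) G"
proof -
  have "set (flab (xs @ T # ys)) = set (flab (T # xs @ ys))" "length (flab (xs @ T # ys)) = length (flab (T # xs @ ys))"
    "feds (xs @ T # ys) = feds (T # xs @ ys)"
    by (auto simp: flab_def feds_def)
  then show ?thesis using distinct_transfer unfolding represents_def by metis
qed

lemma represents_extract:
  assumes "T \<in> set ts" "represents ts G"
  obtains xs ys where "ts = xs @ T # ys" "represents (T # xs @ ys) G"
  using assms represents_move by (metis split_list)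

subsection \<open>Isomorphisms\<close>

lemma rt_map: "rt (map_rtree f T) = f (rt T)"
  by (induction T) auto

lemma lab_map: "lab (map_rtree f T) = map f (lab T)"
  by (induction T) auto

lemma eds_map: "eds (map_rtree f T) = (`) f ` eds T"
  by (induction T) (auto simp: rt_map)

lemma vec_map: "vec (map_rtree f T) = vec T"
  by (induction T) auto

lemma vg_map: "vg (map_rtree f T) = vg T"
  by (simp add: vg_def v_defs vec_map)

lemma flab_map: "flab (map (map_rtree f) ts) = map f (flab ts)"
  by (simp add: flab_def map_concat comp_def lab_map)

lemma feds_map: "feds (map (map_rtree f) ts) = (`) f ` feds ts"
  by (auto simp: feds_def eds_map)

text \<open>The relator of the trivial relation: equality up to labels, also across different label
  types.\<close>

definition same_shape :: "'a rtree \<Rightarrow> 'b rtree \<Rightarrow> bool" where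
  "same_shape = rel_rtree (\<lambda>_ _. True)"

lemma same_shape_simps [simp]:
  "same_shape (Vtx x) (Vtx y)" "same_shape (Join R W) (Join R' W') \<longleftrightarrow> same_shape R R' \<and> same_shape W W'"
  by (simp_all add: same_shape_def)

lemma same_shape_map:
  assumes "same_shape T U"
  shows "length (lab T) = length (lab U)" "map f (lab T) = lab U \<Longrightarrow> map_rtree f T = U"
  using assms unfolding same_shape_def by (induction rule: rtree.rel_induct) auto

text \<open>Trees of equal shape list their labels in corresponding order; relabelling position by
  position is the isomorphism.\<close>

lemma represents_iso:
  assumes "list_all2 same_shape ts us" "represents ts G" "represents us H"
  shows "G \<simeq> H"
proof -
  have len: "length (flab ts) = length (flab us)"
    using assms(1) by (induction rule: list_all2_induct) (auto simp: flab_def same_shape_map(1))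
  define f where "f = (\<lambda>x. the (map_of (zip (flab ts) (flab us)) x))"
  have d: "distinct (flab ts)" "distinct (flab us)" using assms by (auto simp: represents_def)
  have "f (flab ts ! i) = flab us ! i" if "i < length (flab ts)" for i
    using that d(1) len unfolding f_def by (simp add: map_of_zip_nth)
  then have f: "map f (flab ts) = flab us" using len by (intro nth_equalityI) auto
  have "map f (flab ts) = flab us \<Longrightarrow> map (map_rtree f) ts = us"
    using assms(1)
  proof (induction rule: list_all2_induct)
    case (Cons T ts U us)
    then have "map f (lab T) @ map f (flab ts) = lab U @ flab us" by (simp add: flab_def)
    then have "map f (lab T) = lab U" "map f (flab ts) = flab us"
      using same_shape_map(1)[OF Cons.hyps(1)] by (simp_all add: append_eq_append_conv)
    then show ?case using Cons same_shape_map(2)[OF Cons.hyps(1)] by simp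
  qed simp
  then have us: "us = map (map_rtree f) ts" using f by simp
  have inj: "inj_on f (set (flab ts))" using f d by (metis distinct_map)
  have img: "f ` set (flab ts) = set (flab us)" using f by (metis list.set_map)
  have "adj G u v \<longleftrightarrow> adj H (f u) (f v)" if "u \<in> set (flab ts)" "v \<in> set (flab ts)" for u v
  proof -
    have sub: "e \<subseteq> set (flab ts)" if "e \<in> feds ts" for e
      using that represents_simple[OF assms(2)] assms(2) by (fastforce simp: simple_graph_def represents_def)
    have "{f u, f v} \<in> feds us \<longleftrightarrow> f ` {u, v} \<in> (`) f ` feds ts" unfolding us feds_map by simp
    also have "\<dots> \<longleftrightarrow> {u, v} \<in> feds ts"
    proof
      assume "f ` {u, v} \<in> (`) f ` feds ts"
      then obtain e where e: "e \<in> feds ts" "f ` {u, v} = f ` e" by blast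
      then have "{u, v} = e" using inj_on_image_eq_iff[OF inj _ sub[OF e(1)], of "{u, v}"] that by simp
      then show "{u, v} \<in> feds ts" using e by simp
    qed blast
    finally show ?thesis using assms by (simp add: adj_def represents_def)
  qed
  then show ?thesis
    unfolding graph_iso_def using inj img assms(2,3) by (intro exI[of _ f]) (auto simp: bij_betw_def represents_def)
qed

text \<open>Relabelling along the inverse isomorphism turns the trees of \<open>H\<close> into trees
  for \<open>G\<close>. As \<open>vg\<close> ignores labels, \<open>\<Phi> G\<close> can then be
  computed from \<open>us\<close>.\<close>

lemma represents_iso_back:
  assumes "simple_graph G" "G \<simeq> H" "represents us H"
  obtains f where "represents (map (map_rtree f) us) G"
proof -
  obtain f where f: "bij_betw f (verts G) (verts H)"
    and a: "\<And>u v. u \<in> verts G \<Longrightarrow> v \<in> verts G \<Longrightarrow> adj G u v \<longleftrightarrow> adj H (f u) (f v)"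
    using assms(2) unfolding graph_iso_def by blast
  define g where "g = inv_into (verts G) f"
  have g: "bij_betw g (verts H) (verts G)" unfolding g_def by (rule bij_betw_inv_into[OF f])
  have gf: "x \<in> verts G \<Longrightarrow> g (f x) = x" for x unfolding g_def using f by (simp add: bij_betw_inv_into_left)
  have fg: "y \<in> verts H \<Longrightarrow> f (g y) = y" for y unfolding g_def using f by (simp add: bij_betw_inv_into_right)
  have H: "simple_graph H" "verts H = set (flab us)" "edges H = feds us" "distinct (flab us)"
    using represents_simple[OF assms(3)] assms(3) by (auto simp: represents_def)
  have E: "edges G = (`) g ` edges H"
  proof (intro set_eqI iffI)
    fix e assume e: "e \<in> edges G"
    then obtain u v where uv: "u \<in> verts G" "v \<in> verts G" "e = {u, v}"
      using assms(1) unfolding simple_graph_def by metis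
    then have "{f u, f v} \<in> edges H" using e a by (simp add: adj_def)
    moreover have "e = g ` {f u, f v}" using uv gf by simp
    ultimately show "e \<in> (`) g ` edges H" by blast
  next
    fix e assume "e \<in> (`) g ` edges H"
    then obtain e' where e': "e' \<in> edges H" "e = g ` e'" by blast
    then obtain u v where uv: "u \<in> verts H" "v \<in> verts H" "e' = {u, v}"
      using H(1) unfolding simple_graph_def by metis
    then have "g u \<in> verts G" "g v \<in> verts G" using g by (auto simp: bij_betw_def)
    then show "e \<in> edges G" using a[of "g u" "g v"] fg uv e' by (simp add: adj_def)
  qed
  have "represents (map (map_rtree g) us) G"
    using g H E unfolding represents_def flab_map feds_map by (auto simp: bij_betw_def distinct_map)
  then show ?thesis using that by blast
qed

lemma iso_num_mds:
  assumes "simple_graph G" "G \<simeq> H" "represents us H"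
  shows "\<Phi> G = prod_list (map vg us)"
proof -
  obtain f where "represents (map (map_rtree f) us) G" using represents_iso_back[OF assms] by blast
  from represents_num_mds[OF this] show ?thesis by (simp add: comp_def vg_map)
qed

subsection \<open>Every forest is represented\<close>

lemma attach_ex:
  assumes "y \<in> set (lab T)"
  shows "\<exists>T'. rt T' = rt T \<and> set (lab T') = set (lab T) \<union> set (lab W) \<and> length (lab T') = length (lab T) + length (lab W) \<and>
    eds T' = insert {y, rt W} (eds T \<union> eds W)"
  using assms
proof (induction T)
  case (Vtx x)
  then show ?case by (intro exI[of _ "Join (Vtx x) W"]) auto
next
  case (Join R U)
  then consider "y \<in> set (lab R)" | "y \<in> set (lab U)" by auto
  then show ?case
  proof cases
    case 1
    then obtain R' where "rt R' = rt R" "set (lab R') = set (lab R) \<union> set (lab W)"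
      "length (lab R') = length (lab R) + length (lab W)" "eds R' = insert {y, rt W} (eds R \<union> eds W)"
      using Join.IH(1) by blast
    then show ?thesis by (intro exI[of _ "Join R' U"]) auto
  next
    case 2
    then obtain U' where "rt U' = rt U" "set (lab U') = set (lab U) \<union> set (lab W)"
      "length (lab U') = length (lab U) + length (lab W)" "eds U' = insert {y, rt W} (eds U \<union> eds W)"
      using Join.IH(2) by blast
    then show ?thesis by (intro exI[of _ "Join R U'"]) auto
  qed
qed

text \<open>The side containing \<open>x\<close> is rerooted there, and the other side is then
  attached at the former root, now an inner vertex. Lengths are recorded so that distinctness of the
  labels carries over.\<close>

lemma reroot_ex:
  assumes "x \<in> set (lab T)"
  shows "\<exists>T'. rt T' = x \<and> set (lab T') = set (lab T) \<and> length (lab T') = length (lab T) \<and> eds T' = eds T"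
  using assms
proof (induction T)
  case (Join R W)
  then consider "x \<in> set (lab R)" | "x \<in> set (lab W)" by auto
  then show ?case
  proof cases
    case 1
    then obtain R' where R': "rt R' = x" "set (lab R') = set (lab R)" "length (lab R') = length (lab R)" "eds R' = eds R"
      using Join.IH(1) by blast
    then have "rt R \<in> set (lab R')" by simp
    from attach_ex[OF this, of W] show ?thesis using R' by auto
  next
    case 2
    then obtain W' where W': "rt W' = x" "set (lab W') = set (lab W)" "length (lab W') = length (lab W)" "eds W' = eds W"
      using Join.IH(2) by blast
    then have "rt W \<in> set (lab W')" by simp
    from attach_ex[OF this, of R] show ?thesis using W' by (auto simp: insert_commute Un_commute add.commute)
  qed
next
  case (Vtx y)
  then show ?case by (intro exI[of _ "Vtx x"]) auto
qed

lemma root_path_ex: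
  assumes "y \<in> set (lab T)" "distinct (lab T)"
  shows "\<exists>p. p \<noteq> [] \<and> hd p = rt T \<and> last p = y \<and> distinct p \<and> set p \<subseteq> set (lab T) \<and> successively (ad T) p"
  using assms
proof (induction T)
  case (Vtx x)
  then show ?case by (intro exI[of _ "[x]"]) auto
next
  case (Join R W)
  have mono: "successively (ad R) p \<Longrightarrow> successively (ad (Join R W)) p"
    "successively (ad W) p \<Longrightarrow> successively (ad (Join R W)) p" for p
    by (auto simp: ad_Join elim!: successively_mono)
  from Join.prems consider "y \<in> set (lab R)" | "y \<in> set (lab W)" by auto
  then show ?case
  proof cases
    case 1
    then obtain p where "p \<noteq> []" "hd p = rt R" "last p = y" "distinct p" "set p \<subseteq> set (lab R)" "successively (ad R) p"
      using Join by auto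
    then show ?thesis using mono by (intro exI[of _ p]) auto
  next
    case 2
    then obtain p where p: "p \<noteq> []" "hd p = rt W" "last p = y" "distinct p" "set p \<subseteq> set (lab W)" "successively (ad W) p"
      using Join by auto
    have "rt R \<notin> set p" using p(5) Join.prems(2) rt_in_lab[of R] unfolding lab.simps distinct_append by blast
    moreover have "ad (Join R W) (rt R) (hd p)" using p(2) by (simp add: ad_Join)
    ultimately show ?thesis using p mono(2)[OF p(6)]
      by (intro exI[of _ "rt R # p"]) (auto simp: successively_Cons)
  qed
qed

lemma tree_path_ex:
  assumes "x \<in> set (lab T)" "y \<in> set (lab T)" "distinct (lab T)"
  shows "\<exists>p. p \<noteq> [] \<and> hd p = x \<and> last p = y \<and> distinct p \<and> successively (ad T) p"
proof -
  obtain T' where T': "rt T' = x" "set (lab T') = set (lab T)" "length (lab T') = length (lab T)" "eds T' = eds T"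
    using reroot_ex[OF assms(1)] by blast
  have "distinct (lab T')" using distinct_transfer[of "lab T" "lab T'"] T' assms(3) by simp
  moreover have "ad T' = ad T" using T'(4) by (intro ext) (simp add: ad_def)
  ultimately show ?thesis using root_path_ex[of y T'] T' assms(2) by auto
qed

lemma represents_tree_adj: "represents ts G \<Longrightarrow> T \<in> set ts \<Longrightarrow> ad T x y \<Longrightarrow> adj G x y"
  by (auto simp: represents_def feds_def ad_def adj_def)

text \<open>Induction on the number of edges. Once an edge is removed its ends lie in different
  trees, because a path within one tree would close up to a cycle. The two trees, rerooted at these
  ends, are put together by \<open>Join\<close>.\<close>

theorem forest_represented:
  assumes "is_forest G"
  shows "\<exists>ts. represents ts G"
proof -
  have "finite (edges G)"
  proof (rule finite_subset)
    show "edges G \<subseteq> Pow (verts G)" using assms unfolding is_forest_def simple_graph_def by fastforce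
    show "finite (Pow (verts G))" using assms by (simp add: is_forest_def simple_graph_def)
  qed
  moreover have "\<exists>ts. represents ts G" if "card (edges G) = n" "finite (edges G)" "is_forest G" for n and G :: "'a ugraph"
    using that
  proof (induction n arbitrary: G)
    case 0
    then have "edges G = {}" "finite (verts G)" by (auto simp: is_forest_def simple_graph_def)
    moreover obtain xs where "set xs = verts G" "distinct xs" using finite_distinct_list calculation(2) by blast
    moreover have "concat (map (lab \<circ> Vtx) xs) = xs" by (induction xs) auto
    ultimately have "represents (map Vtx xs) G" by (auto simp: represents_def flab_def feds_def)
    then show ?case by blast
  next
    case (Suc n)
    then obtain e where e: "e \<in> edges G" by fastforce
    define G' where "G' = G\<lparr>edges := edges G - {e}\<rparr>"
    have G: "simple_graph G" "\<nexists>p. is_cycle G p" using Suc.prems by (auto simp: is_forest_def)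
    then obtain u v where uv: "u \<in> verts G" "v \<in> verts G" "u \<noteq> v" "e = {u, v}"
      using e by (auto simp: simple_graph_def)
    have mono: "adj G' x y \<Longrightarrow> adj G x y" for x y by (auto simp: adj_def G'_def)
    have "is_cycle G' p \<Longrightarrow> is_cycle G p" for p
      using mono by (auto simp: is_cycle_def elim!: successively_mono)
    then have "is_forest G'" using G by (auto simp: is_forest_def simple_graph_def G'_def)
    moreover have "card (edges G') = n" "finite (edges G')" using Suc.prems e by (auto simp: G'_def)
    ultimately obtain ts where ts: "represents ts G'" using Suc.IH by blast
    have verts: "verts G' = verts G" by (simp add: G'_def)
    obtain T where T: "T \<in> set ts" "u \<in> set (lab T)"
      using ts uv verts by (auto simp: represents_def flab_def)
    obtain xs where xs: "represents (T # xs) G'" using represents_extract[OF T(1) ts] by blast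
    have dT: "distinct (lab T)" using xs by (simp add: represents_def flab_def)
    have "v \<notin> set (lab T)"
    proof
      assume "v \<in> set (lab T)"
      then obtain p where p: "p \<noteq> []" "hd p = u" "last p = v" "distinct p" "successively (ad T) p"
        using tree_path_ex[OF T(2) _ dT] by blast
      have s: "successively (adj G') p"
        using p(5) represents_tree_adj[OF xs] by (auto elim!: successively_mono)
      have ne: "\<not> adj G' u v" using uv by (simp add: adj_def G'_def)
      \<comment> \<open>The removed edge is missing in \<open>G'\<close>, so the path cannot consist
        of \<open>u\<close> and \<open>v\<close> alone.\<close>
      have "length p \<ge> 3"
      proof (rule ccontr)
        assume "\<not> length p \<ge> 3"
        then have "p = [u] \<or> p = [u, v]" using p(1-3) by (cases p; cases "tl p"; cases "tl (tl p)") auto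
        then show False
        proof
          assume "p = [u]"
          then show False using p(3) uv(3) by simp
        next
          assume "p = [u, v]"
          then show False using s ne by simp
        qed
      qed
      moreover have "successively (adj G) p" using s mono by (auto elim!: successively_mono)
      moreover have "adj G (last p) (hd p)" using p(2,3) e uv(4) by (simp add: adj_def insert_commute)
      ultimately show False using G(2) p(4) by (auto simp: is_cycle_def)
    qed
    then obtain U where U: "U \<in> set xs" "v \<in> set (lab U)"
      using xs uv verts by (auto simp: represents_def flab_def)
    obtain ys zs where yz: "xs = ys @ U # zs" using U(1) by (meson split_list)
    obtain T' where T': "rt T' = u" "set (lab T') = set (lab T)" "length (lab T') = length (lab T)" "eds T' = eds T"
      using reroot_ex[OF T(2)] by blast
    obtain U' where U': "rt U' = v" "set (lab U') = set (lab U)" "length (lab U') = length (lab U)" "eds U' = eds U"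
      using reroot_ex[OF U(2)] by blast
    have "set (flab (Join T' U' # ys @ zs)) = set (flab (T # xs))"
      "length (flab (Join T' U' # ys @ zs)) = length (flab (T # xs))"
      "feds (Join T' U' # ys @ zs) = insert e (feds (T # xs))"
      using T' U' uv(4) unfolding yz by (auto simp: flab_def feds_def)
    moreover have "edges G = insert e (edges G')" using e by (auto simp: G'_def)
    ultimately have "represents (Join T' U' # ys @ zs) G"
      using xs verts distinct_transfer[of "flab (T # xs)" "flab (Join T' U' # ys @ zs)"] by (simp add: represents_def)
    then show ?case by blast
  qed
  ultimately show ?thesis using assms by blast
qed

theorem tree_represented:
  assumes "is_tree G"
  shows "\<exists>T. represents [T] G"
proof -
  have G: "is_forest G" "verts G \<noteq> {}" "\<And>u v. u \<in> verts G \<Longrightarrow> v \<in> verts G \<Longrightarrow> (adj G)\<^sup>*\<^sup>* u v"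
    using assms by (auto simp: is_tree_def connected_graph_def)
  obtain ts where ts: "represents ts G" using forest_represented[OF G(1)] by blast
  then obtain T xs where T: "ts = T # xs" using G(2) by (cases ts) (auto simp: represents_def flab_def)
  have "xs = []"
  proof (rule ccontr)
    assume "xs \<noteq> []"
    then obtain U us where xs: "xs = U # us" by (cases xs) auto
    have d: "set (lab T) \<inter> set (flab xs) = {}" and v: "verts G = set (lab T) \<union> set (flab xs)"
      using ts unfolding T represents_def by (auto simp: flab_def)
    have step: "y \<in> set (lab T)" if x: "x \<in> set (lab T)" and xy: "adj G x y" for x y
    proof -
      obtain W where W: "W \<in> set (T # xs)" "{x, y} \<in> eds W"
        using xy ts unfolding T by (auto simp: represents_def feds_def adj_def)
      have "distinct (lab W)" using ts W(1) unfolding T by (auto simp: represents_def flab_def distinct_concat_iff)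
      from graph_on_ad[OF this] have "x \<in> set (lab W)" "y \<in> set (lab W)"
        using W(2) by (auto simp: graph_on_def ad_def)
      then show ?thesis using W(1) x d by (auto simp: flab_def)
    qed
    have "y \<in> set (lab T)" if "(adj G)\<^sup>*\<^sup>* (rt T) y" for y
      using that by (induction rule: rtranclp_induct) (auto intro: step)
    moreover have "rt T \<in> verts G" "rt U \<in> verts G" "rt U \<in> set (flab xs)" using v unfolding xs by (auto simp: flab_def)
    ultimately show False using G(3) d by blast
  qed
  then show ?thesis using ts T by auto
qed

subsection \<open>The extremal graphs\<close>

lemma flab_append: "flab (ts @ us) = flab ts @ flab us"
  by (simp add: flab_def)

lemma feds_append: "feds (ts @ us) = feds ts \<union> feds us"
  by (auto simp: feds_def)

lemma represents_disj_union:
  assumes "represents ts G" "represents us H"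
  shows "represents (map (map_rtree Inl) ts @ map (map_rtree Inr) us) (G \<uplus> H)"
  using assms unfolding represents_def
  by (auto simp: flab_append feds_append flab_map feds_map distinct_map disj_union_def)

lemma represents_copies:
  assumes "represents ts G"
  shows "represents (concat (map (\<lambda>i. map (map_rtree (Pair i)) ts) [0..<k])) (copies k G)"
proof -
  have V: "flab (concat (map (\<lambda>i. map (map_rtree (Pair i)) ts) js)) = List.product js (flab ts)" for js
    by (induction js) (auto simp: flab_append flab_map, simp add: flab_def)
  have E: "feds (concat (map (\<lambda>i. map (map_rtree (Pair i)) ts) js)) = {Pair i ` e | i e. i \<in> set js \<and> e \<in> feds ts}" for js
    by (auto simp: feds_def eds_map)
  show ?thesis
    using assms unfolding represents_def V E copies_def by (auto simp: distinct_product)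
qed

lemma att_graph:
  "lab (att T Ws) = lab T @ flab Ws" "eds (att T Ws) = eds T \<union> feds Ws \<union> {{rt T, rt W} | W. W \<in> set Ws}"
  by (induction Ws arbitrary: T) (auto simp: flab_def feds_def)

lemma represents_add_edges:
  assumes "represents (T # Ws) G"
  shows "represents [att T Ws] (add_edges G {{rt T, rt W} | W. W \<in> set Ws})"
proof -
  have "flab [att T Ws] = flab (T # Ws)" by (simp add: flab_def att_graph)
  moreover have "feds [att T Ws] = feds (T # Ws) \<union> {{rt T, rt W} | W. W \<in> set Ws}"
    by (simp add: feds_def att_graph)
  ultimately show ?thesis using assms unfolding represents_def add_edges_def by simp
qed

text \<open>The roots are the points where edges get attached: the centre 1 of P_3 for
  \<open>T_star\<close>, the leaf 1 of K_{1,3} for \<open>T_star_8\<close>.\<close>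

abbreviation P3_tree :: "nat rtree" where "P3_tree \<equiv> Join (Join (Vtx 1) (Vtx 0)) (Vtx 2)"
abbreviation K13_tree :: "nat rtree" where "K13_tree \<equiv> Join (Vtx 1) (Join (Join (Vtx 0) (Vtx 2)) (Vtx 3))"
abbreviation K14_tree :: "nat rtree" where
  "K14_tree \<equiv> Join (Join (Join (Join (Vtx 0) (Vtx 1)) (Vtx 2)) (Vtx 3)) (Vtx 4)"

lemma represents_P3: "represents [P3_tree] (path_graph 3)"
proof -
  have "{..<3} = {0, 1, 2 :: nat}" by auto
  moreover have "{{i, Suc i} | i. Suc i < 3} = (\<lambda>i. {i, Suc i}) ` {0, 1 :: nat}"
    by (rule set_eqI) (auto simp: numeral_3_eq_3 less_Suc_eq)
  ultimately show ?thesis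
    by (simp add: represents_def flab_def feds_def path_graph_def insert_commute numeral_2_eq_2)
qed

lemma represents_P1: "represents [Vtx 0] (path_graph 1)"
  by (simp add: represents_def flab_def feds_def path_graph_def lessThan_Suc)

lemma star_graph_eq: "star_graph m = \<lparr>verts = {..m}, edges = (\<lambda>i. {0, i}) ` {1..m}\<rparr>"
proof -
  have "{1..m} = {i. 1 \<le> i \<and> i \<le> m}" by auto
  then show ?thesis by (simp only: star_graph_def setcompr_eq_image)
qed

lemma represents_K13: "represents [K13_tree] (star_graph 3)"
proof -
  have "{..3} = {0, 1, 2, 3 :: nat}" "{1..3} = {1, 2, 3 :: nat}" by auto
  then show ?thesis by (simp add: represents_def flab_def feds_def star_graph_eq insert_commute)
qed

lemma represents_K14: "represents [K14_tree] (star_graph 4)"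
proof -
  have "{..4} = {0, 1, 2, 3, 4 :: nat}" "{1..4} = {1, 2, 3, 4 :: nat}" by auto
  then show ?thesis by (simp add: represents_def flab_def feds_def star_graph_eq insert_commute)
qed

lemma represents_copies_single:
  assumes "represents [T] G"
  shows "represents (map (\<lambda>i. map_rtree (Pair i) T) [0..<k]) (copies k G)"
proof -
  have "concat (map (\<lambda>i. map (map_rtree (Pair i)) [T]) [0..<k]) = map (\<lambda>i. map_rtree (Pair i) T) [0..<k]"
    by (induction k) auto
  then show ?thesis using represents_copies[OF assms, of k] by simp
qed

lemma represents_T_star:
  "represents [att (Vtx (Inr 0)) (map (\<lambda>i. map_rtree Inl (map_rtree (Pair i) P3_tree)) [0..<(n - 1) div 3])] (T_star n)"
proof -
  define k where "k = (n - 1) div 3"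
  let ?Ws = "map (\<lambda>i. map_rtree Inl (map_rtree (Pair i) P3_tree)) [0..<k] :: (nat \<times> nat + nat) rtree list"
  have "represents (?Ws @ [Vtx (Inr 0)]) (copies k (path_graph 3) \<uplus> path_graph 1)"
    using represents_disj_union[OF represents_copies_single[OF represents_P3, of k] represents_P1] by (simp add: comp_def)
  then have "represents (Vtx (Inr 0) # ?Ws) (copies k (path_graph 3) \<uplus> path_graph 1)"
    using represents_move[of ?Ws _ "[]"] by simp
  from represents_add_edges[OF this]
  have "represents [att (Vtx (Inr 0)) ?Ws]
      (add_edges (copies k (path_graph 3) \<uplus> path_graph 1) {{rt (Vtx (Inr 0)), rt W} | W. W \<in> set ?Ws})" .
  moreover have "{{rt (Vtx (Inr 0)), rt W} | W. W \<in> set ?Ws} = {{Inr 0, Inl (i, 1)} | i. i < k}"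
    by (simp add: setcompr_eq_image image_image lessThan_def[symmetric] atLeast0LessThan)
  ultimately show ?thesis unfolding T_star_def Let_def k_def by simp
qed

lemma represents_T_star_8:
  "represents [Join (map_rtree (Pair 0) K13_tree) (map_rtree (Pair 1) K13_tree)] T_star_8"
proof -
  have "represents [map_rtree (Pair 0) K13_tree, map_rtree (Pair 1) K13_tree] (copies 2 (star_graph 3))"
    using represents_copies_single[OF represents_K13, of 2] by (simp add: numeral_2_eq_2 upt_rec)
  from represents_add_edges[OF this] show ?thesis
    by (simp add: T_star_8_def)
qed

subsection \<open>Recognising the extremal graphs\<close>

text \<open>Equality of unrooted trees up to relabelling, in the form in which the extremal classes
  of the dichotomy deliver it.\<close>

definition like :: "'a rtree \<Rightarrow> 'b rtree \<Rightarrow> bool" where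
  "like T P \<longleftrightarrow> (\<exists>U. ueq T U \<and> same_shape U P)"

lemma same_shape_trans: "same_shape T U \<Longrightarrow> same_shape U V \<Longrightarrow> same_shape T V"
proof (induction T arbitrary: U V)
  case (Vtx x)
  then show ?case by (cases U; cases V) (auto simp: same_shape_def)
next
  case (Join R W)
  then show ?case by (cases U; cases V) (auto simp: same_shape_def)
qed

lemma same_shape_map_rtree: "same_shape T (map_rtree f T)"
  by (induction T) auto

lemma like_iso:
  assumes "list_all2 like ts ps" "represents ts G" "represents ps H"
  shows "G \<simeq> H"
proof -
  have "\<exists>us. list_all2 ueq ts us \<and> list_all2 same_shape us ps"
    using assms(1)
  proof (induction rule: list_all2_induct)
    case (Cons T ts P ps)
    then obtain U us where "ueq T U" "same_shape U P" "list_all2 ueq ts us" "list_all2 same_shape us ps"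
      by (auto simp: like_def)
    then show ?case by (intro exI[of _ "U # us"]) simp
  qed simp
  then show ?thesis using represents_ueq represents_iso assms(2,3) by metis
qed

lemma like_map: "like T P \<Longrightarrow> like T (map_rtree f P)"
  unfolding like_def using same_shape_trans same_shape_map_rtree by blast

lemma isP3c_shape: "isP3c A \<Longrightarrow> same_shape A P3_tree"
  by (auto simp: isP3c_def)

lemma P3_like: "nsz T = 3 \<Longrightarrow> like T P3_tree"
proof -
  assume "nsz T = 3"
  then have "isP3 T" using nsz_le3_item[of T] nsz_items[of T] by (auto simp: item_def)
  then consider x y z where "T = Join (Join (Vtx x) (Vtx y)) (Vtx z)" | x y z where "T = Join (Vtx x) (Join (Vtx y) (Vtx z))"
    by (auto simp: is_defs)
  then show ?thesis
  proof cases
    case 1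
    then have "ueq T T \<and> same_shape T P3_tree" by (auto intro: ueq.req)
    then show ?thesis unfolding like_def by blast
  next
    case (2 x y z)
    then have "ueq T (Join (Join (Vtx y) (Vtx z)) (Vtx x))" by (auto intro: ueq.swap)
    then show ?thesis unfolding like_def by fastforce
  qed
qed

lemma same_shape_att:
  "same_shape T U \<Longrightarrow> list_all2 same_shape Ws Vs \<Longrightarrow> same_shape (att T Ws) (att U Vs)"
  by (induction Ws arbitrary: T U Vs) (auto simp: list_all2_Cons1)

lemma Tstar_like_T_star:
  assumes "Tstar_like T" "nsz T = n"
  shows "like T (att (Vtx (Inr 0)) (map (\<lambda>i. map_rtree Inl (map_rtree (Pair i) P3_tree)) [0..<(n - 1) div 3]) :: (nat \<times> nat + nat) rtree)"
proof -
  obtain x Ws where T: "ueq T (att (Vtx x) Ws)" and Ws: "\<forall>A\<in>set Ws. isP3c A"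
    using assms(1) unfolding Tstar_like_def by blast
  then have "nsz T = 3 * length Ws + 1"
    using ueq_nsz[OF T] star_vals(6)[of Ws x] by (auto simp: isP3_def)
  then have "length Ws = (n - 1) div 3" using assms(2) by simp
  moreover have "same_shape A (map_rtree Inl (map_rtree (Pair i) P3_tree))" if "A \<in> set Ws" for A and i :: nat
    using Ws that by (intro same_shape_trans[OF same_shape_trans[OF isP3c_shape same_shape_map_rtree] same_shape_map_rtree]) auto
  ultimately have "list_all2 same_shape Ws (map (\<lambda>i. map_rtree Inl (map_rtree (Pair i) P3_tree)) [0..<(n - 1) div 3] :: (nat \<times> nat + nat) rtree list)"
    by (intro list_all2_all_nthI) (auto simp: in_set_conv_nth simp del: rtree.map)
  from same_shape_att[OF same_shape_simps(1) this] show ?thesis using T unfolding like_def by blast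
qed

lemma K13_like: "Tstar_like T \<Longrightarrow> nsz T = 4 \<Longrightarrow> like T K13_tree"
proof -
  assume "Tstar_like T" "nsz T = 4"
  from Tstar_like_T_star[OF this] obtain U where U: "ueq T U"
    "same_shape U (att (Vtx (Inr 0)) (map (\<lambda>i. map_rtree Inl (map_rtree (Pair i) P3_tree)) [0..<1]) :: (nat \<times> nat + nat) rtree)"
    unfolding like_def by auto
  then have "same_shape U K13_tree" by (intro same_shape_trans[OF U(2)]) simp
  then show ?thesis using U(1) unfolding like_def by blast
qed

lemma K14_like_star: "K14_like T \<Longrightarrow> like T K14_tree"
  unfolding K14_like_def like_def by fastforce

lemma T8_like_star: "T8_like T \<Longrightarrow> like T (Join (map_rtree (Pair 0) K13_tree) (map_rtree (Pair 1) K13_tree))"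
  unfolding T8_like_def like_def isP3c_def by fastforce

lemma represents_swap: "represents (xs @ ys) G \<Longrightarrow> represents (ys @ xs) G"
  unfolding represents_def flab_append feds_append by auto

lemma represents_partition:
  assumes "represents ts G"
  shows "represents (filter P ts @ filter (\<lambda>T. \<not> P T) ts) G"
  using assms
proof (induction ts arbitrary: G)
  case (Cons T ts)
  let ?G = "\<lparr>verts = set (flab ts), edges = feds ts\<rparr>"
  let ?us = "filter P ts @ filter (\<lambda>T. \<not> P T) ts"
  have *: "distinct (flab (T # ts))" "verts G = set (lab T) \<union> set (flab ts)" "edges G = eds T \<union> feds ts"
    using Cons.prems by (auto simp: represents_def flab_def feds_def)
  then have "represents ts ?G" by (simp add: represents_def flab_def)
  then have "represents ?us ?G" by (rule Cons.IH)
  then have "represents (T # ?us) G" using * by (auto simp: represents_def flab_def feds_def)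
  then show ?case using represents_move[of "filter P ts" T "filter (\<lambda>T. \<not> P T) ts" G] by simp
qed simp

lemma like_copies_iso:
  assumes "represents (us @ ts) F" "\<forall>T\<in>set ts. nsz T = 3" "list_all2 like us ps" "represents ps H"
  shows "F \<simeq> copies (length ts) (path_graph 3) \<uplus> H"
proof -
  let ?Ps = "map (map_rtree Inl) (map (\<lambda>i. map_rtree (Pair i) P3_tree) [0..<length ts])"
  have "list_all2 like ts ?Ps"
    using assms(2) P3_like like_map by (fastforce simp: list_all2_conv_all_nth)
  moreover have "list_all2 like us (map (map_rtree Inr) ps)"
    using assms(3) by (auto simp: list.rel_map elim!: list_all2_mono intro: like_map)
  ultimately have "list_all2 like (ts @ us) (?Ps @ map (map_rtree Inr) ps)" by (rule list_all2_appendI)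
  then show ?thesis
    using represents_swap[OF assms(1)]
      represents_disj_union[OF represents_copies_single[OF represents_P3] assms(4)] by (rule like_iso)
qed

lemma vg_P3_tree: "vg (Join (Join (Vtx x) (Vtx y)) (Vtx z)) = 3" "vg K13_tree = 4" "vg K14_tree = 5"
  "vg (Join (map_rtree (Pair 0) K13_tree) (map_rtree (Pair 1) K13_tree)) = 15"
  by (simp_all add: vg_def)

lemma vg_T_star_tree:
  "vg (att (Vtx (Inr 0)) (map (\<lambda>i. map_rtree Inl (map_rtree (Pair i) P3_tree)) [0..<k]) :: (nat \<times> nat + nat) rtree) = 3 ^ k + k"
proof -
  let ?Ws = "map (\<lambda>i. map_rtree Inl (map_rtree (Pair i) P3_tree)) [0..<k] :: (nat \<times> nat + nat) rtree list"
  have "\<forall>A\<in>set ?Ws. isP3 A" by (auto simp: isP3_def isP3c_def)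
  moreover have "filter isP3e ?Ws = []" by (auto simp: filter_empty_conv isP3e_def)
  ultimately show ?thesis using star_vg[of ?Ws "Inr 0"] by simp
qed

lemma iso_copies_num_mds:
  assumes "simple_graph F" "F \<simeq> copies k (path_graph 3) \<uplus> H" "represents ps H"
  shows "\<Phi> F = 3 ^ k * prod_list (map vg ps)"
proof -
  have "prod_list (map (\<lambda>x. 3) [0..<k]) = (3 :: nat) ^ k" by (induction k) auto
  then show ?thesis
    using iso_num_mds[OF assms(1,2) represents_disj_union[OF represents_copies_single[OF represents_P3] assms(3)]]
    by (simp add: comp_def vg_map vg_P3_tree)
qed

subsection \<open>The bound for forests\<close>

definition rho :: "'a rtree \<Rightarrow> real" where "rho T = real (vg T) ^ 3 / 3 ^ nsz T"

lemma rho_nonneg [simp]: "rho T \<ge> 0"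
  by (simp add: rho_def)

text \<open>With \<open>x = lam ^ n\<close>, the power in \<open>tb n\<close> is at most
  \<open>x / 1.442\<close> and the linear term at most \<open>0.0471 * x\<close>. The target 0.4063
  lies just below 8000 / 19683, the normalised value \<open>f2 9 ^ 3 / 3 ^ 9\<close>.\<close>

lemma tb_cube:
  assumes "n \<ge> 12"
  shows "tb n ^ 3 \<le> 0.4063 * 3 ^ n"
proof -
  obtain k where n: "n = 12 + k" using assms le_Suc_ex by blast
  define x where "x = lam ^ n"
  have x: "x \<ge> 81 * (1 + 0.442 * real k)" using lam_pow_ge[of 12 k] by (simp add: n x_def lam_pow_eval)
  have "lam * lam ^ (n - 1) = x" unfolding x_def n by (simp add: power_Suc[symmetric] del: power_Suc)
  moreover have "1.442 * lam ^ (n - 1) \<le> lam * lam ^ (n - 1)" using lam_gt by (intro mult_right_mono) auto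
  moreover have "x > 0" by (simp add: x_def)
  ultimately have "lam ^ (n - 1) \<le> 0.6935 * x" by simp
  moreover have "(real n - 1) / 3 \<le> 0.0471 * x" using x by (simp add: n field_simps)
  ultimately have "tb n \<le> 0.7406 * x" unfolding tb_def by (simp add: diff_divide_distrib)
  moreover have "0 \<le> tb n" unfolding tb_def n by (intro add_nonneg_nonneg) (auto simp: less_imp_le)
  ultimately have "tb n ^ 3 \<le> (0.7406 * x) ^ 3" by (rule power_mono)
  also have "\<dots> = 0.7406 ^ 3 * x ^ 3" by (simp only: power_mult_distrib)
  also have "x ^ 3 = 3 ^ n" unfolding x_def using lam_pow_mult3[of n] by (simp add: mult.commute flip: power_mult)
  also have "0.7406 ^ 3 * 3 ^ n \<le> (0.4063 :: real) * 3 ^ n" by (intro mult_right_mono) (simp_all add: power3_eq_cube)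
  finally show ?thesis .
qed

text \<open>0.458 is slightly above 1000 / 2187, which is the value both for 10 sets at order 7 and
  for 30 sets at order 10. Orders divisible by 3 satisfy the smaller bound 0.4063.\<close>

lemma tree_classes:
  assumes "nsz T \<noteq> 3"
  obtains (K13) "nsz T = 4" "vg T = 4" "Tstar_like T" | (K14) "nsz T = 5" "vg T = 5" "K14_like T"
  | (T7) "nsz T = 7" "vg T = 11" "Tstar_like T" | (T8) "nsz T = 8" "vg T = 15" "T8_like T"
  | (other) "rho T \<le> 0.458" "nsz T mod 3 = 0 \<Longrightarrow> rho T \<le> 0.4063"
proof (cases "nsz T < 4")
  case True
  then have "nsz T = 1 \<or> nsz T = 2" using assms nsz_pos[of T] by linarith
  then have "rho T \<le> 0.4063"
    using small_vg[of T] by (auto simp: rho_def le_Suc_eq)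
  then show ?thesis by (intro other) auto
next
  case False
  then have n4: "4 \<le> nsz T" by simp
  note D = tree_dichotomy[OF n4] special_vg[OF n4]
  show ?thesis
  proof (cases "nsz T \<le> 9")
    case True
    then have "nsz T = 4 \<or> nsz T = 5 \<or> nsz T = 6 \<or> nsz T = 7 \<or> nsz T = 8 \<or> nsz T = 9" using n4 by linarith
    moreover have other': ?thesis if "vg T \<le> sc (nsz T)"
    proof -
      have "real (vg T) ^ 3 \<le> real (sc (nsz T)) ^ 3" using that by (intro power_mono) auto
      then have "rho T \<le> real (sc (nsz T)) ^ 3 / 3 ^ nsz T" unfolding rho_def by (intro divide_right_mono) auto
      then have "rho T \<le> 0.458" "nsz T mod 3 = 0 \<Longrightarrow> rho T \<le> 0.4063"
        using calculation by (auto simp: sc_def)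
      then show ?thesis by (rule other)
    qed
    consider "lesser T" | "Tstar_like T" "nsz T = 4 \<or> nsz T = 7" | "K14_like T" | "T8_like T"
      using D calculation by fastforce
    then show ?thesis
    proof cases
      case 1
      then show ?thesis using other' True by (simp add: lesser_def)
    next
      case 2
      then show ?thesis using D(2) K13 T7 by auto
    next
      case 3
      then show ?thesis using D(3) K14 by auto
    next
      case 4
      then show ?thesis using D(4) T8 by auto
    qed
  next
    case False
    have tb: "real (vg T) \<le> tb (nsz T)" using special_le_tb[OF n4 D(1)] .
    consider "nsz T = 10" | "nsz T = 11" | "nsz T \<ge> 12" using False by linarith
    then show ?thesis
    proof cases
      case 1
      then have "real (vg T) \<le> 30" using tb by (simp add: tb_def lam_pow_eval)
      then have "real (vg T) ^ 3 \<le> 30 ^ 3" by (intro power_mono) auto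
      then show ?thesis using 1 by (intro other) (simp_all add: rho_def)
    next
      case 2
      then have "real (vg T) < 43" using tb lam_lt by (simp add: tb_def lam_pow_eval)
      then have "vg T \<le> 42" by linarith
      then have "real (vg T) \<le> 42" by simp
      then have "real (vg T) ^ 3 \<le> 42 ^ 3" by (intro power_mono) auto
      then show ?thesis using 2 by (intro other) (simp_all add: rho_def)
    next
      case 3
      have "real (vg T) ^ 3 \<le> tb (nsz T) ^ 3" using tb by (intro power_mono) auto
      then have "rho T \<le> 0.4063" using tb_cube[OF 3] by (simp add: rho_def field_simps)
      then show ?thesis by (intro other) auto
    qed
  qed
qed

definition rhos :: "'a rtree list \<Rightarrow> real" where "rhos ts = prod_list (map rho ts)"

lemma prod_vg_cube: "real (prod_list (map vg ts)) ^ 3 = rhos ts * 3 ^ sum_list (map nsz ts)"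
  by (induction ts) (simp_all add: rhos_def rho_def power_mult_distrib power_add)

lemma rhos_nonneg: "rhos ts \<ge> 0"
  unfolding rhos_def by (induction ts) auto

definition K13 :: "'a rtree \<Rightarrow> bool" where "K13 T \<longleftrightarrow> nsz T = 4 \<and> vg T = 4 \<and> Tstar_like T"
definition K14 :: "'a rtree \<Rightarrow> bool" where "K14 T \<longleftrightarrow> nsz T = 5 \<and> vg T = 5 \<and> K14_like T"
definition T7 :: "'a rtree \<Rightarrow> bool" where "T7 T \<longleftrightarrow> nsz T = 7 \<and> vg T = 11 \<and> Tstar_like T"
definition T8 :: "'a rtree \<Rightarrow> bool" where "T8 T \<longleftrightarrow> nsz T = 8 \<and> vg T = 15 \<and> T8_like T"

lemma rho_special: "K13 T \<Longrightarrow> rho T = 64 / 81" "K14 T \<Longrightarrow> rho T = 125 / 243" "T7 T \<Longrightarrow> rho T = 1331 / 2187"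
  "T8 T \<Longrightarrow> rho T = 125 / 243"
  by (simp_all add: K13_def K14_def T7_def T8_def rho_def)

lemma rho_classes:
  assumes "nsz T \<noteq> 3"
  obtains "K13 T" | "K14 T" | "T7 T" | "T8 T" | "rho T \<le> 0.458" "nsz T mod 3 = 0 \<Longrightarrow> rho T \<le> 0.4063"
  using assms by (rule tree_classes) (auto simp: K13_def K14_def T7_def T8_def)

lemma rho_not_K13: "nsz T \<noteq> 3 \<Longrightarrow> \<not> K13 T \<Longrightarrow> rho T \<le> 1331 / 2187"
  by (rule rho_classes[of T]) (auto simp: rho_special)

lemma rho_le: "nsz T \<noteq> 3 \<Longrightarrow> rho T \<le> 64 / 81"
  using rho_not_K13[of T] rho_special(1)[of T] by (cases "K13 T") auto

lemma rhos_le: "\<forall>T\<in>set us. nsz T \<noteq> 3 \<Longrightarrow> rhos us \<le> (64 / 81) ^ length us"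
proof (induction us)
  case (Cons T us)
  then have "rho T * rhos us \<le> 64 / 81 * (64 / 81) ^ length us"
    using rho_le[of T] rhos_nonneg[of us] by (intro mult_mono) auto
  then show ?case by (simp add: rhos_def)
qed (simp add: rhos_def)

text \<open>All unnamed combinations fall below 0.4063: their values are at most 64/81 * 0.458,
  (1331/2187)^2, 1331/2187 * (64/81)^2 or (64/81)^4. Only a single component can exceed it without
  being one of the special trees, and then its order is not divisible by 3.\<close>

lemma components_cases:
  assumes "\<forall>T\<in>set us. nsz T \<noteq> 3"
  obtains (Nil) "us = []" | (one) T where "us = [T]" "K13 T \<or> K14 T \<or> T7 T \<or> T8 T"
  | (two) A B where "us = [A, B] \<or> us = [B, A]" "K13 A" "K13 B \<or> K14 B \<or> T7 B \<or> T8 B"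
  | (three) A B C where "us = [A, B, C]" "K13 A" "K13 B" "K13 C"
  | (large) T where "us = [T]" "rho T \<le> 0.458" "nsz T mod 3 \<noteq> 0"
  | (small) "rhos us \<le> 0.4063"
proof -
  note le = rho_le and nk = rho_not_K13
  consider "us = []" | T where "us = [T]" | A B where "us = [A, B]" | A B C where "us = [A, B, C]" | "length us \<ge> 4"
    by (cases us; cases "tl us"; cases "tl (tl us)"; cases "tl (tl (tl us))") auto
  then show ?thesis
  proof cases
    case (2 T)
    then have "nsz T \<noteq> 3" using assms by simp
    then show ?thesis
    proof (cases rule: rho_classes)
      case 5
      then show ?thesis using 2 large small by (cases "nsz T mod 3 = 0") (auto simp: rhos_def)
    qed (use 2 one in auto)
  next
    case (3 A B)
    then have n: "nsz A \<noteq> 3" "nsz B \<noteq> 3" using assms by auto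
    have r: "rhos us = rho A * rho B" using 3 by (simp add: rhos_def)
    have *: thesis if "K13 A'" "nsz B' \<noteq> 3" "us = [A', B'] \<or> us = [B', A']" "rhos us = rho A' * rho B'" for A' B'
      using that(2)
    proof (cases rule: rho_classes)
      case 5
      have "rhos us \<le> 64 / 81 * 0.458" unfolding that(4) rho_special(1)[OF that(1)] using 5(1) by simp
      then show ?thesis by (intro small) simp
    qed (use that two in blast)+
    show ?thesis
    proof (cases "K13 A \<or> K13 B")
      case True
      then show ?thesis using *[of A B] *[of B A] 3 n r by (auto simp: mult.commute)
    next
      case False
      then have "rhos us \<le> 1331 / 2187 * (1331 / 2187)" unfolding r using nk n by (intro mult_mono) auto
      then show ?thesis by (intro small) simp
    qed
  next
    case (4 A B C)
    then have n: "nsz A \<noteq> 3" "nsz B \<noteq> 3" "nsz C \<noteq> 3" using assms by auto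
    have r: "rhos us = rho A * rho B * rho C" using 4 by (simp add: rhos_def)
    have *: "x * y * z \<le> 0.4063" if "x \<le> 1331 / 2187" "y \<le> 64 / 81" "z \<le> 64 / 81" "0 \<le> x" "0 \<le> y" "0 \<le> z" for x y z :: real
    proof -
      have "x * y * z \<le> 1331 / 2187 * (64 / 81) * (64 / 81)" using that by (intro mult_mono) auto
      then show ?thesis by simp
    qed
    show ?thesis
    proof (cases "K13 A \<and> K13 B \<and> K13 C")
      case True
      then show ?thesis using 4 three by blast
    next
      case False
      then have "rhos us \<le> 0.4063"
        using nk n le *[of "rho A" "rho B" "rho C"] *[of "rho B" "rho A" "rho C"] *[of "rho C" "rho A" "rho B"]
        unfolding r by (auto simp: ac_simps)
      then show ?thesis by (rule small)
    qed
  next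
    case 5
    have "rhos us \<le> (64 / 81) ^ length us" using rhos_le[OF assms] .
    also have "\<dots> \<le> (64 / 81) ^ 4" using 5 by (intro power_decreasing) auto
    finally show ?thesis by (intro small) (simp add: eval_nat_numeral)
  qed (use Nil in auto)
qed

section \<open>The extremal functions and the extremal forests\<close>

lemma f1_vals: "f1 (3 * k) = 3 ^ k" "f1 (3 * k + 4) = 4 * 3 ^ k" "f1 (3 * k + 8) = 16 * 3 ^ k"
proof -
  have "(3 * k + 4) mod 3 = 1" "(3 * k + 8) mod 3 = 2" by presburger+
  then show "f1 (3 * k) = 3 ^ k" "f1 (3 * k + 4) = 4 * 3 ^ k" "f1 (3 * k + 8) = 16 * 3 ^ k"
    by (simp_all add: f1_def)
qed

lemma f2_vals: "f2 (3 * k + 7) = 11 * 3 ^ k" "f2 (3 * k + 8) = 15 * 3 ^ k" "f2 (3 * k + 12) = 64 * 3 ^ k" "f2 9 = 20"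
proof -
  have "(3 * k + 7) mod 3 = 1" "(3 * k + 8) mod 3 = 2" "(3 * k + 12) mod 3 = 0" by presburger+
  moreover have "3 * k + 7 \<noteq> 9" "3 * k + 8 \<noteq> 9" by presburger+
  ultimately show "f2 (3 * k + 7) = 11 * 3 ^ k" "f2 (3 * k + 8) = 15 * 3 ^ k" "f2 (3 * k + 12) = 64 * 3 ^ k" "f2 9 = 20"
    by (simp_all add: f2_def)
qed

text \<open>From order 7 on, \<open>f2 n ^ 3 / 3 ^ n\<close> takes only four values: 1331/2187,
  125/243, 262144/531441, and 8000/19683 at \<open>n = 9\<close>. The last is the smallest and only
  just exceeds 0.4064; the first two belong to the orders not divisible by 3.\<close>

lemma f2_cube:
  assumes "n \<ge> 7"
  shows "0.4064 * 3 ^ n < real (f2 n) ^ 3" "n mod 3 \<noteq> 0 \<Longrightarrow> 0.51 * 3 ^ n < real (f2 n) ^ 3"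
proof -
  have cube: "((3 :: real) ^ k) ^ 3 = 3 ^ (3 * k)" for k by (simp add: mult.commute flip: power_mult)
  consider k where "n = 3 * k + 7" | k where "n = 3 * k + 8" | k where "n = 3 * k + 12" | "n = 9"
  proof -
    have "(\<exists>k. n = 3 * k + 7) \<or> (\<exists>k. n = 3 * k + 8) \<or> (\<exists>k. n = 3 * k + 12) \<or> n = 9"
      using assms by presburger
    then show ?thesis using that by blast
  qed
  then have "0.4064 * 3 ^ n < real (f2 n) ^ 3 \<and> (n mod 3 \<noteq> 0 \<longrightarrow> 0.51 * 3 ^ n < real (f2 n) ^ 3)"
  proof cases
    case (1 k)
    show ?thesis unfolding 1 f2_vals by (simp add: power_add power_mult_distrib cube)
  next
    case (2 k)
    show ?thesis unfolding 2 f2_vals by (simp add: power_add power_mult_distrib cube)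
  next
    case (3 k)
    show ?thesis unfolding 3 f2_vals by (simp add: power_add power_mult_distrib cube)
  next
    case 4
    show ?thesis unfolding 4 f2_vals by simp
  qed
  then show "0.4064 * 3 ^ n < real (f2 n) ^ 3" "n mod 3 \<noteq> 0 \<Longrightarrow> 0.51 * 3 ^ n < real (f2 n) ^ 3" by auto
qed

definition extremal :: "nat \<Rightarrow> 'b ugraph \<Rightarrow> bool" where
  "extremal n F \<longleftrightarrow>
     (n mod 3 = 1 \<and> F \<simeq> copies ((n - 7) div 3) (path_graph 3) \<uplus> T_star 7) \<or>
     (n mod 3 = 2 \<and> (F \<simeq> copies ((n - 8) div 3) (path_graph 3) \<uplus> T_star_8 \<or>
        F \<simeq> copies ((n - 5) div 3) (path_graph 3) \<uplus> star_graph 4)) \<or>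
     (n = 9 \<and> F \<simeq> star_graph 3 \<uplus> star_graph 4) \<or>
     (n mod 3 = 0 \<and> n \<ge> 12 \<and> F \<simeq> copies ((n - 12) div 3) (path_graph 3) \<uplus> copies 3 (star_graph 3))"

lemma represents_stars3:
  "represents [map_rtree (Pair 0) K13_tree, map_rtree (Pair 1) K13_tree, map_rtree (Pair 2) K13_tree] (copies 3 (star_graph 3))"
  using represents_copies_single[OF represents_K13, of 3] by (simp add: numeral_3_eq_3 upt_rec numeral_2_eq_2)

lemma represents_stars34:
  "represents [map_rtree Inl K13_tree, map_rtree Inr K14_tree] (star_graph 3 \<uplus> star_graph 4)"
  using represents_disj_union[OF represents_K13 represents_K14] by simp

lemma represents_T_star_7:
  "represents [att (Vtx (Inr 0)) (map (\<lambda>i. map_rtree Inl (map_rtree (Pair i) P3_tree)) [0..<2])] (T_star 7)"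
  using represents_T_star[of 7] by simp

lemma extremal_num_mds:
  assumes "simple_graph F" "extremal n F" "n \<ge> 7"
  shows "\<Phi> F = f2 n"
proof -
  consider "n mod 3 = 1" "F \<simeq> copies ((n - 7) div 3) (path_graph 3) \<uplus> T_star 7"
    | "n mod 3 = 2" "F \<simeq> copies ((n - 8) div 3) (path_graph 3) \<uplus> T_star_8"
    | "n mod 3 = 2" "F \<simeq> copies ((n - 5) div 3) (path_graph 3) \<uplus> star_graph 4"
    | "n = 9" "F \<simeq> star_graph 3 \<uplus> star_graph 4"
    | "n mod 3 = 0" "n \<ge> 12" "F \<simeq> copies ((n - 12) div 3) (path_graph 3) \<uplus> copies 3 (star_graph 3)"
    using assms(2) unfolding extremal_def by (elim disjE conjE) auto
  then show ?thesis
  proof cases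
    case 1
    obtain k where k: "n = 3 * k + 7"
      by (rule that[of "(n - 7) div 3"]) (use 1(1) assms(3) in presburger)
    show ?thesis
      using iso_copies_num_mds[OF assms(1) 1(2) represents_T_star_7] unfolding k f2_vals by (simp add: vg_T_star_tree del: rtree.map One_nat_def)
  next
    case 2
    obtain k where k: "n = 3 * k + 8"
      by (rule that[of "(n - 8) div 3"]) (use 2(1) assms(3) in presburger)
    show ?thesis
      using iso_copies_num_mds[OF assms(1) 2(2) represents_T_star_8] unfolding k f2_vals by (simp add: vg_def)
  next
    case 3
    obtain k where k: "n = 3 * k + 8"
      by (rule that[of "(n - 8) div 3"]) (use 3(1) assms(3) in presburger)
    show ?thesis
      using iso_copies_num_mds[OF assms(1) 3(2) represents_K14] unfolding k f2_vals by (simp add: vg_def)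
  next
    case 4
    show ?thesis
      using iso_num_mds[OF assms(1) 4(2) represents_stars34] unfolding 4 f2_vals by (simp add: vg_def)
  next
    case 5
    obtain k where k: "n = 3 * k + 12"
      by (rule that[of "(n - 12) div 3"]) (use 5(1,2) assms(3) in presburger)
    show ?thesis
      using iso_copies_num_mds[OF assms(1) 5(3) represents_stars3] unfolding k f2_vals by (simp add: vg_def)
  qed
qed

lemma vg_size3: "nsz T = 3 \<Longrightarrow> vg T = 3"
  using nsz_le3_item[of T] nsz_items[of T] by (auto simp: item_def is_defs vg_def)

lemma forest_split:
  assumes "is_forest F" "graph_order F = n"
  obtains us ts where "represents (us @ ts) F" "\<forall>T\<in>set us. nsz T \<noteq> 3" "\<forall>T\<in>set ts. nsz T = 3"
    "n = sum_list (map nsz us) + 3 * length ts" "\<Phi> F = prod_list (map vg us) * 3 ^ length ts"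
    "real (\<Phi> F) ^ 3 = rhos us * 3 ^ n"
proof -
  obtain ws where ws: "represents ws F" using forest_represented[OF assms(1)] by blast
  let ?us = "filter (\<lambda>T. nsz T \<noteq> 3) ws" and ?ts = "filter (\<lambda>T. \<not> nsz T \<noteq> 3) ws"
  have r: "represents (?us @ ?ts) F" by (rule represents_partition[OF ws])
  have 3: "\<forall>T\<in>set ts. nsz T = 3 \<Longrightarrow> sum_list (map nsz ts) = 3 * length ts \<and> prod_list (map vg ts) = 3 ^ length ts"
    for ts :: "'a rtree list"
    by (induction ts) (auto simp: vg_size3)
  have t: "\<forall>T\<in>set ?ts. nsz T = 3" by simp
  have n: "n = sum_list (map nsz ?us) + 3 * length ?ts"
    using represents_order[OF r] 3[OF t] assms(2) by simp
  have p: "\<Phi> F = prod_list (map vg ?us) * 3 ^ length ?ts"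
    using represents_num_mds[OF r] 3[OF t] by simp
  have "real (\<Phi> F) ^ 3 = rhos ?us * 3 ^ n"
    unfolding p n of_nat_mult power_mult_distrib prod_vg_cube by (simp add: power_add power_mult mult.commute flip: power_mult[of 3 _ 3])
  then show ?thesis using that[OF r _ t n p] by simp
qed

text \<open>Besides copies of P_3 alone, one or two further K_{1,3} attain \<open>f1 n\<close> and
  are excluded by hypothesis. The other named combinations are evaluated directly; the rest is
  separated by the gap between the bounds on \<open>rhos\<close> and the cube of
  \<open>f2\<close>.\<close>

lemma forest_bound:
  assumes "is_forest F" "graph_order F = n" "n \<ge> 7" "\<Phi> F < f1 n"
  shows "\<Phi> F \<le> f2 n \<and> (\<Phi> F = f2 n \<longrightarrow> extremal n F)"
proof -
  obtain us ts where r: "represents (us @ ts) F" and us: "\<forall>T\<in>set us. nsz T \<noteq> 3" and ts: "\<forall>T\<in>set ts. nsz T = 3"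
    and n: "n = sum_list (map nsz us) + 3 * length ts" and P: "\<Phi> F = prod_list (map vg us) * 3 ^ length ts"
    and R: "real (\<Phi> F) ^ 3 = rhos us * 3 ^ n"
    using forest_split[OF assms(1,2)] by blast
  define k where "k = length ts"
  note iso = like_copies_iso[OF r ts, folded k_def]
  have strict: "\<Phi> F < f2 n" if "real (\<Phi> F) ^ 3 < real (f2 n) ^ 3"
    using power_less_imp_less_base[OF that] by simp
  from us show ?thesis
  proof (cases rule: components_cases)
    case Nil
    then show ?thesis using n P assms(4) f1_vals(1)[of k] by (simp add: k_def)
  next
    case (one T)
    then consider "K13 T" | "K14 T" | "T7 T" | "T8 T" by blast
    then show ?thesis
    proof cases
      case 1
      then have "n = 3 * k + 4" "\<Phi> F = 4 * 3 ^ k" using n P one by (simp_all add: k_def K13_def)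
      then show ?thesis using f1_vals(2)[of k] assms(4) by simp
    next
      case 2
      then have n': "n = 3 * k + 5" "\<Phi> F = 5 * 3 ^ k" using n P one by (simp_all add: k_def K14_def)
      \<comment> \<open>Order at least 7 forces a P_3 beside K_{1,4}, so \<open>5 * 3 ^ k\<close>
        can be written as \<open>15 * 3 ^ k'\<close>.\<close>
      then obtain k' where k': "k = Suc k'" using assms(3) by (cases k) auto
      have "list_all2 like us [K14_tree]" using 2 one K14_like_star by (auto simp: K14_def)
      from iso[OF this represents_K14] have "F \<simeq> copies k (path_graph 3) \<uplus> star_graph 4" .
      moreover have "n mod 3 = 2" "(n - 5) div 3 = k" unfolding n' by presburger+
      moreover have "n = 3 * k' + 8" "\<Phi> F = 15 * 3 ^ k'" using n' k' by simp_all
      ultimately show ?thesis using f2_vals(2)[of k'] by (simp add: extremal_def)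
    next
      case 3
      then have n': "n = 3 * k + 7" "\<Phi> F = 11 * 3 ^ k" using n P one by (simp_all add: k_def T7_def)
      have "like T (att (Vtx (Inr 0)) (map (\<lambda>i. map_rtree Inl (map_rtree (Pair i) P3_tree)) [0..<2]) :: (nat \<times> nat + nat) rtree)"
        using 3 Tstar_like_T_star[of T 7] by (simp add: T7_def)
      then have "list_all2 like us [att (Vtx (Inr 0)) (map (\<lambda>i. map_rtree Inl (map_rtree (Pair i) P3_tree)) [0..<2]) :: (nat \<times> nat + nat) rtree]"
        unfolding one by simp
      from iso[OF this represents_T_star_7] have "F \<simeq> copies k (path_graph 3) \<uplus> T_star 7" .
      moreover have "n mod 3 = 1" "(n - 7) div 3 = k" unfolding n' by presburger+
      ultimately show ?thesis using f2_vals(1)[of k] n' by (simp add: extremal_def)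
    next
      case 4
      then have n': "n = 3 * k + 8" "\<Phi> F = 15 * 3 ^ k" using n P one by (simp_all add: k_def T8_def)
      have "list_all2 like us [Join (map_rtree (Pair 0) K13_tree) (map_rtree (Pair 1) K13_tree)]"
        unfolding one using 4 T8_like_star[of T] by (simp add: T8_def)
      from iso[OF this represents_T_star_8] have "F \<simeq> copies k (path_graph 3) \<uplus> T_star_8" .
      moreover have "n mod 3 = 2" "(n - 8) div 3 = k" unfolding n' by presburger+
      ultimately show ?thesis using f2_vals(2)[of k] n' by (simp add: extremal_def)
    qed
  next
    case (two A B)
    have nP: "n = nsz A + nsz B + 3 * k" "\<Phi> F = vg A * vg B * 3 ^ k"
      using two(1) n P by (auto simp: k_def)
    from two(3) consider "K13 B" | "K14 B" | "T7 B" | "T8 B" by blast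
    then show ?thesis
    proof cases
      case 1
      then have "n = 3 * k + 8" "\<Phi> F = 16 * 3 ^ k" using nP two(2) by (simp_all add: K13_def)
      then show ?thesis using f1_vals(3)[of k] assms(4) by simp
    next
      case 2
      then have n': "n = 3 * k + 9" "\<Phi> F = 20 * 3 ^ k" using nP two(2) by (simp_all add: K13_def K14_def)
      show ?thesis
      proof (cases k)
        case 0
        then have ts0: "ts = []" by (simp add: k_def)
        have AB: "represents [A, B] F"
          using r two(1) represents_swap[of "[B]" "[A]"] unfolding ts0 by auto
        have "list_all2 like [A, B] [map_rtree Inl K13_tree, map_rtree Inr K14_tree]"
          using two(2) 2 like_map[OF K13_like[of A], of "Inl :: nat \<Rightarrow> nat + nat"]
            like_map[OF K14_like_star[of B], of "Inr :: nat \<Rightarrow> nat + nat"]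
          by (simp add: K13_def K14_def del: rtree.map)
        from like_iso[OF this AB represents_stars34] show ?thesis
          using n' 0 f2_vals(4) by (simp add: extremal_def)
      next
        case (Suc k')
        \<comment> \<open>As soon as a P_3 is present, K_{1,3} with K_{1,4} loses against three
          K_{1,3}: 60 < 64.\<close>
        then have "n = 3 * k' + 12" "\<Phi> F = 60 * 3 ^ k'" using n' by simp_all
        then show ?thesis using f2_vals(3)[of k'] by simp
      qed
    next
      case 3
      \<comment> \<open>The closest competitor: 44 against 45 = 15 * 3.\<close>
      then have "n = 3 * (k + 1) + 8" "\<Phi> F = 44 * 3 ^ k" using nP two(2) by (simp_all add: K13_def T7_def)
      then show ?thesis using f2_vals(2)[of "k + 1"] by simp
    next
      case 4
      then have "n = 3 * k + 12" "\<Phi> F = 60 * 3 ^ k" using nP two(2) by (simp_all add: K13_def T8_def)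
      then show ?thesis using f2_vals(3)[of k] by simp
    qed
  next
    case (three A B C)
    then have n': "n = 3 * k + 12" "\<Phi> F = 64 * 3 ^ k" using n P by (simp_all add: k_def K13_def)
    have "like A (map_rtree (Pair (0 :: nat)) K13_tree)" "like B (map_rtree (Pair (1 :: nat)) K13_tree)"
      "like C (map_rtree (Pair (2 :: nat)) K13_tree)"
      using three(2-4) by (auto intro!: like_map K13_like simp: K13_def simp del: rtree.map One_nat_def)
    then have "list_all2 like us [map_rtree (Pair (0 :: nat)) K13_tree, map_rtree (Pair 1) K13_tree, map_rtree (Pair 2) K13_tree]"
      unfolding three by (simp del: rtree.map)
    from iso[OF this represents_stars3] have "F \<simeq> copies k (path_graph 3) \<uplus> copies 3 (star_graph 3)" .
    moreover have "n mod 3 = 0" "(n - 12) div 3 = k" "n \<ge> 12" unfolding n' by presburger+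
    ultimately show ?thesis using f2_vals(3)[of k] n' by (simp add: extremal_def)
  next
    case (large T)
    have "n mod 3 \<noteq> 0" using large n by simp
    then have "0.51 * 3 ^ n < real (f2 n) ^ 3" using f2_cube(2)[OF assms(3)] by blast
    moreover have "real (\<Phi> F) ^ 3 \<le> 0.51 * 3 ^ n"
      unfolding R using large by (intro mult_right_mono) (auto simp: rhos_def)
    ultimately show ?thesis using strict by fastforce
  next
    case small
    have "real (\<Phi> F) ^ 3 \<le> 0.4064 * 3 ^ n"
      unfolding R using small by (intro mult_right_mono) auto
    then show ?thesis using strict f2_cube(1)[OF assms(3)] by fastforce
  qed
qed

text \<open>The normalised value of 6 sets at order 6 is below the threshold 0.4063, so the gap
  argument of the larger orders does not apply directly. Integrality replaces it.\<close>

lemma forest_bound_6: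
  assumes "is_forest F" "graph_order F = 6" "\<Phi> F < f1 6"
  shows "\<Phi> F \<le> 6"
proof -
  obtain us ts where r: "represents (us @ ts) F" and us: "\<forall>T\<in>set us. nsz T \<noteq> 3" and ts: "\<forall>T\<in>set ts. nsz T = 3"
    and n: "6 = sum_list (map nsz us) + 3 * length ts" and P: "\<Phi> F = prod_list (map vg us) * 3 ^ length ts"
    and R: "real (\<Phi> F) ^ 3 = rhos us * 3 ^ 6"
    using forest_split[OF assms(1,2)] by blast
  from us show ?thesis
  proof (cases rule: components_cases)
    case Nil
    then have "length ts = 2" using n by simp
    then show ?thesis using Nil P assms(3) by (simp add: f1_def)
  next
    case (one T)
    then show ?thesis using n by (auto simp: K13_def K14_def T7_def T8_def) presburger+
  next
    case (two A B)
    then show ?thesis using n by (auto simp: K13_def K14_def T7_def T8_def)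
  next
    case (three A B C)
    then show ?thesis using n by (auto simp: K13_def)
  next
    case (large T)
    then show ?thesis using n by simp presburger
  next
    case small
    \<comment> \<open>0.4063 * 729 is less than 297, while \<open>7 ^ 3 = 343\<close>.\<close>
    then have "real (\<Phi> F) ^ 3 < 7 ^ 3" unfolding R by simp
    then have "real (\<Phi> F) < 7" by (rule power_less_imp_less_base) simp
    then show ?thesis by simp
  qed
qed

section \<open>The theorem in terms of graphs\<close>

lemma tb_powr: "n \<ge> 1 \<Longrightarrow> tb n = 3 powr ((real n - 1) / 3) + (real n - 1) / 3"
proof -
  assume n: "n \<ge> 1"
  have lam: "lam = 3 powr (1 / 3)" by (simp add: lam_def root_powr_inverse)
  have "lam ^ (n - 1) = lam powr real (n - 1)" by (simp add: powr_realpow)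
  also have "\<dots> = 3 powr (1 / 3 * real (n - 1))" unfolding lam by (simp add: powr_powr)
  finally show ?thesis using n by (simp add: tb_def of_nat_diff)
qed

lemma tree_bound:
  assumes "is_tree T" "graph_order T = n" "n \<ge> 4"
  shows "real (\<Phi> T) \<le> tb n \<and> (real (\<Phi> T) = tb n \<longleftrightarrow> n mod 3 = 1 \<and> T \<simeq> T_star n)"
proof -
  obtain U where U: "represents [U] T" using tree_represented[OF assms(1)] by blast
  have P: "\<Phi> T = vg U" using represents_num_mds[OF U] by simp
  have n: "nsz U = n" using represents_order[OF U] assms(2) by simp
  have n4: "4 \<le> nsz U" using n assms(3) by simp
  have "real (\<Phi> T) = tb n" if m: "n mod 3 = 1" and iso: "T \<simeq> T_star n"
  proof -
    define k where "k = (n - 1) div 3"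
    have k: "n = 3 * k + 1" unfolding k_def using m assms(3) by presburger
    then have "(n - 1) div 3 = k" by simp
    then have "\<Phi> T = 3 ^ k + k"
      using iso_num_mds[OF represents_simple[OF U] iso represents_T_star] by (simp add: vg_T_star_tree del: rtree.map One_nat_def)
    then show ?thesis unfolding k tb_mod1 by simp
  qed
  moreover have "n mod 3 = 1 \<and> T \<simeq> T_star n" if eq: "real (\<Phi> T) = tb n"
  proof -
    \<comment> \<open>K_{1,4} and \<open>T_star_8\<close> stay strictly below \<open>tb\<close>, so
      equality leaves only the class \<open>Tstar_like\<close>.\<close>
    have "tb 5 > 5" "tb 8 > 15" using lam_gt lam2_gt by (simp_all add: tb_def lam_pow_eval)
    then have "Tstar_like U"
      using tree_dichotomy[OF n4] special_vg(2,3)[OF n4] eq n P by (auto simp: lesser_def)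
    moreover from this have "T \<simeq> T_star n"
      using like_iso[OF _ U represents_T_star] Tstar_like_T_star[OF _ n] by simp
    ultimately show ?thesis using special_vg(1)[OF n4] n by simp
  qed
  moreover have "real (\<Phi> T) \<le> tb n" using special_le_tb[OF n4 tree_dichotomy[OF n4]] n P by simp
  ultimately show ?thesis by blast
qed

theorem theorem2:
  shows
    "(\<forall>n \<ge> 4. \<forall>T :: 'a ugraph. is_tree T \<and> graph_order T = n \<longrightarrow>
        real (\<Phi> T) \<le> 3 powr ((real n - 1) / 3) + (real n - 1) / 3 \<and>
        (real (\<Phi> T) = 3 powr ((real n - 1) / 3) + (real n - 1) / 3 \<longleftrightarrow>
           n mod 3 = 1 \<and> T \<simeq> T_star n))
     \<and>
     (\<forall>n. 4 \<le> n \<and> n \<le> 6 \<longrightarrow> (\<forall>F :: 'b ugraph. is_forest F \<and> graph_order F = n \<longrightarrow>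
        \<Phi> F < f1 n \<longrightarrow> \<Phi> F \<le> f2 n))
     \<and>
     (\<forall>n \<ge> 7. \<forall>F :: 'b ugraph. is_forest F \<and> graph_order F = n \<longrightarrow>
        \<Phi> F < f1 n \<longrightarrow>
          \<Phi> F \<le> f2 n \<and>
          (\<Phi> F = f2 n \<longleftrightarrow>
             (n mod 3 = 1 \<and>
                F \<simeq> copies ((n - 7) div 3) (path_graph 3) \<uplus> T_star 7) \<or>
             (n mod 3 = 2 \<and>
                (F \<simeq> copies ((n - 8) div 3) (path_graph 3) \<uplus> T_star_8 \<or>
                 F \<simeq> copies ((n - 5) div 3) (path_graph 3) \<uplus> star_graph 4)) \<or>
             (n = 9 \<and>
                F \<simeq> star_graph 3 \<uplus> star_graph 4) \<or>
             (n mod 3 = 0 \<and> n \<ge> 12 \<and>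
                F \<simeq> copies ((n - 12) div 3) (path_graph 3) \<uplus> copies 3 (star_graph 3))))"
proof (intro conjI allI impI)
  fix n and T :: "'a ugraph"
  assume "4 \<le> n" and T: "is_tree T \<and> graph_order T = n"
  then show "real (\<Phi> T) \<le> 3 powr ((real n - 1) / 3) + (real n - 1) / 3"
    and "real (\<Phi> T) = 3 powr ((real n - 1) / 3) + (real n - 1) / 3 \<longleftrightarrow> n mod 3 = 1 \<and> T \<simeq> T_star n"
    using tree_bound[of T n] tb_powr[of n] by auto
next
  fix n and F :: "'b ugraph"
  assume n: "4 \<le> n \<and> n \<le> 6" and F: "is_forest F \<and> graph_order F = n" and lt: "\<Phi> F < f1 n"
  from n have "n = 4 \<or> n = 5 \<or> n = 6" by linarith
  then show "\<Phi> F \<le> f2 n"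
  \<comment> \<open>At orders 4 and 5 the value of \<open>f2\<close> is one less than that of
    \<open>f1\<close>, so only order 6 requires an argument.\<close>
  proof (elim disjE)
    assume "n = 6"
    then show ?thesis using forest_bound_6[of F] F lt by (simp add: f2_def)
  qed (use lt in \<open>simp_all add: f1_def f2_def\<close>)
next
  fix n and F :: "'b ugraph"
  assume n: "7 \<le> n" and F: "is_forest F \<and> graph_order F = n" and lt: "\<Phi> F < f1 n"
  then have B: "\<Phi> F \<le> f2 n \<and> (\<Phi> F = f2 n \<longrightarrow> extremal n F)" by (intro forest_bound) auto
  then show "\<Phi> F \<le> f2 n" ..
  have "simple_graph F" using F by (simp add: is_forest_def)
  then have "\<Phi> F = f2 n \<longleftrightarrow> extremal n F" using B extremal_num_mds n by blast
  then show "\<Phi> F = f2 n \<longleftrightarrow>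
      (n mod 3 = 1 \<and>
         F \<simeq> copies ((n - 7) div 3) (path_graph 3) \<uplus> T_star 7) \<or>
      (n mod 3 = 2 \<and>
         (F \<simeq> copies ((n - 8) div 3) (path_graph 3) \<uplus> T_star_8 \<or>
          F \<simeq> copies ((n - 5) div 3) (path_graph 3) \<uplus> star_graph 4)) \<or>
      (n = 9 \<and>
         F \<simeq> star_graph 3 \<uplus> star_graph 4) \<or>
      (n mod 3 = 0 \<and> n \<ge> 12 \<and>
         F \<simeq> copies ((n - 12) div 3) (path_graph 3) \<uplus> copies 3 (star_graph 3))"
    unfolding extremal_def .
qed

end
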